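(* For every positive integer $n$, the $\mathfrak{sl}(3)$ clasp $f_n$ of weight $(n,0)$ satisfies, in $\mathrm{Hom}(+^n,+^n)$, $$f_n=(f_{n-1}\otimes \mathrm{id}_+)+\sum_{i=2}^{n}\frac{[n+1-i]}{[n]}\;H_{i-1}\circ H_{i-2}\circ\cdots\circ H_2\circ H_1\circ (f_{n-1}\otimes \mathrm{id}_+).$$
   Context: Ground field $K=\mathbb{C}(q^{1/2})$; $[n]=\frac{q^{n/2}-q^{-n/2}}{q^{1/2}-q^{-1/2}}$. Webs. An $\mathfrak{sl}(3)$ web in a rectangle is a planar oriented graph (possibly with closed oriented loops without vertices), up to isotopy, all of whose interior vertices are trivalent and are either sources or sinks, and whose univalent vertices lie on the bottom and top sides of the rectangle. For words $s,t$ in the letters $+,-$, $\mathrm{Hom}(s,t)$ is the $K$-vector space spanned by webs whose bottom endpoints read $s$ and whose top endpoints read $t$ (left to right), where $+$ means that the strand there is oriented upward and $-$ downward, modulo the local relations: (1) a closed loop (either orientation) may be removed with factor $[3]$; (2) a bigon (two parallel edges between two vertices, with one outer leg at each vertex) equals $-[2]$ times the single oriented strand; (3) a square face with its four outer legs equals the sum of the two planar, orientation-compatible ways of joining the four legs by two disjoint arcs. Composition $w\circ v$ stacks $w$ on top of $v$; $\otimes$ is horizontal juxtaposition; $\mathrm{id}_s$ is the web of vertical strands. Clasps. The weight of a word with $a$ letters $+$ and $b$ letters $-$ is $(a,b)$, meaning $a\lambda_1+b\lambda_2$ ($\lambda_1,\lambda_2$ fundamental weights of $\mathfrak{sl}(3)$).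 The partial order on weights is generated by $(a,b)\succ(a+1,b-2)$ and $(a,b)\succ(a-2,b+1)$. The clasp $P_s\in\mathrm{Hom}(s,s)$ is the unique nonzero idempotent such that $w\circ P_s=0$ for all $w\in\mathrm{Hom}(s,t)$ and $P_s\circ w'=0$ for all $w'\in\mathrm{Hom}(t,s)$ whenever the weight of $t$ is strictly less than that of $s$. The clasp of weight $(n,0)$ is $f_n=P_{+^n}$ ($f_0$ is the empty web). The webs $H_k$. Let $H\in\mathrm{Hom}(++,++)$ be the web with one sink, joined to both bottom endpoints, one source, joined to both top endpoints, and an edge oriented from the source to the sink. For $1\le k\le n-1$, $H_k\in\mathrm{Hom}(+^n,+^n)$ is $H$ placed on the $k$-th and $(k+1)$-st strands counted from the right, with vertical strands elsewhere. *)

theory Defs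
  imports
    "HOL-Computational_Algebra.Polynomial"
    "HOL-Computational_Algebra.Fraction_Field"
    "HOL-Library.Poly_Mapping"
begin

text \<open>The ground field is the field of rational functions over the complex numbers in one
  indeterminate, which plays the role of \<open>q\<close> to the power \<open>1/2\<close>.\<close>

type_synonym K = "complex poly fract"

definition q_half :: K where
  "q_half = Fract [:0, 1:] 1"

definition qint :: "nat \<Rightarrow> K" where
  "qint n = (q_half ^ n - inverse q_half ^ n) / (q_half - inverse q_half)"

datatype sign = Plus | Minus

type_synonym word = "sign list"

primrec opp :: "sign \<Rightarrow> sign" where
  "opp Plus = Minus"
| "opp Minus = Plus"

text \<open>A web in generic position with respect to the height function of the rectangle is cut by
  horizontal and vertical lines into vertical strands, local minima, local maxima and trivalent
  vertices. So a drawing of a web is an expression in these pieces, built by stacking and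
  horizontal juxtaposition.

  \<^item> \<open>Cup e\<close> is a local minimum whose two upper endpoints read \<open>e\<close>, \<open>opp e\<close>;
    \<open>Cap e\<close> is a local maximum whose two lower endpoints read \<open>e\<close>, \<open>opp e\<close>.
  \<^item> \<open>Vertex e i\<close> is a trivalent vertex with \<open>i\<close> legs leaving through the bottom and
    \<open>3 - i\<close> legs leaving through the top. A leg at the bottom labelled \<open>Plus\<close> and a leg at the top
    labelled \<open>Minus\<close> both point into the vertex. So \<open>Vertex Plus i\<close> is a sink and
    \<open>Vertex Minus i\<close> is a source.
  \<^item> \<open>Stack w v\<close> is \<open>w\<close> on top of \<open>v\<close>, and \<open>Beside v w\<close> is \<open>v\<close> to the left of \<open>w\<close>.\<close>

datatype drawing =
    Strands word
  | Cup sign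
  | Cap sign
  | Vertex sign nat
  | Stack drawing drawing
  | Beside drawing drawing

primrec bottom_word :: "drawing \<Rightarrow> word" where
  "bottom_word (Strands s) = s"
| "bottom_word (Cup e) = []"
| "bottom_word (Cap e) = [e, opp e]"
| "bottom_word (Vertex e i) = replicate i e"
| "bottom_word (Stack w v) = bottom_word v"
| "bottom_word (Beside v w) = bottom_word v @ bottom_word w"

primrec top_word :: "drawing \<Rightarrow> word" where
  "top_word (Strands s) = s"
| "top_word (Cup e) = [e, opp e]"
| "top_word (Cap e) = []"
| "top_word (Vertex e i) = replicate (3 - i) (opp e)"
| "top_word (Stack w v) = top_word w"
| "top_word (Beside v w) = top_word v @ top_word w"

text \<open>Stacking requires that the endpoints and their orientations match.\<close>

primrec proper :: "drawing \<Rightarrow> bool" where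
  "proper (Strands s) \<longleftrightarrow> True"
| "proper (Cup e) \<longleftrightarrow> True"
| "proper (Cap e) \<longleftrightarrow> True"
| "proper (Vertex e i) \<longleftrightarrow> i \<le> 3"
| "proper (Stack w v) \<longleftrightarrow> proper w \<and> proper v \<and> bottom_word w = top_word v"
| "proper (Beside v w) \<longleftrightarrow> proper v \<and> proper w"

definition drawings :: "word \<Rightarrow> word \<Rightarrow> drawing set" where
  "drawings s t = {d. proper d \<and> bottom_word d = s \<and> top_word d = t}"

text \<open>Planar isotopy of drawings, fixing the endpoints. The rules from \<open>stack_assoc\<close> to
  \<open>interchange\<close> rescale the pieces and change their relative heights; \<open>zigzag_left\<close> and
  \<open>zigzag_right\<close> straighten a strand, cancelling a minimum against a maximum; \<open>bend_left\<close> and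
  \<open>bend_right\<close> swing the outermost upper leg of a vertex down to the bottom. A generic isotopy of
  planar trivalent graphs in the rectangle decomposes into these moves and their inverses.\<close>

inductive isotopic :: "drawing \<Rightarrow> drawing \<Rightarrow> bool" where
  refl: "isotopic d d"
| sym: "isotopic d e \<Longrightarrow> isotopic e d"
| trans: "isotopic d e \<Longrightarrow> isotopic e f \<Longrightarrow> isotopic d f"
| stack_cong: "isotopic w w' \<Longrightarrow> isotopic v v' \<Longrightarrow> isotopic (Stack w v) (Stack w' v')"
| beside_cong: "isotopic v v' \<Longrightarrow> isotopic w w' \<Longrightarrow> isotopic (Beside v w) (Beside v' w')"
| stack_assoc: "isotopic (Stack (Stack u w) v) (Stack u (Stack w v))"
| stack_top: "isotopic (Stack (Strands (top_word d)) d) d"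
| stack_bottom: "isotopic (Stack d (Strands (bottom_word d))) d"
| beside_assoc: "isotopic (Beside (Beside u v) w) (Beside u (Beside v w))"
| beside_empty_left: "isotopic (Beside (Strands []) d) d"
| beside_empty_right: "isotopic (Beside d (Strands [])) d"
| beside_strands: "isotopic (Beside (Strands s) (Strands t)) (Strands (s @ t))"
| interchange:
    "bottom_word w = top_word v \<Longrightarrow> bottom_word w' = top_word v' \<Longrightarrow>
     isotopic (Stack (Beside w w') (Beside v v')) (Beside (Stack w v) (Stack w' v'))"
| zigzag_left:
    "isotopic (Stack (Beside (Cap e) (Strands [e])) (Beside (Strands [e]) (Cup (opp e))))
              (Strands [e])"
| zigzag_right:
    "isotopic (Stack (Beside (Strands [e]) (Cap (opp e))) (Beside (Cup e) (Strands [e])))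
              (Strands [e])"
| bend_left:
    "i < 3 \<Longrightarrow>
     isotopic (Stack (Beside (Cap e) (Strands (replicate (2 - i) (opp e))))
                     (Beside (Strands [e]) (Vertex e i)))
              (Vertex e (Suc i))"
| bend_right:
    "i < 3 \<Longrightarrow>
     isotopic (Stack (Beside (Strands (replicate (2 - i) (opp e))) (Cap (opp e)))
                     (Beside (Vertex e i) (Strands [e])))
              (Vertex e (Suc i))"

lemma isotopic_same_boundary:
  "isotopic d e \<Longrightarrow> d \<in> drawings s t \<longleftrightarrow> e \<in> drawings s t"
proof -
  assume "isotopic d e"
  then have "proper d = proper e \<and> bottom_word d = bottom_word e \<and> top_word d = top_word e"
  proof (induction rule: isotopic.induct)
    case (bend_left i e)
    then have "i = 0 \<or> i = 1 \<or> i = 2" by auto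
    then show ?case by (cases e) (auto simp: numeral_2_eq_2 numeral_3_eq_3)
  next
    case (bend_right i e)
    then have "i = 0 \<or> i = 1 \<or> i = 2" by auto
    then show ?case by (cases e) (auto simp: numeral_2_eq_2 numeral_3_eq_3)
  next
    case (zigzag_left e)
    then show ?case by (cases e) auto
  next
    case (zigzag_right e)
    then show ?case by (cases e) auto
  qed auto
  then show ?thesis by (simp add: drawings_def)
qed

type_synonym comb = "drawing \<Rightarrow>\<^sub>0 K"

definition scale :: "K \<Rightarrow> comb \<Rightarrow> comb" where
  "scale c x = Poly_Mapping.map ((*) c) x"

abbreviation pic :: "drawing \<Rightarrow> comb" where
  "pic d \<equiv> Poly_Mapping.single d 1"

definition bilin :: "(drawing \<Rightarrow> drawing \<Rightarrow> drawing) \<Rightarrow> comb \<Rightarrow> comb \<Rightarrow> comb" where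
  "bilin f x y = (\<Sum>d\<in>Poly_Mapping.keys x. \<Sum>e\<in>Poly_Mapping.keys y.
     Poly_Mapping.single (f d e) (Poly_Mapping.lookup x d * Poly_Mapping.lookup y e))"

definition bigon :: "sign \<Rightarrow> drawing" where
  "bigon e = Stack (Vertex (opp e) 2) (Vertex e 1)"

text \<open>The square has its four vertices at the corners: the two lower ones carry the outer legs
  going down, the two upper ones those going up. The lower side of the square is a \<open>Cap\<close>, the
  upper side a \<open>Cup\<close>, and the two vertical sides are strands.\<close>

definition square :: "sign \<Rightarrow> drawing" where
  "square e =
     Stack (Beside (Vertex (opp e) 2) (Vertex e 2))
    (Stack (Beside (Strands [opp e]) (Beside (Cup (opp e)) (Strands [e])))
    (Stack (Beside (Strands [opp e]) (Beside (Cap (opp e)) (Strands [e])))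
           (Beside (Vertex e 1) (Vertex (opp e) 1))))"

text \<open>The span of all relations, closed under placing them inside a larger web. A drawing that is
  not proper is not a web and is identified with \<open>0\<close>, so that a composition with mismatched
  endpoints is \<open>0\<close>.\<close>

inductive_set relations :: "comb set" where
  zero: "0 \<in> relations"
| add: "x \<in> relations \<Longrightarrow> y \<in> relations \<Longrightarrow> x + y \<in> relations"
| scale: "x \<in> relations \<Longrightarrow> scale c x \<in> relations"
| improper: "\<not> proper d \<Longrightarrow> pic d \<in> relations"
| isotopy: "isotopic d e \<Longrightarrow> pic d - pic e \<in> relations"
| loop: "pic (Stack (Cap e) (Cup e)) - scale (qint 3) (pic (Strands [])) \<in> relations"
| bigon: "pic (bigon e) - scale (- qint 2) (pic (Strands [e])) \<in> relations"
| square: "pic (square e) - (pic (Strands [e, opp e]) + pic (Stack (Cup e) (Cap e))) \<in> relations"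
| stack_left: "x \<in> relations \<Longrightarrow> bilin Stack x y \<in> relations"
| stack_right: "y \<in> relations \<Longrightarrow> bilin Stack x y \<in> relations"
| beside_left: "x \<in> relations \<Longrightarrow> bilin Beside x y \<in> relations"
| beside_right: "y \<in> relations \<Longrightarrow> bilin Beside x y \<in> relations"

lemma lookup_scale: "Poly_Mapping.lookup (scale c x) d = c * Poly_Mapping.lookup x d"
  unfolding scale_def by transfer (simp add: when_def)

lemma scale_add_right: "scale c (x + y) = scale c x + scale c y"
  by (rule poly_mapping_eqI) (simp add: lookup_scale lookup_add algebra_simps)

lemma scale_add_left: "scale (a + b) x = scale a x + scale b x"
  by (rule poly_mapping_eqI) (simp add: lookup_scale lookup_add algebra_simps)

lemma scale_scale: "scale a (scale b x) = scale (a * b) x"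
  by (rule poly_mapping_eqI) (simp add: lookup_scale algebra_simps)

lemma scale_one: "scale 1 x = x"
  by (rule poly_mapping_eqI) (simp add: lookup_scale)

lemma scale_minus_one: "scale (- 1) x = - x"
  by (rule poly_mapping_eqI) (simp add: lookup_scale)

lemma scale_diff_right: "scale c (x - y) = scale c x - scale c y"
  by (rule poly_mapping_eqI) (simp add: lookup_scale lookup_minus algebra_simps)

lemma bilin_supset:
  assumes "finite A" "Poly_Mapping.keys x \<subseteq> A" "finite B" "Poly_Mapping.keys y \<subseteq> B"
  shows "bilin f x y = (\<Sum>d\<in>A. \<Sum>e\<in>B.
    Poly_Mapping.single (f d e) (Poly_Mapping.lookup x d * Poly_Mapping.lookup y e))"
proof -
  have "bilin f x y = (\<Sum>d\<in>A. \<Sum>e\<in>Poly_Mapping.keys y.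
      Poly_Mapping.single (f d e) (Poly_Mapping.lookup x d * Poly_Mapping.lookup y e))"
    unfolding bilin_def
    by (rule sum.mono_neutral_left) (use assms in \<open>auto simp: in_keys_iff\<close>)
  also have "\<dots> = (\<Sum>d\<in>A. \<Sum>e\<in>B.
      Poly_Mapping.single (f d e) (Poly_Mapping.lookup x d * Poly_Mapping.lookup y e))"
    by (intro sum.cong refl sum.mono_neutral_left) (use assms in \<open>auto simp: in_keys_iff\<close>)
  finally show ?thesis .
qed

lemma bilin_diff_left: "bilin f (x - x') y = bilin f x y - bilin f x' y"
proof -
  let ?A = "Poly_Mapping.keys x \<union> Poly_Mapping.keys x'" and ?B = "Poly_Mapping.keys y"
  have k: "Poly_Mapping.keys (x - x') \<subseteq> ?A"
    by (auto simp: in_keys_iff lookup_minus)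
  show ?thesis
    using k by (subst (1 2 3) bilin_supset[of ?A _ ?B])
      (auto simp: lookup_minus left_diff_distrib single_diff sum_subtractf)
qed

lemma bilin_diff_right: "bilin f x (y - y') = bilin f x y - bilin f x y'"
proof -
  let ?B = "Poly_Mapping.keys y \<union> Poly_Mapping.keys y'" and ?A = "Poly_Mapping.keys x"
  have k: "Poly_Mapping.keys (y - y') \<subseteq> ?B"
    by (auto simp: in_keys_iff lookup_minus)
  show ?thesis
    using k by (subst (1 2 3) bilin_supset[of ?A _ ?B])
      (auto simp: lookup_minus right_diff_distrib single_diff sum_subtractf)
qed

lemma relations_uminus: "x \<in> relations \<Longrightarrow> - x \<in> relations"
  using relations.scale[of x "- 1"] by (simp add: scale_minus_one)

text \<open>The type \<open>skein\<close> is the direct sum of all the spaces \<open>Hom s t\<close>.\<close>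

quotient_type skein = comb / "\<lambda>x y. x - y \<in> relations"
proof (rule equivpI)
  show "reflp (\<lambda>x y. x - y \<in> relations)"
    by (simp add: reflp_def relations.zero)
  show "symp (\<lambda>x y. x - y \<in> relations)"
    unfolding symp_def by (metis relations_uminus minus_diff_eq)
  show "transp (\<lambda>x y. x - y \<in> relations)"
  proof (rule transpI)
    fix x y z :: comb
    assume "x - y \<in> relations" "y - z \<in> relations"
    from relations.add[OF this] show "x - z \<in> relations" by simp
  qed
qed

instantiation skein :: ab_group_add
begin

lift_definition zero_skein :: skein is "0 :: comb" .

lift_definition plus_skein :: "skein \<Rightarrow> skein \<Rightarrow> skein" is "(+)"
  by (metis relations.add add_diff_add)

lift_definition uminus_skein :: "skein \<Rightarrow> skein" is uminus
  by (metis relations_uminus minus_diff_commute minus_diff_eq minus_diff_minus)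

lift_definition minus_skein :: "skein \<Rightarrow> skein \<Rightarrow> skein" is "(-)"
proof -
  fix a b c d :: comb
  assume "a - b \<in> relations" "c - d \<in> relations"
  then have "(a - b) + - (c - d) \<in> relations"
    by (intro relations.add relations_uminus)
  then show "(a - c) - (b - d) \<in> relations"
    by (simp add: algebra_simps)
qed

instance
  by standard (transfer; simp add: algebra_simps relations.zero)+

end

lift_definition smult :: "K \<Rightarrow> skein \<Rightarrow> skein" (infixr "*\<^sub>K" 75) is scale
  by (metis relations.scale scale_diff_right)

interpretation skein: vector_space smult
  by standard
    (transfer; simp add: scale_add_right scale_add_left scale_scale scale_one relations.zero)+

lift_definition compose :: "skein \<Rightarrow> skein \<Rightarrow> skein" (infixr "\<odot>" 70) is "bilin Stack"
proof -
  fix x x' y y' :: comb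
  assume "x - x' \<in> relations" "y - y' \<in> relations"
  then have "bilin Stack (x - x') y + bilin Stack x' (y - y') \<in> relations"
    by (intro relations.add relations.stack_left relations.stack_right)
  then show "bilin Stack x y - bilin Stack x' y' \<in> relations"
    by (simp add: bilin_diff_left bilin_diff_right)
qed

lift_definition tensor :: "skein \<Rightarrow> skein \<Rightarrow> skein" (infixr "\<otimes>" 72) is "bilin Beside"
proof -
  fix x x' y y' :: comb
  assume "x - x' \<in> relations" "y - y' \<in> relations"
  then have "bilin Beside (x - x') y + bilin Beside x' (y - y') \<in> relations"
    by (intro relations.add relations.beside_left relations.beside_right)
  then show "bilin Beside x y - bilin Beside x' y' \<in> relations"
    by (simp add: bilin_diff_left bilin_diff_right)
qed

lift_definition web :: "drawing \<Rightarrow> skein" is pic .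

definition Hom :: "word \<Rightarrow> word \<Rightarrow> skein set" where
  "Hom s t = skein.span (web ` drawings s t)"

definition id_web :: "word \<Rightarrow> skein" where
  "id_web s = web (Strands s)"

definition weight :: "word \<Rightarrow> int \<times> int" where
  "weight s = (int (count_list s Plus), int (count_list s Minus))"

text \<open>Intermediate weights need not be dominant, hence pairs of integers.\<close>

inductive weight_less :: "int \<times> int \<Rightarrow> int \<times> int \<Rightarrow> bool" (infix "\<prec>" 50) where
  "(a + 1, b - 2) \<prec> (a, b)"
| "(a - 2, b + 1) \<prec> (a, b)"
| "x \<prec> y \<Longrightarrow> y \<prec> z \<Longrightarrow> x \<prec> z"

definition is_clasp :: "word \<Rightarrow> skein \<Rightarrow> bool" where
  "is_clasp s P \<longleftrightarrow>
     P \<in> Hom s s \<and> P \<noteq> 0 \<and> P \<odot> P = P \<and>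
     (\<forall>t. weight t \<prec> weight s \<longrightarrow>
        (\<forall>w\<in>Hom s t. w \<odot> P = 0) \<and> (\<forall>w'\<in>Hom t s. P \<odot> w' = 0))"

definition clasp :: "word \<Rightarrow> skein" where
  "clasp s = (THE P. is_clasp s P)"

definition f_clasp :: "nat \<Rightarrow> skein" where
  "f_clasp n = clasp (replicate n Plus)"

definition H_web :: skein where
  "H_web = web (Stack (Vertex Minus 1) (Vertex Plus 2))"

text \<open>For \<open>1 \<le> k < n\<close>; strands are counted from the right.\<close>

definition H_at :: "nat \<Rightarrow> nat \<Rightarrow> skein" where
  "H_at n k = id_web (replicate (n - k - 1) Plus) \<otimes> H_web \<otimes> id_web (replicate (k - 1) Plus)"

end

theory Submission
  imports Defs
begin

text \<open>
  Let \<open>Y\<close> be the vertex merging two neighbouring upward strands. The clasp of weight \<open>(n, 0)\<close> is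
  the only combination of webs that differs from the identity by an element of the left ideal
  generated by the \<open>Y\<close>s and that is killed by all \<open>Y\<close>s from above. The reason is that every web from
  \<open>+\<^sup>n\<close> to a word with fewer than \<open>n\<close> letters lies in this left ideal. To see this, bend all upper
  endpoints down: a web with lower endpoints \<open>a @ b\<close>, where \<open>a\<close> is longer than \<open>b\<close>, can be rewritten
  so that it begins with crossings of oppositely oriented strands of \<open>a\<close> followed by a cap or a \<open>Y\<close>
  on two strands of \<open>a\<close>. This is shown by induction on the number of generators of the web, the
  letters of \<open>b\<close> being moved over to \<open>a\<close> one after the other. Reflection in a horizontal line then
  shows that the clasp is also killed from below, and it is nonzero because its highest weight
  coefficient in the tensor power of the three-dimensional representation is 1.

  It remains to see that the right-hand side of the recursion is killed by the \<open>Y\<close> on the strands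
  \<open>j\<close> and \<open>j + 1\<close>. Only the terms \<open>i = j, j + 1, j + 2\<close> survive, they are proportional to each other
  by the bigon and square relations, and they cancel because of \<open>[m + 2] - [2] [m + 1] + [m] = 0\<close>.
\<close>

section \<open>The category of webs\<close>

text \<open>A geometric proof would count faces. Webs here are expressions and not embedded graphs,
  so the number of stacked generators takes the place of such a count. The obstacle is that a cap or
  a merging found high up in a web has to be pulled down to the lower boundary, past the crossings
  \<open>X_web\<close> in its way. A crossing is invertible only up to a cup over a cap, because two
  opposite crossings form a square. That extra term is itself reducible, so modulo reducible webs
  crossings can be moved almost like permutations. The exchanges used, such as
  \<open>cap_X_right\<close>, \<open>Y_X\<close> and \<open>X_cup\<close>, replace two generators by
  two, and resolving loops, bigons and squares never needs more generators than before; this keeps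
  the induction on their number alive. Since \<open>clasp\<close> is defined by \<open>THE\<close>,
  existence and uniqueness are both at stake. Uniqueness rests on a second consequence of
  reducibility: every endomorphism of \<open>n\<close> upward strands is a scalar modulo the left
  ideal. Existence comes from the recursion itself.\<close>

lemma bilin_single_left:
  "bilin f (Poly_Mapping.single d c) y
    = (\<Sum>e\<in>Poly_Mapping.keys y. Poly_Mapping.single (f d e) (c * Poly_Mapping.lookup y e))"
  by (cases "c = 0") (auto simp: bilin_def)

lemma bilin_add_left: "bilin f (x + x') y = bilin f x y + bilin f x' y"
  using bilin_diff_left[of f "x + x'" x' y] by (simp add: algebra_simps)

lemma bilin_add_right: "bilin f x (y + y') = bilin f x y + bilin f x y'"
  using bilin_diff_right[of f x "y + y'" y'] by (simp add: algebra_simps)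

lemma scale_zero_right: "scale c 0 = 0"
  by (rule poly_mapping_eqI) (simp add: lookup_scale)

lemma scale_sum: "scale c (sum g A) = (\<Sum>a\<in>A. scale c (g a))"
  by (induction A rule: infinite_finite_induct) (auto simp: scale_add_right scale_zero_right)

lemma scale_single: "scale c (Poly_Mapping.single d b) = Poly_Mapping.single d (c * b)"
  by (rule poly_mapping_eqI) (simp add: lookup_scale lookup_single when_def)

lemma keys_scale: "Poly_Mapping.keys (scale c x) \<subseteq> Poly_Mapping.keys x"
  by (auto simp: in_keys_iff lookup_scale)

lemma bilin_scale_left: "bilin f (scale c x) y = scale c (bilin f x y)"
  by (subst bilin_supset[of "Poly_Mapping.keys x" _ "Poly_Mapping.keys y"])
    (auto simp: keys_scale bilin_def scale_sum scale_single lookup_scale mult.assoc)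

lemma bilin_scale_right: "bilin f x (scale c y) = scale c (bilin f x y)"
  by (subst bilin_supset[of "Poly_Mapping.keys x" _ "Poly_Mapping.keys y"])
    (auto simp: keys_scale bilin_def scale_sum scale_single lookup_scale mult.left_commute)

lemma comb_eq_sum: "x = (\<Sum>d\<in>Poly_Mapping.keys x. scale (Poly_Mapping.lookup x d) (pic d))"
proof (rule poly_mapping_eqI)
  fix e
  have "(\<Sum>d\<in>Poly_Mapping.keys x. Poly_Mapping.lookup x d when d = e) = Poly_Mapping.lookup x e"
    by (cases "e \<in> Poly_Mapping.keys x") (auto simp: when_def in_keys_iff)
  then show "Poly_Mapping.lookup x e = Poly_Mapping.lookup
      (\<Sum>d\<in>Poly_Mapping.keys x. scale (Poly_Mapping.lookup x d) (pic d)) e"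
    by (simp add: lookup_sum scale_single lookup_single)
qed

lemma compose_web: "web d \<odot> web e = web (Stack d e)"
  by transfer (simp add: bilin_single_left relations.zero)

lemma tensor_web: "web d \<otimes> web e = web (Beside d e)"
  by transfer (simp add: bilin_single_left relations.zero)

lemma web_isotopic: "isotopic d e \<Longrightarrow> web d = web e"
  by transfer (rule relations.isotopy)

lemma web_improper: "\<not> proper d \<Longrightarrow> web d = 0"
  by transfer (simp add: relations.improper)

lemma compose_add_left: "(x + y) \<odot> z = x \<odot> z + y \<odot> z"
  by transfer (simp add: bilin_add_left relations.zero)

lemma compose_add_right: "z \<odot> (x + y) = z \<odot> x + z \<odot> y"
  by transfer (simp add: bilin_add_right relations.zero)

lemma compose_scale_left: "(c *\<^sub>K x) \<odot> z = c *\<^sub>K (x \<odot> z)"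
  by transfer (simp add: bilin_scale_left relations.zero)

lemma compose_scale_right: "z \<odot> (c *\<^sub>K x) = c *\<^sub>K (z \<odot> x)"
  by transfer (simp add: bilin_scale_right relations.zero)

lemma tensor_add_left: "(x + y) \<otimes> z = x \<otimes> z + y \<otimes> z"
  by transfer (simp add: bilin_add_left relations.zero)

lemma tensor_add_right: "z \<otimes> (x + y) = z \<otimes> x + z \<otimes> y"
  by transfer (simp add: bilin_add_right relations.zero)

lemma tensor_scale_left: "(c *\<^sub>K x) \<otimes> z = c *\<^sub>K (x \<otimes> z)"
  by transfer (simp add: bilin_scale_left relations.zero)

lemma tensor_scale_right: "z \<otimes> (c *\<^sub>K x) = c *\<^sub>K (z \<otimes> x)"
  by transfer (simp add: bilin_scale_right relations.zero)

lemma compose_zero_left [simp]: "0 \<odot> x = 0"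
  using compose_add_left[of 0 0 x] by simp

lemma compose_zero_right [simp]: "x \<odot> 0 = 0"
  using compose_add_right[of x 0 0] by simp

lemma tensor_zero_left [simp]: "0 \<otimes> x = 0"
  using tensor_add_left[of 0 0 x] by simp

lemma tensor_zero_right [simp]: "x \<otimes> 0 = 0"
  using tensor_add_right[of x 0 0] by simp

lemma compose_minus_left: "(- x) \<odot> z = - (x \<odot> z)"
  using compose_scale_left[of "- 1" x z] by simp

lemma compose_minus_right: "z \<odot> (- x) = - (z \<odot> x)"
  using compose_scale_right[of z "- 1" x] by simp

lemma tensor_minus_left: "(- x) \<otimes> z = - (x \<otimes> z)"
  using tensor_scale_left[of "- 1" x z] by simp

lemma tensor_minus_right: "z \<otimes> (- x) = - (z \<otimes> x)"
  using tensor_scale_right[of z "- 1" x] by simp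

lemmas bilinear = compose_add_left compose_add_right compose_scale_left compose_scale_right
  tensor_add_left tensor_add_right tensor_scale_left tensor_scale_right
  compose_minus_left compose_minus_right tensor_minus_left tensor_minus_right

lemma compose_sum_right: "z \<odot> sum g A = (\<Sum>a\<in>A. z \<odot> g a)"
  by (induction A rule: infinite_finite_induct) (auto simp: compose_add_right)

text \<open>Every element of \<open>skein\<close> is a finite combination of drawings. Multilinear
  laws such as associativity thereby reduce to a single isotopy move.\<close>

lemma skein_induct [case_names zero web scale add]:
  assumes "P 0" "\<And>d. P (web d)" "\<And>c x. P x \<Longrightarrow> P (c *\<^sub>K x)" "\<And>x y. P x \<Longrightarrow> P y \<Longrightarrow> P (x + y)"
  shows "P x"
proof -
  obtain r where r: "x = abs_skein r" by (metis Quotient3_abs_rep Quotient3_skein)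
  have s: "abs_skein (scale c (pic d)) = c *\<^sub>K web d" for c d
    by (simp add: web.abs_eq smult.abs_eq)
  have "P (abs_skein (\<Sum>d\<in>A. scale (h d) (pic d)))" if "finite A" for A h
    using that
    by (induction A) (auto simp: zero_skein.abs_eq[symmetric] plus_skein.abs_eq[symmetric] s assms)
  then show ?thesis
    unfolding r by (subst comb_eq_sum) simp
qed

lemma compose_assoc: "(x \<odot> y) \<odot> z = x \<odot> y \<odot> z"
proof (induction x rule: skein_induct)
  case (web d)
  show ?case
  proof (induction y rule: skein_induct)
    case (web d')
    show ?case
      by (induction z rule: skein_induct)
        (simp_all add: bilinear compose_web web_isotopic[OF isotopic.stack_assoc])
  qed (simp_all add: bilinear)
qed (simp_all add: bilinear)

lemma tensor_assoc: "(x \<otimes> y) \<otimes> z = x \<otimes> y \<otimes> z"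
proof (induction x rule: skein_induct)
  case (web d)
  show ?case
  proof (induction y rule: skein_induct)
    case (web d')
    show ?case
      by (induction z rule: skein_induct)
        (simp_all add: bilinear tensor_web web_isotopic[OF isotopic.beside_assoc])
  qed (simp_all add: bilinear)
qed (simp_all add: bilinear)

lemma id_web_Nil_tensor [simp]: "id_web [] \<otimes> x = x"
  by (induction x rule: skein_induct)
    (simp_all add: bilinear id_web_def tensor_web web_isotopic[OF isotopic.beside_empty_left])

lemma tensor_id_web_Nil [simp]: "x \<otimes> id_web [] = x"
  by (induction x rule: skein_induct)
    (simp_all add: bilinear id_web_def tensor_web web_isotopic[OF isotopic.beside_empty_right])

lemma id_web_tensor_id_web: "id_web s \<otimes> id_web t = id_web (s @ t)"
  by (simp add: id_web_def tensor_web web_isotopic[OF isotopic.beside_strands])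

lemma Hom_induct [consumes 1, case_names web zero add scale]:
  assumes "x \<in> Hom s t" "\<And>d. d \<in> drawings s t \<Longrightarrow> P (web d)" "P 0"
    "\<And>x y. P x \<Longrightarrow> P y \<Longrightarrow> P (x + y)" "\<And>c x. P x \<Longrightarrow> P (c *\<^sub>K x)"
  shows "P x"
  using assms(1) unfolding Hom_def
  by (rule skein.span_induct_alt) (use assms(2-) in auto)

lemma Hom_zero [simp]: "0 \<in> Hom s t"
  unfolding Hom_def by (rule skein.span_zero)

lemma Hom_add: "x \<in> Hom s t \<Longrightarrow> y \<in> Hom s t \<Longrightarrow> x + y \<in> Hom s t"
  unfolding Hom_def by (rule skein.span_add)

lemma Hom_scale: "x \<in> Hom s t \<Longrightarrow> c *\<^sub>K x \<in> Hom s t"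
  unfolding Hom_def by (rule skein.span_scale)

lemma Hom_web: "d \<in> drawings s t \<Longrightarrow> web d \<in> Hom s t"
  unfolding Hom_def by (intro skein.span_base imageI)

lemma Hom_id_web [simp]: "id_web s \<in> Hom s s"
  unfolding id_web_def by (rule Hom_web) (simp add: drawings_def)

lemma Hom_compose: "y \<in> Hom t u \<Longrightarrow> x \<in> Hom s t \<Longrightarrow> y \<odot> x \<in> Hom s u"
proof (induction y rule: Hom_induct)
  case (web e)
  from web(2) show ?case
  proof (induction x rule: Hom_induct)
    case (web d)
    then show ?case using \<open>e \<in> drawings t u\<close>
      by (auto simp: compose_web drawings_def intro!: Hom_web)
  qed (auto simp: bilinear Hom_add Hom_scale)
qed (auto simp: bilinear Hom_add Hom_scale)

lemma Hom_tensor: "x \<in> Hom s t \<Longrightarrow> y \<in> Hom s' t' \<Longrightarrow> x \<otimes> y \<in> Hom (s @ s') (t @ t')"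
proof (induction x rule: Hom_induct)
  case (web d)
  from web(2) show ?case
  proof (induction y rule: Hom_induct)
    case (web e)
    then show ?case using \<open>d \<in> drawings s t\<close>
      by (auto simp: tensor_web drawings_def intro!: Hom_web)
  qed (auto simp: bilinear Hom_add Hom_scale)
qed (auto simp: bilinear Hom_add Hom_scale)

lemma id_web_compose: "x \<in> Hom s t \<Longrightarrow> id_web t \<odot> x = x"
proof (induction x rule: Hom_induct)
  case (web d)
  then show ?case
    using web_isotopic[OF isotopic.stack_top[of d]]
      by (auto simp: id_web_def compose_web drawings_def)
qed (auto simp: bilinear)

lemma compose_id_web: "x \<in> Hom s t \<Longrightarrow> x \<odot> id_web s = x"
proof (induction x rule: Hom_induct)
  case (web d)
  then show ?case
    using web_isotopic[OF isotopic.stack_bottom[of d]]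
      by (auto simp: id_web_def compose_web drawings_def)
qed (auto simp: bilinear)

lemma interchange:
  assumes "x \<in> Hom s t" "y \<in> Hom t u" "x' \<in> Hom s' t'" "y' \<in> Hom t' u'"
  shows "(y \<otimes> y') \<odot> (x \<otimes> x') = (y \<odot> x) \<otimes> (y' \<odot> x')"
  using assms(1)
proof (induction x rule: Hom_induct)
  case (web d)
  show ?case using assms(2)
  proof (induction y rule: Hom_induct)
    case (web e)
    show ?case using assms(3)
    proof (induction x' rule: Hom_induct)
      case (web d')
      show ?case using assms(4)
      proof (induction y' rule: Hom_induct)
        case (web e')
        show ?case
          using web_isotopic[OF isotopic.interchange[of e d e' d']] \<open>d \<in> drawings s t\<close>
            \<open>e \<in> drawings t u\<close> \<open>d' \<in> drawings s' t'\<close> \<open>e' \<in> drawings t' u'\<close>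
          by (simp add: tensor_web compose_web drawings_def)
      qed (auto simp: bilinear)
    qed (auto simp: bilinear)
  qed (auto simp: bilinear)
qed (auto simp: bilinear)

section \<open>Webs inserted between vertical strands\<close>

definition pad :: "word \<Rightarrow> skein \<Rightarrow> word \<Rightarrow> skein" where
  "pad a x b = id_web a \<otimes> x \<otimes> id_web b"

lemma Hom_pad: "x \<in> Hom s t \<Longrightarrow> pad a x b \<in> Hom (a @ s @ b) (a @ t @ b)"
  unfolding pad_def by (intro Hom_tensor Hom_id_web)

lemma pad_add: "pad a (x + y) b = pad a x b + pad a y b"
  by (simp add: pad_def bilinear)

lemma pad_scale: "pad a (c *\<^sub>K x) b = c *\<^sub>K pad a x b"
  by (simp add: pad_def bilinear)

lemma pad_minus: "pad a (- x) b = - pad a x b"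
  by (simp add: pad_def bilinear)

lemma pad_zero [simp]: "pad a 0 b = 0"
  by (simp add: pad_def)

lemma pad_Nil [simp]: "pad [] x [] = x"
  by (simp add: pad_def)

lemma pad_id_web [simp]: "pad a (id_web s) b = id_web (a @ s @ b)"
  by (simp add: pad_def id_web_tensor_id_web)

lemma pad_pad [simp]: "pad a (pad c x d) b = pad (a @ c) x (d @ b)"
  by (simp add: pad_def tensor_assoc id_web_tensor_id_web[symmetric])

lemma pad_compose:
  assumes "x \<in> Hom s t" "y \<in> Hom t u"
  shows "pad a (y \<odot> x) b = pad a y b \<odot> pad a x b"
proof -
  have "id_web a \<otimes> (y \<odot> x) \<otimes> id_web b
      = (id_web a \<odot> id_web a) \<otimes> ((y \<odot> x) \<otimes> (id_web b \<odot> id_web b))"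
    using id_web_compose[OF Hom_id_web] by simp
  also have "\<dots> = (id_web a \<otimes> y \<otimes> id_web b) \<odot> (id_web a \<otimes> x \<otimes> id_web b)"
    using interchange[OF assms Hom_id_web Hom_id_web, of b]
      interchange[OF Hom_id_web[of a] Hom_id_web Hom_tensor[OF assms(1) Hom_id_web[of b]]
        Hom_tensor[OF assms(2) Hom_id_web[of b]]]
    by simp
  finally show ?thesis by (simp add: pad_def)
qed

text \<open>Pieces at disjoint positions exchange their heights; \<open>b\<close> is the word
  between them. This is the form in which the interchange law is mostly used.\<close>

lemma pad_commute:
  assumes "x \<in> Hom s t" "y \<in> Hom s' t'"
  shows "pad a x (b @ t' @ c) \<odot> pad (a @ s @ b) y c = pad (a @ t @ b) y c \<odot> pad a x (b @ s' @ c)"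
proof -
  have X: "pad a x [] \<in> Hom (a @ s) (a @ t)" using Hom_pad[OF assms(1), of a "[]"] by simp
  have Y: "pad b y c \<in> Hom (b @ s' @ c) (b @ t' @ c)" using Hom_pad[OF assms(2)] by simp
  have split: "pad a x w = pad a x [] \<otimes> id_web w" "pad (w @ b) y c = id_web w \<otimes> pad b y c" for w
    by (simp_all add: pad_def tensor_assoc id_web_tensor_id_web[symmetric])
  show ?thesis
    using interchange[OF Hom_id_web X Y Hom_id_web] interchange[OF X Hom_id_web Hom_id_web Y]
      split(2)[of "a @ s"] split(2)[of "a @ t"]
    by (simp add: split(1)[of "b @ t' @ c"] split(1)[of "b @ s' @ c"]
        id_web_compose[OF X] compose_id_web[OF X] id_web_compose[OF Y] compose_id_web[OF Y])
qed

lemma pad_compose':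
  "x \<in> Hom s t \<Longrightarrow> y \<in> Hom t' u \<Longrightarrow> t = t' \<Longrightarrow> pad a (y \<odot> x) b = pad a y b \<odot> pad a x b"
  using pad_compose by simp

section \<open>Local relations\<close>

lemma opp_opp [simp]: "opp (opp e) = e"
  by (cases e) auto

lemma opp_neq [simp]: "opp e \<noteq> e" "e \<noteq> opp e"
  by (cases e; simp)+

lemma neq_opp_iff: "h \<noteq> e \<longleftrightarrow> h = opp e"
  by (cases h; cases e) auto

abbreviation "cap_web e \<equiv> web (Cap e)"
abbreviation "cup_web e \<equiv> web (Cup e)"
abbreviation "Y_web e \<equiv> web (Vertex e 2)"
abbreviation "L_web e \<equiv> web (Vertex e (Suc 0))"

lemma Hom_cap_web [simp]: "cap_web e \<in> Hom [e, opp e] []"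
  by (rule Hom_web) (simp add: drawings_def)

lemma Hom_cup_web [simp]: "cup_web e \<in> Hom [] [e, opp e]"
  by (rule Hom_web) (simp add: drawings_def)

lemma Hom_Y_web [simp]: "Y_web e \<in> Hom [e, e] [opp e]"
  by (rule Hom_web) (simp add: drawings_def numeral_2_eq_2)

lemma Hom_L_web [simp]: "L_web e \<in> Hom [e] [opp e, opp e]"
  by (rule Hom_web) (simp add: drawings_def numeral_2_eq_2)

text \<open>The two trivalent vertices of an \<open>H\<close> whose bar is horizontal, so that the orientations of
  its two sides are exchanged.\<close>

definition X_web :: "sign \<Rightarrow> skein" where
  "X_web e = pad [opp e] (Y_web (opp e)) [] \<odot> pad [] (L_web e) [opp e]"

lemma Hom_X_web [simp]: "X_web e \<in> Hom [e, opp e] [opp e, e]"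
  unfolding X_web_def
  by (rule Hom_compose[where t = "[opp e, opp e, opp e]"])
    (use Hom_pad[OF Hom_Y_web, of "[opp e]" "opp e" "[]"]
      Hom_pad[OF Hom_L_web, of "[]" e "[opp e]"] in simp_all)

text \<open>Composition nests to the right, so two adjacent layers of a longer composite appear only
  in front of a remainder \<open>r\<close>. With \<open>THEN\<close> this turns a relation between
  two layers into a rewrite rule for that situation.\<close>

lemma compose_eq_cont: "x \<odot> y = z \<Longrightarrow> x \<odot> y \<odot> r = z \<odot> r"
  by (simp add: compose_assoc[symmetric])

text \<open>A local relation is verified once with the smallest padding and then transported to
  arbitrary surrounding words \<open>a\<close> and \<open>b\<close>.\<close>

lemma pad_rel:
  assumes "pad p x q \<odot> pad p' x' q' = z"
    and "x \<in> Hom s t" "x' \<in> Hom s' t'" "p @ s @ q = p' @ t' @ q'"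
  shows "pad (a @ p) x (q @ b) \<odot> pad (a @ p') x' (q' @ b) = pad a z b"
  using pad_compose[OF Hom_pad[OF assms(3)], of "pad p x q" p' q' _ a b]
    Hom_pad[OF assms(2), of p q]
  by (simp add: assms(1,4))

lemma pad_rel2:
  assumes "pad p x q \<odot> pad p' x' q' = pad r y w \<odot> pad r' y' w'"
    and "x \<in> Hom s t" "x' \<in> Hom s' t'" "p @ s @ q = p' @ t' @ q'"
    and "y \<in> Hom s1 t1" "y' \<in> Hom s1' t1'" "r @ s1 @ w = r' @ t1' @ w'"
  shows "pad (a @ p) x (q @ b) \<odot> pad (a @ p') x' (q' @ b)
    = pad (a @ r) y (w @ b) \<odot> pad (a @ r') y' (w' @ b)"
  by (simp add: pad_rel[OF assms(1-4)] pad_rel[OF HOL.refl assms(5-7)])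

lemma zigzag_left: "pad a (cap_web e) (e # b) \<odot> pad (a @ [e]) (cup_web (opp e)) b
  = id_web (a @ e # b)"
proof -
  have "pad [] (cap_web e) [e] \<odot> pad [e] (cup_web (opp e)) [] = id_web [e]"
    using web_isotopic[OF isotopic.zigzag_left[of e]]
    by (simp add: pad_def flip: compose_web tensor_web id_web_def)
  from pad_rel[OF this Hom_cap_web Hom_cup_web, of a b] show ?thesis by simp
qed

lemma zigzag_right: "pad (a @ [e]) (cap_web (opp e)) b \<odot> pad a (cup_web e) (e # b)
  = id_web (a @ e # b)"
proof -
  have "pad [e] (cap_web (opp e)) [] \<odot> pad [] (cup_web e) [e] = id_web [e]"
    using web_isotopic[OF isotopic.zigzag_right[of e]]
    by (simp add: pad_def flip: compose_web tensor_web id_web_def)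
  from pad_rel[OF this Hom_cap_web Hom_cup_web, of a b] show ?thesis by simp
qed

lemma bend_left:
  "i < 3 \<Longrightarrow> pad [] (cap_web e) (replicate (2 - i) (opp e)) \<odot> pad [e] (web (Vertex e i)) []
    = web (Vertex e (Suc i))"
  using web_isotopic[OF isotopic.bend_left[of i e]]
  by (simp add: pad_def flip: compose_web tensor_web id_web_def)

lemma bend_right:
  "i < 3 \<Longrightarrow> pad (replicate (2 - i) (opp e)) (cap_web (opp e)) [] \<odot> pad [] (web (Vertex e i)) [e]
    = web (Vertex e (Suc i))"
  using web_isotopic[OF isotopic.bend_right[of i e]]
  by (simp add: pad_def flip: compose_web tensor_web id_web_def)

lemma cap_L: "pad a (cap_web e) (opp e # b) \<odot> pad (a @ [e]) (L_web e) b = pad a (Y_web e) b"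
proof -
  have "pad [] (cap_web e) [opp e] \<odot> pad [e] (L_web e) [] = Y_web e"
    using bend_left[of 1 e] by (simp add: numeral_2_eq_2)
  from pad_rel[OF this Hom_cap_web Hom_L_web, of a b] show ?thesis by simp
qed

lemma cap_L': "pad (a @ [opp e]) (cap_web (opp e)) b \<odot> pad a (L_web e) (e # b) = pad a (Y_web e) b"
proof -
  have "pad [opp e] (cap_web (opp e)) [] \<odot> pad [] (L_web e) [e] = Y_web e"
    using bend_right[of 1 e] by (simp add: numeral_2_eq_2)
  from pad_rel[OF this Hom_cap_web Hom_L_web, of a b] show ?thesis by simp
qed

text \<open>Both sides are the vertex with all three legs at the bottom, reached by
  \<open>bend_left\<close> and by \<open>bend_right\<close>.\<close>

lemma cap_Y: "pad a (cap_web e) b \<odot> pad (a @ [e]) (Y_web e) b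
  = pad a (cap_web (opp e)) b \<odot> pad a (Y_web e) (e # b)"
proof -
  have "cap_web e \<odot> pad [e] (Y_web e) [] = cap_web (opp e) \<odot> pad [] (Y_web e) [e]"
    using bend_left[of 2 e] bend_right[of 2 e] by (simp add: numeral_2_eq_2)
  from pad_rel2[of "[]" _ "[]" _ _ "[]" "[]" _ "[]" "[]", simplified, OF this Hom_cap_web
    Hom_Y_web _ Hom_cap_web Hom_Y_web, of a b]
  show ?thesis by simp
qed

text \<open>Writing \<open>Y\<close> as an \<open>L\<close> with one leg bent down, the cup meets
  the bending cap and the zigzag straightens.\<close>

lemma Y_cup: "pad a (Y_web e) (opp e # b) \<odot> pad (a @ [e]) (cup_web e) b = pad a (L_web e) b"
proof -
  have "pad [] (Y_web e) [opp e] \<odot> pad [e] (cup_web e) [] = L_web e"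
  proof -
    have "pad [] (Y_web e) [opp e] = pad [opp e] (cap_web (opp e)) [opp e]
      \<odot> pad [] (L_web e) [e, opp e]"
      using pad_rel[OF cap_L'[of "[]" e "[]"], of "[e,e]"]
      using pad_rel[OF cap_L'[of "[]" e "[]"] Hom_cap_web Hom_L_web, of "[]" "[opp e]"]
      by simp
    moreover have "pad [] (L_web e) [e, opp e] \<odot> pad [e] (cup_web e) []
      = pad [opp e, opp e] (cup_web e) [] \<odot> L_web e"
      using pad_commute[OF Hom_L_web[of e] Hom_cup_web[of e], of "[]" "[]" "[]"] by simp
    ultimately have "pad [] (Y_web e) [opp e] \<odot> pad [e] (cup_web e) []
        = (pad [opp e] (cap_web (opp e)) [opp e] \<odot> pad [opp e, opp e] (cup_web e) []) \<odot> L_web e"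
      by (simp add: compose_assoc)
    then show ?thesis
      using zigzag_left[of "[opp e]" "opp e" "[]"] id_web_compose[OF Hom_L_web] by simp
  qed
  from pad_rel[OF this Hom_Y_web Hom_cup_web, of a b] show ?thesis by simp
qed

lemma Y_cup': "pad (a @ [opp e]) (Y_web e) b \<odot> pad a (cup_web (opp e)) (e # b) = pad a (L_web e) b"
proof -
  have "pad [opp e] (Y_web e) [] \<odot> pad [] (cup_web (opp e)) [e] = L_web e"
  proof -
    have "pad [opp e] (Y_web e) [] = pad [opp e] (cap_web e) [opp e] \<odot> pad [opp e, e] (L_web e) []"
      using pad_rel[OF cap_L[of "[]" e "[]"] Hom_cap_web Hom_L_web, of "[opp e]" "[]"]
      by simp
    moreover have "pad [opp e, e] (L_web e) [] \<odot> pad [] (cup_web (opp e)) [e]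
        = pad [] (cup_web (opp e)) [opp e, opp e] \<odot> L_web e"
      using pad_commute[OF Hom_cup_web[of "opp e"] Hom_L_web[of e], of "[]" "[]" "[]"] by simp
    ultimately have "pad [opp e] (Y_web e) [] \<odot> pad [] (cup_web (opp e)) [e]
        = (pad [opp e] (cap_web e) [opp e] \<odot> pad [] (cup_web (opp e)) [opp e, opp e]) \<odot> L_web e"
      by (simp add: compose_assoc)
    then show ?thesis
      using zigzag_right[of "[]" "opp e" "[opp e]"] id_web_compose[OF Hom_L_web] by simp
  qed
  from pad_rel[OF this Hom_Y_web Hom_cup_web, of a b] show ?thesis by simp
qed

lemma Y_L: "pad a (Y_web (opp e)) b \<odot> pad a (L_web e) b = - qint 2 *\<^sub>K id_web (a @ e # b)"
proof -
  have "web (bigon e) = - qint 2 *\<^sub>K web (Strands [e])"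
    by transfer (rule relations.bigon)
  then have "pad [] (Y_web (opp e)) [] \<odot> pad [] (L_web e) [] = - qint 2 *\<^sub>K id_web [e]"
    by (simp add: bigon_def compose_web id_web_def)
  from pad_rel[OF this Hom_Y_web Hom_L_web, of a b] show ?thesis by (simp add: pad_scale pad_minus)
qed

lemma cap_cup: "pad a (cap_web e) b \<odot> pad a (cup_web e) b = qint 3 *\<^sub>K id_web (a @ b)"
proof -
  have "web (Stack (Cap e) (Cup e)) = qint 3 *\<^sub>K web (Strands [])"
    by transfer (rule relations.loop)
  then have "pad [] (cap_web e) [] \<odot> pad [] (cup_web e) [] = qint 3 *\<^sub>K id_web []"
    by (simp add: compose_web id_web_def)
  from pad_rel[OF this Hom_cap_web Hom_cup_web, of a b] show ?thesis
    by (simp add: pad_scale pad_minus)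
qed

lemma pad_X_web: "pad a (X_web e) b
  = pad (a @ [opp e]) (Y_web (opp e)) b \<odot> pad a (L_web e) (opp e # b)"
  using pad_rel[OF X_web_def[of e, symmetric] Hom_Y_web Hom_L_web, of a b] by simp

text \<open>The bar of the crossing is read from the other side: the right strand splits and the
  left one takes up the bar. Both readings are needed, since a piece arriving from one side meets
  only the vertex on that side.\<close>

lemma pad_X_web': "pad a (X_web e) b = pad a (Y_web e) (e # b) \<odot> pad (a @ [e]) (L_web (opp e)) b"
proof -
  have 1: "pad a (L_web e) (opp e # b)
      = pad a (Y_web e) (opp e # opp e # b) \<odot> pad (a @ [e]) (cup_web e) (opp e # b)"
    by (simp add: Y_cup)
  have 2: "pad (a @ [opp e]) (Y_web (opp e)) b \<odot> pad a (Y_web e) (opp e # opp e # b)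
      = pad a (Y_web e) (e # b) \<odot> pad (a @ [e, e]) (Y_web (opp e)) b"
    using pad_commute[OF Hom_Y_web[of e] Hom_Y_web[of "opp e"], of a "[]" b] by simp
  have 3: "pad (a @ [e, e]) (Y_web (opp e)) b \<odot> pad (a @ [e]) (cup_web e) (opp e # b)
      = pad (a @ [e]) (L_web (opp e)) b"
    using Y_cup'[of "a @ [e]" "opp e" b] by simp
  show ?thesis
    unfolding pad_X_web by (simp add: 1 3 2[THEN compose_eq_cont] compose_assoc)
qed

text \<open>The cap closes a bigon with the bar: after \<open>cap_Y\<close> a \<open>Y\<close>
  stands directly on an \<open>L\<close>.\<close>

lemma cap_X: "pad a (cap_web (opp e)) b \<odot> pad a (X_web e) b = - qint 2 *\<^sub>K pad a (cap_web e) b"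
proof -
  have "pad a (cap_web (opp e)) b \<odot> pad a (X_web e) b
      = pad a (cap_web e) b \<odot> pad (a @ [e]) (Y_web e) b \<odot> pad (a @ [e]) (L_web (opp e)) b"
    unfolding pad_X_web' by (simp add: cap_Y flip: compose_assoc)
  also have "\<dots> = - qint 2 *\<^sub>K pad a (cap_web e) b"
    using Y_L[of "a @ [e]" "opp e" b] compose_id_web[OF Hom_pad[OF Hom_cap_web, of a e b]]
    by (simp add: bilinear)
  finally show ?thesis .
qed

text \<open>A pure isotopy, in which the cap swings one leg of the crossing downwards. Two
  generators are replaced by two.\<close>

lemma cap_X_right: "pad a (cap_web e) (e # b) \<odot> pad (a @ [e]) (X_web e) b
    = pad a (Y_web (opp e)) b \<odot> pad a (Y_web e) (opp e # b)"
proof -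
  have "pad a (cap_web e) (e # b) \<odot> pad (a @ [e, opp e]) (Y_web (opp e)) b
      = pad a (Y_web (opp e)) b \<odot> pad a (cap_web e) (opp e # opp e # b)"
    using pad_commute[OF Hom_cap_web[of e] Hom_Y_web[of "opp e"], of a "[]" b] by simp
  from this[THEN compose_eq_cont] show ?thesis
    unfolding pad_X_web by (simp add: compose_assoc cap_L)
qed

lemma cap_X_left: "pad (a @ [opp e]) (cap_web e) b \<odot> pad a (X_web e) (opp e # b)
    = pad a (Y_web e) b \<odot> pad (a @ [e]) (Y_web (opp e)) b"
proof -
  have 1: "pad (a @ [opp e]) (cap_web e) b \<odot> pad a (Y_web e) (e # opp e # b)
      = pad a (Y_web e) b \<odot> pad (a @ [e, e]) (cap_web e) b"
    using pad_commute[OF Hom_Y_web[of e] Hom_cap_web[of e], of a "[]" b] by simp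
  have 2: "pad (a @ [e, e]) (cap_web e) b \<odot> pad (a @ [e]) (L_web (opp e)) (opp e # b)
      = pad (a @ [e]) (Y_web (opp e)) b"
    using cap_L'[of "a @ [e]" "opp e" b] by simp
  show ?thesis
    unfolding pad_X_web' by (simp add: 2 1[THEN compose_eq_cont] compose_assoc)
qed

lemma Y_X: "pad a (Y_web (opp e)) (e # b) \<odot> pad (a @ [opp e]) (X_web e) b
    = pad (a @ [e]) (Y_web (opp e)) b \<odot> pad a (X_web (opp e)) (opp e # b)"
proof -
  have "pad a (Y_web (opp e)) (e # b) \<odot> pad (a @ [opp e, opp e]) (Y_web (opp e)) b
      = pad (a @ [e]) (Y_web (opp e)) b \<odot> pad a (Y_web (opp e)) (opp e # opp e # b)"
    using pad_commute[OF Hom_Y_web[of "opp e"] Hom_Y_web[of "opp e"], of a "[]" b] by simp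
  from this[THEN compose_eq_cont] show ?thesis
    using pad_X_web'[of a "opp e" "opp e # b"] pad_X_web[of "a @ [opp e]" e b]
    by (simp add: compose_assoc)
qed

lemma X_cup: "pad a (X_web (opp f)) (opp f # b) \<odot> pad (a @ [opp f]) (cup_web f) b
    = pad (a @ [f]) (L_web f) b \<odot> pad a (L_web (opp f)) b"
proof -
  have 1: "pad a (L_web (opp f)) (f # opp f # b) \<odot> pad (a @ [opp f]) (cup_web f) b
      = pad (a @ [f, f]) (cup_web f) b \<odot> pad a (L_web (opp f)) b"
    using pad_commute[OF Hom_L_web[of "opp f"] Hom_cup_web[of f], of a "[]" b] by simp
  have 2: "pad (a @ [f]) (Y_web f) (opp f # b) \<odot> pad (a @ [f, f]) (cup_web f) b
    = pad (a @ [f]) (L_web f) b"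
    using Y_cup[of "a @ [f]" f b] by simp
  show ?thesis
    using pad_X_web[of a "opp f" "opp f # b"]
    by (simp add: 1 2[THEN compose_eq_cont] compose_assoc)
qed

text \<open>The square is cut at half height. Its lower half, with the lower side drawn as a cap,
  straightens to \<open>X_web e\<close>, and its upper half to \<open>X_web (opp e)\<close>.\<close>

lemma X_X: "pad a (X_web (opp e)) b \<odot> pad a (X_web e) b
    = id_web (a @ e # opp e # b) + pad a (cup_web e) b \<odot> pad a (cap_web e) b"
proof -
  have sq: "web (square e) = web (Strands [e, opp e]) + web (Stack (Cup e) (Cap e))"
    by transfer (rule relations.square)
  have 1: "pad [] (Y_web (opp e)) [opp e] \<odot> pad [opp e, opp e] (Y_web e) []
     = web (Beside (Vertex (opp e) 2) (Vertex e 2))"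
    using interchange[OF Hom_id_web[of "[opp e, opp e]"] Hom_Y_web[of "opp e"] Hom_Y_web[of e]
      Hom_id_web]
      compose_id_web[OF Hom_Y_web[of "opp e"]] id_web_compose[OF Hom_Y_web[of e]]
    by (simp add: pad_def tensor_web)
  have 2: "pad [opp e, opp e] (L_web (opp e)) [] \<odot> pad [] (L_web e) [opp e]
     = web (Beside (Vertex e (Suc 0)) (Vertex (opp e) (Suc 0)))"
    using interchange[OF Hom_L_web[of e] Hom_id_web Hom_id_web Hom_L_web[of "opp e"]]
      compose_id_web[OF Hom_L_web[of "opp e"]] id_web_compose[OF Hom_L_web[of e]]
    by (simp add: pad_def tensor_web)
  have X1: "X_web (opp e) = web (Beside (Vertex (opp e) 2) (Vertex e 2))
    \<odot> pad [opp e] (cup_web (opp e)) [e]"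
    using pad_X_web[of "[]" "opp e" "[]"] pad_X_web'[of "[]" "opp e" "[]"]
      Y_cup'[of "[opp e]" e "[]"]
    by (simp add: 1[symmetric] compose_assoc)
  have X2: "X_web e = pad [opp e] (cap_web (opp e)) [e]
    \<odot> web (Beside (Vertex e (Suc 0)) (Vertex (opp e) (Suc 0)))"
    using pad_X_web[of "[]" e "[]"] cap_L[of "[opp e]" "opp e" "[]"]
    by (simp add: 2[symmetric] flip: compose_assoc)
  have "X_web (opp e) \<odot> X_web e = web (square e)"
    unfolding X1 X2 square_def
    by (simp add: pad_def compose_assoc flip: compose_web tensor_web id_web_def)
  then have "pad [] (X_web (opp e)) [] \<odot> pad [] (X_web e) []
    = id_web [e, opp e] + cup_web e \<odot> cap_web e"
    by (simp add: sq flip: id_web_def compose_web)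
  from pad_rel[OF this Hom_X_web Hom_X_web, of a b] show ?thesis
    using pad_compose[OF Hom_cap_web Hom_cup_web, of a e e b] by (simp add: pad_add)
qed

section \<open>Reducible webs\<close>

datatype gen = GCap sign | GCup sign | GY sign | GL sign | GX sign

primrec gen_bottom :: "gen \<Rightarrow> word" where
  "gen_bottom (GCap e) = [e, opp e]"
| "gen_bottom (GCup e) = []"
| "gen_bottom (GY e) = [e, e]"
| "gen_bottom (GL e) = [e]"
| "gen_bottom (GX e) = [e, opp e]"

primrec gen_top :: "gen \<Rightarrow> word" where
  "gen_top (GCap e) = []"
| "gen_top (GCup e) = [e, opp e]"
| "gen_top (GY e) = [opp e]"
| "gen_top (GL e) = [opp e, opp e]"
| "gen_top (GX e) = [opp e, e]"

primrec gen_web :: "gen \<Rightarrow> skein" where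
  "gen_web (GCap e) = cap_web e"
| "gen_web (GCup e) = cup_web e"
| "gen_web (GY e) = Y_web e"
| "gen_web (GL e) = L_web e"
| "gen_web (GX e) = X_web e"

lemma Hom_gen_web [simp]: "gen_web g \<in> Hom (gen_bottom g) (gen_top g)"
  by (cases g) auto

text \<open>In \<open>built k s t z\<close> the number \<open>k\<close> bounds the number of generators that are stacked. A
  crossing \<open>X_web\<close> counts as a single generator, so that no rewriting step increases \<open>k\<close>.\<close>

inductive built :: "nat \<Rightarrow> word \<Rightarrow> word \<Rightarrow> skein \<Rightarrow> bool" where
  built_id: "built k s s (id_web s)"
| built_layer: "built k (a @ gen_top g @ b) t z \<Longrightarrow>
  built (Suc k) (a @ gen_bottom g @ b) t (z \<odot> pad a (gen_web g) b)"
| built_zero: "built k s t 0"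
| built_add: "built k s t z \<Longrightarrow> built k s t z' \<Longrightarrow> built k s t (z + z')"
| built_scale: "built k s t z \<Longrightarrow> built k s t (r *\<^sub>K z)"

lemma built_mono: "built k s t z \<Longrightarrow> k \<le> l \<Longrightarrow> built l s t z"
proof (induction arbitrary: l rule: built.induct)
  case (built_layer k a g b t z)
  then obtain l' where "l = Suc l'" "k \<le> l'" by (cases l) auto
  with built_layer show ?case by (auto intro: built.built_layer)
qed (auto intro: built.intros)

lemma built_Hom: "built k s t z \<Longrightarrow> z \<in> Hom s t"
proof (induction rule: built.induct)
  case (built_layer k a g b t z)
  show ?case by (rule Hom_compose[OF built_layer.IH Hom_pad[OF Hom_gen_web]])
qed (auto intro: Hom_add Hom_scale)

lemma built_comp: "built k s t z \<Longrightarrow> built l t u y \<Longrightarrow> built (k + l) s u (y \<odot> z)"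
proof (induction rule: built.induct)
  case (built_id k s)
  then show ?case by (auto simp: compose_id_web[OF built_Hom] intro: built_mono)
next
  case (built_layer k a g b t z)
  then show ?case by (auto simp: compose_assoc[symmetric] intro: built.built_layer)
qed (auto simp: bilinear intro: built.intros)

lemma built_widen: "built k s t z \<Longrightarrow> built k (a @ s @ b) (a @ t @ b) (pad a z b)"
proof (induction rule: built.induct)
  case (built_layer k c g d t z)
  have "pad a (z \<odot> pad c (gen_web g) d) b = pad a z b \<odot> pad (a @ c) (gen_web g) (d @ b)"
    using pad_compose[OF Hom_pad[OF Hom_gen_web] built_Hom[OF built_layer(1)]] by simp
  then show ?case using built.built_layer[of k "a @ c" g "d @ b"] built_layer by simp
qed (auto simp: pad_add pad_scale intro: built.intros)

lemma built_gen: "built (Suc 0) (a @ gen_bottom g @ b) (a @ gen_top g @ b) (pad a (gen_web g) b)"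
  using built_layer[OF built_id[of 0], of a g b]
    by (simp add: id_web_compose[OF Hom_pad[OF Hom_gen_web]])

text \<open>Here \<open>c\<close> is the exact number of crossings, in contrast to the bound in
  \<open>built\<close>. A crossing exchanges only neighbours of opposite sign, so a word of equal
  letters admits the empty chain only.\<close>

inductive crossings :: "nat \<Rightarrow> word \<Rightarrow> word \<Rightarrow> skein \<Rightarrow> bool" where
  crossings_id: "crossings 0 s s (id_web s)"
| crossings_X: "crossings c (u @ opp e # e # v) t x \<Longrightarrow>
    crossings (Suc c) (u @ e # opp e # v) t (x \<odot> pad u (X_web e) v)"

lemma crossings_built: "crossings c s t x \<Longrightarrow> built c s t x"
proof (induction rule: crossings.induct)
  case (crossings_X c u e v t x)
  then show ?case using built_layer[of c u "GX e" v t x] by simp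
qed (auto intro: built_id)

lemma crossings_Hom: "crossings c s t x \<Longrightarrow> x \<in> Hom s t"
  by (intro built_Hom crossings_built)

lemma crossings_length: "crossings c s t x \<Longrightarrow> length s = length t"
  by (induction rule: crossings.induct) auto

lemma crossings_comp: "crossings c s t x \<Longrightarrow> crossings d t u y \<Longrightarrow> crossings (c + d) s u (y \<odot> x)"
proof (induction rule: crossings.induct)
  case (crossings_id s)
  then show ?case by (simp add: compose_id_web[OF crossings_Hom])
qed (auto simp: compose_assoc[symmetric] intro: crossings.intros)

lemma crossings_widen: "crossings c s t x \<Longrightarrow> crossings c (a @ s @ b) (a @ t @ b) (pad a x b)"
proof (induction rule: crossings.induct)
  case (crossings_X c u e v t x)
  have "pad a (x \<odot> pad u (X_web e) v) b = pad a x b \<odot> pad (a @ u) (X_web e) (v @ b)"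
    using pad_compose[OF Hom_pad[OF Hom_X_web[of e]], of x u v t a b]
      crossings_Hom[OF crossings_X(1)] by simp
  then show ?case using crossings.crossings_X[of c "a @ u" e "v @ b"] crossings_X by simp
qed (auto intro: crossings.intros)

lemma crossings_X_web: "crossings (Suc 0) (u @ e # opp e # v) (u @ opp e # e # v)
  (pad u (X_web e) v)"
  using crossings_X[OF crossings_id, of u e v]
    id_web_compose[OF Hom_pad[OF Hom_X_web[of e]], of u v] by simp

definition reduction :: "sign \<Rightarrow> sign \<Rightarrow> gen" where
  "reduction h e = (if h = e then GY e else GCap h)"

lemma reduction_simps [simp]: "reduction e e = GY e" "reduction e (opp e) = GCap e"
  "reduction (opp e) e = GCap (opp e)"
  by (auto simp: reduction_def)

lemma gen_bottom_reduction [simp]: "gen_bottom (reduction h e) = [h, e]"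
  by (auto simp: reduction_def neq_opp_iff)

text \<open>\<open>reducible k s b t z\<close>: every term of \<open>z\<close>, a web from \<open>s @ b\<close> to \<open>t\<close>, begins with crossings
  among the strands of \<open>s\<close> followed by a cap or a merging of two adjacent strands of \<open>s\<close>. The right
  strand of this pair may be taken to be an unmoved letter \<open>e\<close> of \<open>s\<close> such that only the strands to
  its left are crossed. This makes the notion recursive in \<open>s\<close>; that it is stable under all
  crossings of \<open>s\<close> is \<open>reducible_crossings\<close> below.\<close>

inductive reducible :: "nat \<Rightarrow> word \<Rightarrow> word \<Rightarrow> word \<Rightarrow> skein \<Rightarrow> bool" where
  reducible_gen: "crossings c s1 (s' @ [h]) x \<Longrightarrow>
    built j (s' @ gen_top (reduction h e) @ s2 @ b) t w \<Longrightarrow> j + c < k \<Longrightarrow>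
    reducible k (s1 @ e # s2) b t (w \<odot> pad s' (gen_web (reduction h e)) (s2 @ b)
      \<odot> pad [] x (e # s2 @ b))"
| reducible_zero: "reducible k s b t 0"
| reducible_add: "reducible k s b t z \<Longrightarrow> reducible k s b t z' \<Longrightarrow> reducible k s b t (z + z')"
| reducible_scale: "reducible k s b t z \<Longrightarrow> reducible k s b t (r *\<^sub>K z)"

lemma reducible_minus: "reducible k s b t z \<Longrightarrow> reducible k s b t (- z)"
  using reducible_scale[of k s b t z "- 1"] by simp

lemma reducible_mono: "reducible k s b t z \<Longrightarrow> k \<le> l \<Longrightarrow> reducible l s b t z"
  by (induction rule: reducible.induct) (auto intro: reducible.intros)

text \<open>The strict bound \<open>j + c < k\<close> in \<open>reducible_gen\<close> reserves one
  unit for the reducing generator itself.\<close>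

lemma reducible_built: "reducible k s b t z \<Longrightarrow> built k (s @ b) t z"
proof (induction rule: reducible.induct)
  case (reducible_gen c s1 s' h x j e s2 b t w k)
  have "built (Suc j) (s' @ [h, e] @ s2 @ b) t (w \<odot> pad s' (gen_web (reduction h e)) (s2 @ b))"
    using built_layer[of j s' "reduction h e" "s2 @ b" t w] reducible_gen(2) by simp
  from built_comp[OF built_widen[OF crossings_built[OF reducible_gen(1)], of "[]" "e # s2 @ b"],
    of "Suc j", simplified, OF this[simplified]]
  have "built (c + Suc j) (s1 @ e # s2 @ b) t
    (w \<odot> pad s' (gen_web (reduction h e)) (s2 @ b) \<odot> pad [] x (e # s2 @ b))"
    by (simp add: compose_assoc)
  then show ?case using reducible_gen(3) by (auto intro: built_mono)
qed (auto intro: built.intros)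

lemma reducible_Hom: "reducible k s b t z \<Longrightarrow> z \<in> Hom (s @ b) t"
  by (intro built_Hom reducible_built)

lemma reducible_comp: "reducible k s b t z \<Longrightarrow> built l t u y \<Longrightarrow> reducible (k + l) s b u (y \<odot> z)"
proof (induction rule: reducible.induct)
  case (reducible_gen c s1 s' h x j e s2 b t w k)
  then show ?case
    using reducible.reducible_gen[OF reducible_gen(1)
      built_comp[OF reducible_gen(2) reducible_gen(4)], of "k + l"] by (simp add: compose_assoc)
qed (auto simp: bilinear intro: reducible.intros)

lemma reducible_widen: "reducible k s b t z \<Longrightarrow> reducible k s (b @ d) (t @ d) (pad [] z d)"
proof (induction rule: reducible.induct)
  case (reducible_gen c s1 s' h x j e s2 b t w k)
  have "pad [] (w \<odot> pad s' (gen_web (reduction h e)) (s2 @ b) \<odot> pad [] x (e # s2 @ b)) d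
    = pad [] w d \<odot> pad s' (gen_web (reduction h e)) (s2 @ b @ d) \<odot> pad [] x (e # s2 @ b @ d)"
  proof -
    have x: "pad [] x (e # s2 @ b) \<in> Hom (s1 @ e # s2 @ b) (s' @ [h, e] @ s2 @ b)"
      using Hom_pad[OF crossings_Hom[OF reducible_gen(1)], of "[]" "e # s2 @ b"] by simp
    have y: "pad s' (gen_web (reduction h e)) (s2 @ b) \<in> Hom (s' @ [h, e] @ s2 @ b)
      (s' @ gen_top (reduction h e) @ s2 @ b)"
      using Hom_pad[OF Hom_gen_web[of "reduction h e"]] by simp
    show ?thesis
      using pad_compose[OF Hom_compose[OF y x] built_Hom[OF reducible_gen(2)], of "[]" d]
        pad_compose[OF x y, of "[]" d]
      by simp
  qed
  then show ?case
    using reducible.reducible_gen[OF reducible_gen(1), of j e s2 "b @ d" "t @ d" "pad [] w d" k]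
      built_widen[OF reducible_gen(2), of "[]" d] reducible_gen(3)
    by simp
qed (auto simp: pad_add pad_scale intro: reducible.intros)

text \<open>Strands to the right of the chosen letter take no part in the reduction, so
  \<open>b1\<close> may be counted among the untouched strands \<open>s2\<close>.\<close>

lemma reducible_shift: "reducible k s (b1 @ b) t z \<Longrightarrow> reducible k (s @ b1) b t z"
proof (induction k s "b1 @ b" t z rule: reducible.induct)
  case (reducible_gen c s1 s' h x j e s2 t w k)
  then show ?case using reducible.reducible_gen[of c s1 s' h x j e "s2 @ b1" b t w k] by simp
qed (auto intro: reducible.intros)

text \<open>The web \<open>y\<close> lives on strands that neither the crossings nor the reducing
  generator touch; it slides up past both and is absorbed by \<open>w\<close>.\<close>

lemma reducible_outer:
  assumes "reducible k s b' t z" "built l b b' y"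
  shows "reducible (k + l) s b t (z \<odot> pad s y [])"
  using assms
proof (induction rule: reducible.induct)
  case (reducible_gen c s1 s' h x j e s2 b' t w k)
  note y = built_Hom[OF reducible_gen(4)]
  have 1: "pad [] x (e # s2 @ b') \<odot> pad (s1 @ e # s2) y []
      = pad (s' @ [h, e] @ s2) y [] \<odot> pad [] x (e # s2 @ b)"
    using pad_commute[OF crossings_Hom[OF reducible_gen(1)] y, of "[]" "e # s2" "[]"] by simp
  have 2: "pad s' (gen_web (reduction h e)) (s2 @ b') \<odot> pad (s' @ [h, e] @ s2) y []
      = pad (s' @ gen_top (reduction h e) @ s2) y [] \<odot> pad s' (gen_web (reduction h e)) (s2 @ b)"
    using pad_commute[OF Hom_gen_web[of "reduction h e"] y, of s' s2 "[]"] by simp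
  have "built (j + l) (s' @ gen_top (reduction h e) @ s2 @ b) t
    (w \<odot> pad (s' @ gen_top (reduction h e) @ s2) y [])"
    using built_comp[OF built_widen[OF reducible_gen(4), of "s' @ gen_top (reduction h e) @ s2"
      "[]"]] reducible_gen(2)
    by (simp add: add.commute)
  from reducible.reducible_gen[OF reducible_gen(1) this, of "k + l"] show ?case
    using reducible_gen(3) 1 2[THEN compose_eq_cont] by (simp add: compose_assoc)
qed (auto simp: bilinear intro: reducible.intros)

text \<open>Either the right letter of the pair is the last letter \<open>e\<close>, or it lies in
  \<open>s\<close>, and then \<open>e\<close> can be handed over to the outer word. Words are peeled
  from the right by means of this dichotomy.\<close>

lemma reducible_snoc_induct [consumes 1, case_names left last zero add scale]:
  assumes "reducible k (s @ [e]) b t z" and "\<And>z. reducible k s (e # b) t z \<Longrightarrow> P z"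
    and "\<And>c s' h x j w. crossings c s (s' @ [h]) x \<Longrightarrow>
      built j (s' @ gen_top (reduction h e) @ b) t w \<Longrightarrow> j + c < k \<Longrightarrow>
      P (w \<odot> pad s' (gen_web (reduction h e)) b \<odot> pad [] x (e # b))"
    and "P 0" "\<And>z z'. P z \<Longrightarrow> P z' \<Longrightarrow> P (z + z')" "\<And>r z. P z \<Longrightarrow> P (r *\<^sub>K z)"
  shows "P z"
  using assms
proof (induction k "s @ [e]" b t z rule: reducible.induct)
  case (reducible_gen c s1 s' h x j e' s2 b t w k)
  show ?case
  proof (cases s2 rule: rev_cases)
    case Nil
    with reducible_gen show ?thesis by auto
  next
    case (snoc s2' e'')
    with reducible_gen have "s = s1 @ e' # s2'" "e'' = e" by auto
    with snoc reducible_gen show ?thesis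
      using reducible.reducible_gen[of c s1 s' h x j e' s2' "e # b" t w k] by auto
  qed
qed auto

lemma reducible_X_inner:
  assumes "reducible k (u @ [opp e]) (e # b) t z"
  shows "reducible (Suc k) (u @ [e, opp e]) b t (z \<odot> pad u (X_web e) b)"
  using assms
proof (induction rule: reducible_snoc_induct)
  case (left z)
  have "built (Suc 0) (e # opp e # b) (opp e # e # b) (pad [] (X_web e) b)"
    using built_gen[of "[]" "GX e" b] by simp
  from reducible_outer[OF left this] show ?case using reducible_shift[of "Suc k" u "[e, opp e]" b]
    by simp
next
  case (last c s' h x j w)
  have comm: "pad [] x (opp e # e # b) \<odot> pad u (X_web e) b
      = pad (s' @ [h]) (X_web e) b \<odot> pad [] x (e # opp e # b)"
    using pad_commute[OF crossings_Hom[OF last(1)] Hom_X_web[of e], of "[]" "[]" b] by simp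
  show ?case
  proof (cases "h = e")
    \<comment> \<open>The pair is capped. \<open>cap_X_right\<close> turns cap and crossing into two
      mergings, the lower of which joins \<open>h\<close> with the letter \<open>e\<close> next to
      it.\<close>
    case True
    have "built (Suc j) (s' @ [opp e, opp e] @ b) t (w \<odot> pad s' (Y_web (opp e)) b)"
      using built_layer[of j s' "GY (opp e)" b t w] last(2) True by simp
    from reducible_gen[of c u s' e x "Suc j" e "[opp e]" b, OF _ _] last(1,3) True this
    have "reducible (Suc k) (u @ [e, opp e]) b t
       ((w \<odot> pad s' (Y_web (opp e)) b) \<odot> pad s' (Y_web e) (opp e # b) \<odot> pad [] x (e # opp e # b))"
      by simp
    then show ?thesis
      using True comm cap_X_right[of s' e b, THEN compose_eq_cont] by (simp add: compose_assoc)
  next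
    \<comment> \<open>Here \<open>Y_X\<close> moves the merging one place to the right. The letter
      \<open>h\<close> first crosses \<open>e\<close>, so the chain grows by one crossing.\<close>
    case False
    then have h: "h = opp e" by (simp add: neq_opp_iff)
    have "crossings (c + Suc 0) (u @ [e]) (s' @ [e, opp e])
      (pad s' (X_web (opp e)) [] \<odot> pad [] x [e])"
    proof (rule crossings_comp)
      show "crossings c (u @ [e]) (s' @ [opp e, e]) (pad [] x [e])"
        using crossings_widen[OF last(1), of "[]" "[e]"] h by simp
      show "crossings (Suc 0) (s' @ [opp e, e]) (s' @ [e, opp e]) (pad s' (X_web (opp e)) [])"
        using crossings_X_web[of s' "opp e" "[]"] by simp
    qed
    from reducible_gen[of "Suc c" "u @ [e]" "s' @ [e]" "opp e" _ j "opp e" "[]" b] this last(2,3) h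
    have "reducible (Suc k) (u @ [e, opp e]) b t (w \<odot> pad (s' @ [e]) (Y_web (opp e)) b
        \<odot> pad [] (pad s' (X_web (opp e)) [] \<odot> pad [] x [e]) (opp e # b))"
      by simp
    moreover have "pad [] (pad s' (X_web (opp e)) [] \<odot> pad [] x [e]) (opp e # b)
       = pad s' (X_web (opp e)) (opp e # b) \<odot> pad [] x (e # opp e # b)"
      using pad_compose[OF Hom_pad[OF crossings_Hom[OF last(1)], of "[]" "[e]"], of "pad s'
        (X_web (opp e)) []" _ "[]" "opp e # b"]
        Hom_pad[OF Hom_X_web[of "opp e"], of s' "[]"] h by simp
    ultimately show ?thesis
      using h comm Y_X[of s' e b, THEN compose_eq_cont] by (simp add: compose_assoc)
  qed
qed (auto simp: bilinear intro: reducible.intros)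

section \<open>Chains of crossings\<close>

text \<open>Modulo reducible webs, a chain of crossings moves the last strand at most once. Moving it away
  and back again is the identity up to reducible webs, by \<open>X_X\<close>.\<close>

inductive crossing_form :: "nat \<Rightarrow> word \<Rightarrow> sign \<Rightarrow> word \<Rightarrow> sign \<Rightarrow> skein \<Rightarrow> bool" where
  crossing_form_still: "crossings c' s s' x' \<Longrightarrow> c' \<le> c \<Longrightarrow> crossing_form c s l s' l (pad [] x' [l])"
| crossing_form_cross: "crossings c1 s (p @ [opp l]) x1 \<Longrightarrow> crossings c2 (p @ [l]) s' x2 \<Longrightarrow>
  c1 + c2 < c \<Longrightarrow>
    crossing_form c s l s' (opp l) (pad [] x2 [opp l] \<odot> pad p (X_web (opp l)) [] \<odot> pad [] x1 [l])"
| crossing_form_reducible: "reducible c (s @ [l]) [] (s' @ [h]) x \<Longrightarrow> crossing_form c s l s' h x"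
| crossing_form_add: "crossing_form c s l s' h x \<Longrightarrow> crossing_form c s l s' h x' \<Longrightarrow>
  crossing_form c s l s' h (x + x')"

lemma pad_compose3:
  assumes "x \<in> Hom s t" "y \<in> Hom t u" "z \<in> Hom u v"
  shows "pad a (z \<odot> y \<odot> x) b = pad a z b \<odot> pad a y b \<odot> pad a x b"
  using pad_compose[OF assms(1,2)] pad_compose[OF Hom_compose[OF assms(2,1)] assms(3)] by simp

text \<open>The normal form of the chain controls what the crossing below it can meet. If the last
  strand stays put, a bigon arises. If it moves once, the merging slides down by \<open>Y_X\<close>,
  and two opposite crossings meet in a square.\<close>

lemma reducible_X_crossing_form:
  assumes "crossing_form c u (opp e) s' h x" "built j (s' @ gen_top (reduction h e) @ b) t w"
    "j + c < k"
  shows "reducible (Suc k) (u @ [e, opp e]) b t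
    (w \<odot> pad s' (gen_web (reduction h e)) b \<odot> pad [] x (e # b) \<odot> pad u (X_web e) b)"
  using assms
proof (induction c u "opp e" s' h x rule: crossing_form.induct)
  case (crossing_form_still c' u s' x' c)
  have comm: "pad [] x' (opp e # e # b) \<odot> pad u (X_web e) b
    = pad s' (X_web e) b \<odot> pad [] x' (e # opp e # b)"
    using pad_commute[OF crossings_Hom[OF crossing_form_still(1)] Hom_X_web[of e], of "[]" "[]" b]
      by simp
  have "crossings c' (u @ [e]) (s' @ [e]) (pad [] x' [e])"
    using crossings_widen[OF crossing_form_still(1), of "[]" "[e]"] by simp
  from reducible_gen[OF this, of j "opp e" "[]" b t w "Suc k"]
  have "reducible (Suc k) (u @ [e, opp e]) b t
    (w \<odot> pad s' (cap_web e) b \<odot> pad [] x' (e # opp e # b))"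
    using crossing_form_still by simp
  then show ?case
    by (simp add: comm cap_X[of s' e b, THEN compose_eq_cont] bilinear reducible_scale
      reducible_minus)
next
  case (crossing_form_cross c1 u p x1 c2 s' x2 c)
  have 1: "pad s' (Y_web e) b \<odot> pad [] x2 (e # e # b)
    = pad [] x2 (opp e # b) \<odot> pad (p @ [opp e]) (Y_web e) b"
    using pad_commute[OF crossings_Hom[OF crossing_form_cross(2)] Hom_Y_web[of e], of "[]" "[]" b]
      by simp
  have 2: "pad [] x1 (opp e # e # b) \<odot> pad u (X_web e) b
    = pad (p @ [e]) (X_web e) b \<odot> pad [] x1 (e # opp e # b)"
    using pad_commute[OF crossings_Hom[OF crossing_form_cross(1)] Hom_X_web[of e], of "[]" "[]" b]
      by simp
  have 3: "pad (p @ [opp e]) (Y_web e) b \<odot> pad p (X_web e) (e # b)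
      = pad p (Y_web e) (opp e # b) \<odot> pad (p @ [e]) (X_web (opp e)) b"
    using Y_X[of p "opp e" b] by simp
  have 4: "pad [] (pad [] x2 [e] \<odot> pad p (X_web e) [] \<odot> pad [] x1 [opp e]) (e # b)
      = pad [] x2 (e # e # b) \<odot> pad p (X_web e) (e # b) \<odot> pad [] x1 (opp e # e # b)"
  proof -
    have "pad [] x1 [opp e] \<in> Hom (u @ [opp e]) (p @ [e, opp e])"
      using Hom_pad[OF crossings_Hom[OF crossing_form_cross(1)], of "[]" "[opp e]"] by simp
    moreover have "pad p (X_web e) [] \<in> Hom (p @ [e, opp e]) (p @ [opp e, e])"
      using Hom_pad[OF Hom_X_web[of e], of p "[]"] by simp
    moreover have "pad [] x2 [e] \<in> Hom (p @ [opp e, e]) (s' @ [e])"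
      using Hom_pad[OF crossings_Hom[OF crossing_form_cross(2)], of "[]" "[e]"] by simp
    ultimately show ?thesis by (simp add: pad_compose3)
  qed
  have x1: "pad [] x1 (e # opp e # b) \<in> Hom (u @ e # opp e # b) (p @ e # e # opp e # b)"
    using Hom_pad[OF crossings_Hom[OF crossing_form_cross(1)], of "[]" "e # opp e # b"] by simp
  have w2: "built (c2 + j) (p @ opp e # opp e # b) t (w \<odot> pad [] x2 (opp e # b))"
    using built_comp[OF built_widen[OF crossings_built[OF crossing_form_cross(2)], of "[]" "opp e
      # b"]] crossing_form_cross(4) by simp
  \<comment> \<open>The two terms of the square: the identity leaves a merging of two letters
    \<open>e\<close>, the cup over the cap leaves a cap. Both are reductions.\<close>
  let ?A = "(w \<odot> pad [] x2 (opp e # b)) \<odot> pad p (Y_web e) (opp e # b) \<odot> pad [] x1 (e # opp e # b)"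
  let ?B = "(w \<odot> pad [] x2 (opp e # b)) \<odot> pad p (Y_web e) (opp e # b)
    \<odot> pad (p @ [e]) (cup_web e) b \<odot> pad (p @ [e]) (cap_web e) b \<odot> pad [] x1 (e # opp e # b)"
  have A: "reducible (Suc k) (u @ [e, opp e]) b t ?A"
    using reducible_gen[of c1 u p e x1 "c2 + j" e "[opp e]" b t _ "Suc k"] crossing_form_cross w2
      by simp
  have "built (Suc (c2 + j)) (p @ [e, e] @ opp e # b) t
      ((w \<odot> pad [] x2 (opp e # b)) \<odot> pad p (Y_web e) (opp e # b))"
    using built_layer[of "c2 + j" p "GY e" "opp e # b"] w2 by simp
  then have "built (Suc (Suc (c2 + j))) ((p @ [e]) @ b) t
      (((w \<odot> pad [] x2 (opp e # b)) \<odot> pad p (Y_web e) (opp e # b)) \<odot> pad (p @ [e]) (cup_web e) b)"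
    using built_layer[of "Suc (c2 + j)" "p @ [e]" "GCup e" b] by simp
  moreover have "crossings c1 (u @ [e]) ((p @ [e]) @ [e]) (pad [] x1 [e])"
    using crossings_widen[OF crossing_form_cross(1), of "[]" "[e]"] by simp
  ultimately have B: "reducible (Suc k) (u @ [e, opp e]) b t ?B"
    using reducible_gen[of c1 "u @ [e]" "p @ [e]" e "pad [] x1 [e]" "Suc (Suc (c2 + j))" "opp e"
      "[]" b t
        "((w \<odot> pad [] x2 (opp e # b)) \<odot> pad p (Y_web e) (opp e # b))
        \<odot> pad (p @ [e]) (cup_web e) b" "Suc k"]
      crossing_form_cross(3,5) by (simp add: compose_assoc)
  have "w \<odot> pad s' (Y_web e) b \<odot> pad [] x2 (e # e # b) \<odot> pad p (X_web e) (e # b)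
      \<odot> pad [] x1 (opp e # e # b) \<odot> pad u (X_web e) b
    = w \<odot> pad [] x2 (opp e # b) \<odot> pad p (Y_web e) (opp e # b)
      \<odot> (pad (p @ [e]) (X_web (opp e)) b \<odot> pad (p @ [e]) (X_web e) b) \<odot> pad [] x1 (e # opp e # b)"
    by (simp add: compose_assoc 1[THEN compose_eq_cont] 2 3[THEN compose_eq_cont])
  also have "\<dots> = ?A + ?B"
    using id_web_compose[OF x1] by (simp add: X_X bilinear compose_assoc)
  finally show ?case
    using reducible_add[OF A B] by (simp add: 4 compose_assoc)
next
  case (crossing_form_reducible c u s' h x)
  have "reducible c (u @ [opp e]) (e # b) (s' @ h # e # b) (pad [] x (e # b))"
    using reducible_widen[OF crossing_form_reducible(1), of "e # b"] by simp
  from reducible_comp[OF this, of "Suc j" t "w \<odot> pad s' (gen_web (reduction h e)) b"]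
  have "reducible (c + Suc j) (u @ [opp e]) (e # b) t
    ((w \<odot> pad s' (gen_web (reduction h e)) b) \<odot> pad [] x (e # b))"
    using built_layer[of j s' "reduction h e" b t w] crossing_form_reducible(2) by simp
  from reducible_X_inner[OF this] show ?case
    using reducible_mono[of "Suc (c + Suc j)"] crossing_form_reducible(3)
      by (simp add: compose_assoc)
next
  case (crossing_form_add c u s' h x x')
  then show ?case by (simp add: pad_add bilinear reducible_add)
qed

text \<open>The normal form on the prefix \<open>u @ [opp e]\<close> is an assumption because it is
  proved together with this statement; \<open>crossings_crossing_form\<close> supplies it by
  induction on the length.\<close>

lemma reducible_X_aux:
  assumes "\<And>c s' h x. crossings c (u @ [opp e]) (s' @ [h]) x \<Longrightarrow> crossing_form c u (opp e) s' h x"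
    and "reducible k (u @ opp e # e # v) b t z"
  shows "reducible (Suc k) (u @ e # opp e # v) b t (z \<odot> pad u (X_web e) (v @ b))"
  using assms(2)
proof (induction v arbitrary: b z rule: rev_induct)
  case Nil
  then have "reducible k ((u @ [opp e]) @ [e]) b t z" by simp
  then show ?case
  proof (induction rule: reducible_snoc_induct)
    case (left z)
    then show ?case using reducible_X_inner[of k u e b t z] by simp
  next
    case (last c s' h x j w)
    then show ?case using reducible_X_crossing_form[OF assms(1)[OF last(1)] last(2,3)]
      by (simp add: compose_assoc)
  qed (auto simp: bilinear intro: reducible.intros)
next
  case (snoc f v)
  then have "reducible k ((u @ opp e # e # v) @ [f]) b t z" by simp
  then show ?case
  proof (induction rule: reducible_snoc_induct)
    case (left z)
    from snoc.IH[OF left] show ?case using reducible_shift[of "Suc k" "u @ e # opp e # v" "[f]" b]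
      by simp
  next
    case (last c s' h x j w)
    from crossings_X[of c u e v, OF last(1)] last(2,3)
    have "reducible (Suc k) ((u @ e # opp e # v) @ [f]) b t
        (w \<odot> pad s' (gen_web (reduction h f)) b \<odot> pad [] (x \<odot> pad u (X_web e) v) (f # b))"
      using reducible_gen[of "Suc c" "u @ e # opp e # v" s' h _ j f "[]" b t w "Suc k"] by simp
    then show ?case
      using pad_compose'[OF Hom_pad[OF Hom_X_web[of e], of u v] crossings_Hom[OF last(1)], of "[]"
        "f # b"]
      by (simp add: compose_assoc)
  qed (auto simp: bilinear intro: reducible.intros)
qed

lemma crossing_form_X_inner:
  assumes IH: "\<And>c s' h x. crossings c (u @ [opp e]) (s' @ [h]) x \<Longrightarrow> crossing_form c u (opp e) s' h x"
    and "crossing_form c (u @ opp e # e # v) l s' h y"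
  shows "crossing_form (Suc c) (u @ e # opp e # v) l s' h (y \<odot> pad u (X_web e) (v @ [l]))"
  using assms(2)
proof (induction c "u @ opp e # e # v" l s' h y rule: crossing_form.induct)
  case (crossing_form_still c' s' x' c l)
  then show ?case
    using crossing_form.crossing_form_still[OF crossings_X[OF crossing_form_still(1)], of "Suc c" l]
      pad_compose'[OF Hom_pad[OF Hom_X_web[of e], of u v]
        crossings_Hom[OF crossing_form_still(1)], of "[]" "[l]"]
    by simp
next
  case (crossing_form_cross c1 p l x1 c2 s' x2 c)
  then show ?case
    using crossing_form.crossing_form_cross[OF crossings_X[OF crossing_form_cross(1)]
      crossing_form_cross(2), of "Suc c"]
      pad_compose'[OF Hom_pad[OF Hom_X_web[of e], of u v]
        crossings_Hom[OF crossing_form_cross(1)], of "[]" "[l]"]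
    by (simp add: compose_assoc)
next
  case (crossing_form_reducible c l s' h x)
  then have "reducible c (u @ opp e # e # v @ [l]) [] (s' @ [h]) x" by simp
  from reducible_X_aux[OF IH this] show ?case by (intro crossing_form.crossing_form_reducible) simp
next
  case (crossing_form_add c l s' h x x')
  then show ?case by (simp add: bilinear crossing_form.crossing_form_add)
qed

text \<open>By \<open>h = opp e\<close> the middle part \<open>x1\<close> returns a last strand of
  the same sign, which excludes that this strand is crossed once. What remains is a pair of opposite
  crossings facing each other, resolved by \<open>X_X\<close>, or a reducible term.\<close>

lemma crossing_form_cross_back:
  assumes "crossing_form c1 u (opp e) p h x1" "h = opp e" "crossings c2 (p @ [e]) s' x2"
    "c1 + c2 < c"
  shows "crossing_form (Suc c) (u @ [e]) (opp e) s' (opp e)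
    (pad [] x2 [opp e] \<odot> pad p (X_web (opp e)) [] \<odot> pad [] x1 [e] \<odot> pad u (X_web e) [])"
  using assms
proof (induction c1 u "opp e" p h x1 rule: crossing_form.induct)
  case (crossing_form_still c' u p x' c1)
  have x2: "pad [] x2 [opp e] \<in> Hom (p @ [e, opp e]) (s' @ [opp e])"
    using Hom_pad[OF crossings_Hom[OF crossing_form_still(4)], of "[]" "[opp e]"] by simp
  have x': "pad [] x' [e, opp e] \<in> Hom (u @ [e, opp e]) (p @ [e, opp e])"
    using Hom_pad[OF crossings_Hom[OF crossing_form_still(1)], of "[]" "[e, opp e]"] by simp
  have 1: "pad [] x' [opp e, e] \<odot> pad u (X_web e) [] = pad p (X_web e) [] \<odot> pad [] x' [e, opp e]"
    using pad_commute[OF crossings_Hom[OF crossing_form_still(1)] Hom_X_web[of e], of "[]" "[]"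
      "[]"] by simp
  have ch: "crossings c' (u @ [e]) (p @ [e]) (pad [] x' [e])"
    using crossings_widen[OF crossing_form_still(1), of "[]" "[e]"] by simp
  have A: "crossing_form (Suc c) (u @ [e]) (opp e) s' (opp e)
    (pad [] x2 [opp e] \<odot> pad [] x' [e, opp e])"
    using crossing_form.crossing_form_still[OF crossings_comp[OF ch crossing_form_still(4)], of
      "Suc c" "opp e"] crossing_form_still(2,5)
      pad_compose[OF crossings_Hom[OF ch] crossings_Hom[OF crossing_form_still(4)], of "[]"
        "[opp e]"] by simp
  have "built (Suc c2) (p @ []) (s' @ [opp e]) (pad [] x2 [opp e] \<odot> pad p (cup_web e) [])"
    using built_layer[of c2 p "GCup e" "[]"]
      built_widen[OF crossings_built[OF crossing_form_still(4)], of "[]" "[opp e]"] by simp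
  then have "reducible (Suc c) (u @ [e, opp e]) [] (s' @ [opp e])
      ((pad [] x2 [opp e] \<odot> pad p (cup_web e) []) \<odot> pad p (cap_web e) [] \<odot> pad [] x' [e, opp e])"
    using reducible_gen[OF ch, of "Suc c2" "opp e" "[]" "[]" _ _ "Suc c"] crossing_form_still(2,5)
      by simp
  then have B: "crossing_form (Suc c) (u @ [e]) (opp e) s' (opp e)
      (pad [] x2 [opp e] \<odot> pad p (cup_web e) [] \<odot> pad p (cap_web e) [] \<odot> pad [] x' [e, opp e])"
    by (intro crossing_form.crossing_form_reducible) (simp add: compose_assoc)
  have "pad [] x2 [opp e] \<odot> pad p (X_web (opp e)) [] \<odot> pad [] x' [opp e, e] \<odot> pad u (X_web e) []
    = pad [] x2 [opp e] \<odot> (pad p (X_web (opp e)) [] \<odot> pad p (X_web e) []) \<odot> pad [] x' [e, opp e]"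
    using 1 by (simp add: compose_assoc)
  also have "\<dots> = pad [] x2 [opp e] \<odot> pad [] x' [e, opp e]
    + pad [] x2 [opp e] \<odot> pad p (cup_web e) [] \<odot> pad p (cap_web e) [] \<odot> pad [] x' [e, opp e]"
    using id_web_compose[OF x'] by (simp add: X_X bilinear compose_assoc)
  finally show ?case using crossing_form.crossing_form_add[OF A B] by simp
next
  case (crossing_form_reducible c1 u p h x)
  have "reducible c1 (u @ [opp e]) [e] (p @ [opp e, e]) (pad [] x [e])"
    using reducible_widen[OF crossing_form_reducible(1), of "[e]"] crossing_form_reducible(2)
      by simp
  from reducible_X_inner[OF this]
  have 1: "reducible (Suc c1) (u @ [e, opp e]) [] (p @ [opp e, e])
    (pad [] x [e] \<odot> pad u (X_web e) [])" .
  have "built (Suc c2) (p @ [opp e, e]) (s' @ [opp e])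
    (pad [] x2 [opp e] \<odot> pad p (X_web (opp e)) [])"
    using built_layer[of c2 p "GX (opp e)" "[]"]
      built_widen[OF crossings_built[OF crossing_form_reducible(3)], of "[]" "[opp e]"] by simp
  from reducible_comp[OF 1 this]
  have "reducible (Suc c) (u @ [e, opp e]) [] (s' @ [opp e])
    (pad [] x2 [opp e] \<odot> pad p (X_web (opp e)) [] \<odot> pad [] x [e] \<odot> pad u (X_web e) [])"
    using reducible_mono[of "Suc c1 + Suc c2" _ _ _ _ "Suc c"] crossing_form_reducible(4)
      by (simp add: compose_assoc)
  then show ?case by (intro crossing_form.crossing_form_reducible) simp
next
  case (crossing_form_add c u p h x x')
  then show ?case by (simp add: pad_add bilinear crossing_form.crossing_form_add)
qed simp

lemma crossing_form_X_last:
  assumes IH: "\<And>c s' h x. crossings c (u @ [opp e]) (s' @ [h]) x \<Longrightarrow> crossing_form c u (opp e) s' h x"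
    and "crossing_form c (u @ [opp e]) e s' h y"
  shows "crossing_form (Suc c) (u @ [e]) (opp e) s' h (y \<odot> pad u (X_web e) [])"
  using assms(2)
proof (induction c "u @ [opp e]" e' \<equiv> e s' h y rule: crossing_form.induct)
  case (crossing_form_still c' s' x' c)
  have "crossings 0 (u @ [e]) (u @ [opp (opp e)]) (id_web (u @ [e]))"
    using crossings_id by simp
  from crossing_form.crossing_form_cross[OF this crossing_form_still(1), of "Suc c"]
    crossing_form_still show ?case
    using compose_id_web[OF Hom_pad[OF Hom_X_web[of e], of u "[]"]] by simp
next
  case (crossing_form_cross c1 p x1 c2 s' x2 c)
  from crossing_form_cross_back[OF IH[OF crossing_form_cross(1)] HOL.refl
    crossing_form_cross(2,3)] show ?case
    by (simp add: compose_assoc)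
next
  case (crossing_form_reducible c s' h x)
  then have "reducible c (u @ opp e # e # []) [] (s' @ [h]) x" by simp
  from reducible_X_aux[OF IH this] show ?case by (intro crossing_form.crossing_form_reducible) simp
next
  case (crossing_form_add c s' h x x')
  then show ?case by (simp add: bilinear crossing_form.crossing_form_add)
qed

text \<open>A crossing at the bottom of the chain may run into a reducible term or bring the last
  strand back. Both situations require the normal form on the shorter word \<open>u\<close>, hence
  an induction on the length around the one on the chain.\<close>

lemma crossings_crossing_form: "crossings c (s @ [l]) (s' @ [h]) x \<Longrightarrow> crossing_form c s l s' h x"
proof (induction "length s" arbitrary: c s l s' h x rule: less_induct)
  case less
  have "crossing_form c p l' s' h x" if "crossings c q t x" "q = p @ [l']" "t = s' @ [h]"
    "length p = length s"
    for c q t x p l'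
    using that
  proof (induction arbitrary: p l' rule: crossings.induct)
    case (crossings_id q)
    then show ?case using crossing_form_still[OF crossings.crossings_id[of p], of 0 l'] by auto
  next
    case (crossings_X c u e v t x)
    show ?case
    proof (cases v rule: rev_cases)
      case Nil
      with crossings_X have p: "p = u @ [e]" "l' = opp e" by auto
      have "crossing_form c (u @ [opp e]) e s' h x"
        using crossings_X p Nil by (intro crossings_X.IH) auto
      then show ?thesis
        using crossing_form_X_last[of u e c s' h x] less.hyps[of u] crossings_X.prems p Nil by auto
    next
      case (snoc v' l'')
      with crossings_X have p: "p = u @ e # opp e # v'" "l'' = l'" by auto
      have "crossing_form c (u @ opp e # e # v') l' s' h x"
        using crossings_X p snoc by (intro crossings_X.IH) auto
      then show ?thesis
        using crossing_form_X_inner[of u e c v' l' s' h x] less.hyps[of u] crossings_X.prems p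
        snoc by auto
    qed
  qed
  from this[OF less.prems] show ?case by simp
qed

lemma reducible_X: "reducible k (u @ opp e # e # v) b t z \<Longrightarrow>
  reducible (Suc k) (u @ e # opp e # v) b t (z \<odot> pad u (X_web e) (v @ b))"
  by (rule reducible_X_aux) (rule crossings_crossing_form)

lemma reducible_crossings: "crossings c s s' x \<Longrightarrow> reducible k s' b t z \<Longrightarrow>
  reducible (k + c) s b t (z \<odot> pad [] x b)"
proof (induction rule: crossings.induct)
  case (crossings_id s)
  then show ?case using compose_id_web[OF reducible_Hom] by simp
next
  case (crossings_X c u e v s' x)
  from reducible_X[OF crossings_X.IH[OF crossings_X.prems]] show ?case
    using pad_compose'[OF Hom_pad[OF Hom_X_web[of e], of u v] crossings_Hom[OF crossings_X(1)], of
      "[]" b]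
    by (simp add: compose_assoc)
qed

section \<open>Mirror images\<close>

definition linear_extension :: "(drawing \<Rightarrow> skein) \<Rightarrow> comb \<Rightarrow> skein" where
  "linear_extension F x = (\<Sum>d\<in>Poly_Mapping.keys x. Poly_Mapping.lookup x d *\<^sub>K F d)"

lemma linear_extension_supset:
  "finite A \<Longrightarrow> Poly_Mapping.keys x \<subseteq> A \<Longrightarrow> linear_extension F x
    = (\<Sum>d\<in>A. Poly_Mapping.lookup x d *\<^sub>K F d)"
  unfolding linear_extension_def by (rule sum.mono_neutral_left) (auto simp: in_keys_iff)

lemma linear_extension_zero [simp]: "linear_extension F 0 = 0"
  by (simp add: linear_extension_def)

lemma linear_extension_add: "linear_extension F (x + y)
  = linear_extension F x + linear_extension F y"
  by (subst (1 2 3) linear_extension_supset[of "Poly_Mapping.keys x \<union> Poly_Mapping.keys y"])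
    (auto simp: in_keys_iff lookup_add skein.scale_left_distrib sum.distrib)

lemma linear_extension_diff: "linear_extension F (x - y)
  = linear_extension F x - linear_extension F y"
  using linear_extension_add[of F "x - y" y] by simp

lemma linear_extension_scale: "linear_extension F (scale c x) = c *\<^sub>K linear_extension F x"
  by (subst (1 2) linear_extension_supset[of "Poly_Mapping.keys x"])
    (auto simp: in_keys_iff lookup_scale skein.scale_sum_right)

lemma linear_extension_single [simp]: "linear_extension F (Poly_Mapping.single d c) = c *\<^sub>K F d"
  by (subst linear_extension_supset[of "{d}"]) auto

lemma linear_extension_sum: "linear_extension F (sum g A) = (\<Sum>a\<in>A. linear_extension F (g a))"
  by (induction A rule: infinite_finite_induct) (auto simp: linear_extension_add)

text \<open>\<open>cmp\<close> and \<open>tns\<close> are the images of stacking and juxtaposition;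
  they are parameters because a reflection reverses the order of one of them.\<close>

locale drawing_map =
  fixes F :: "drawing \<Rightarrow> skein" and cmp tns :: "skein \<Rightarrow> skein \<Rightarrow> skein"
  assumes cmp_add: "cmp (x + x') y = cmp x y + cmp x' y" "cmp x (y + y') = cmp x y + cmp x y'"
    and cmp_scale: "cmp (c *\<^sub>K x) y = c *\<^sub>K cmp x y" "cmp x (c *\<^sub>K y) = c *\<^sub>K cmp x y"
    and tns_add: "tns (x + x') y = tns x y + tns x' y" "tns x (y + y') = tns x y + tns x y'"
    and tns_scale: "tns (c *\<^sub>K x) y = c *\<^sub>K tns x y" "tns x (c *\<^sub>K y) = c *\<^sub>K tns x y"
    and F_Stack: "F (Stack w v) = cmp (F w) (F v)"
    and F_Beside: "F (Beside v w) = tns (F v) (F w)"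
    and F_improper: "\<not> proper d \<Longrightarrow> F d = 0"
    and F_isotopic: "isotopic d e \<Longrightarrow> F d = F e"
    and F_loop: "F (Stack (Cap s) (Cup s)) = qint 3 *\<^sub>K F (Strands [])"
    and F_bigon: "F (bigon s) = - qint 2 *\<^sub>K F (Strands [s])"
    and F_square: "F (square s) = F (Strands [s, opp s]) + F (Stack (Cup s) (Cap s))"
begin

lemma linear_extension_Stack: "linear_extension F (bilin Stack x y)
  = cmp (linear_extension F x) (linear_extension F y)"
proof -
  have "cmp 0 z = 0" "cmp z 0 = 0" for z
    using cmp_scale(1)[of 0 0 z] cmp_scale(2)[of z 0 0] by auto
  then have "cmp (sum g A) z = (\<Sum>a\<in>A. cmp (g a) z)" "cmp z (sum g A) = (\<Sum>a\<in>A. cmp z (g a))"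
    for g :: "drawing \<Rightarrow> skein" and A z
    by (induction A rule: infinite_finite_induct) (auto simp: cmp_add)
  then show ?thesis
    by (simp add: bilin_def linear_extension_sum F_Stack) (subst sum.swap,
      simp add: linear_extension_def cmp_scale skein.scale_sum_right mult.commute)
qed

lemma linear_extension_Beside: "linear_extension F (bilin Beside x y)
  = tns (linear_extension F x) (linear_extension F y)"
proof -
  have "tns 0 z = 0" "tns z 0 = 0" for z
    using tns_scale(1)[of 0 0 z] tns_scale(2)[of z 0 0] by auto
  then have "tns (sum g A) z = (\<Sum>a\<in>A. tns (g a) z)" "tns z (sum g A) = (\<Sum>a\<in>A. tns z (g a))"
    for g :: "drawing \<Rightarrow> skein" and A z
    by (induction A rule: infinite_finite_induct) (auto simp: tns_add)
  then show ?thesis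
    by (simp add: bilin_def linear_extension_sum F_Beside) (subst sum.swap,
      simp add: linear_extension_def tns_scale skein.scale_sum_right mult.commute)
qed

lemma linear_extension_relations: "x \<in> relations \<Longrightarrow> linear_extension F x = 0"
proof (induction rule: relations.induct)
  case (stack_left x y)
  then show ?case using cmp_scale(1)[of 0 0] by (simp add: linear_extension_Stack)
next
  case (stack_right y x)
  then show ?case using cmp_scale(2)[of _ 0 0] by (simp add: linear_extension_Stack)
next
  case (beside_left x y)
  then show ?case using tns_scale(1)[of 0 0] by (simp add: linear_extension_Beside)
next
  case (beside_right y x)
  then show ?case using tns_scale(2)[of _ 0 0] by (simp add: linear_extension_Beside)
qed (simp_all add: linear_extension_add linear_extension_diff linear_extension_scale F_improper
  F_isotopic F_loop F_bigon F_square)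

end

primrec mirror_drawing :: "drawing \<Rightarrow> drawing" where
  "mirror_drawing (Strands s) = Strands (rev s)"
| "mirror_drawing (Cup e) = Cup (opp e)"
| "mirror_drawing (Cap e) = Cap (opp e)"
| "mirror_drawing (Vertex e i) = Vertex e i"
| "mirror_drawing (Stack w v) = Stack (mirror_drawing w) (mirror_drawing v)"
| "mirror_drawing (Beside v w) = Beside (mirror_drawing w) (mirror_drawing v)"

lemma bottom_word_mirror_drawing [simp]: "bottom_word (mirror_drawing d) = rev (bottom_word d)"
  by (induction d) auto

lemma top_word_mirror_drawing [simp]: "top_word (mirror_drawing d) = rev (top_word d)"
  by (induction d) auto

lemma proper_mirror_drawing [simp]: "proper (mirror_drawing d) = proper d"
  by (induction d) auto

lemma isotopic_mirror_drawing: "isotopic d e \<Longrightarrow> isotopic (mirror_drawing d) (mirror_drawing e)"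
proof (induction rule: isotopic.induct)
  case (stack_top d)
  then show ?case using isotopic.stack_top[of "mirror_drawing d"] by simp
next
  case (stack_bottom d)
  then show ?case using isotopic.stack_bottom[of "mirror_drawing d"] by simp
next
  case (zigzag_left e)
  then show ?case using isotopic.zigzag_right[of e] by simp
next
  case (zigzag_right e)
  then show ?case using isotopic.zigzag_left[of e] by simp
next
  case (bend_left i e)
  then show ?case using isotopic.bend_right[of i e] by simp
next
  case (bend_right i e)
  then show ?case using isotopic.bend_left[of i e] by simp
qed (auto intro: isotopic.intros)

interpretation mirror: drawing_map "\<lambda>d. web (mirror_drawing d)" "(\<odot>)" "\<lambda>x y. y \<otimes> x"
proof
  fix e s
  show "web (mirror_drawing (Stack (Cap e) (Cup e))) = qint 3 *\<^sub>K web (mirror_drawing (Strands []))"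
    using cap_cup[of "[]" "opp e" "[]"] by (simp add: compose_web id_web_def)
  show "web (mirror_drawing (bigon e)) = - qint 2 *\<^sub>K web (mirror_drawing (Strands [e]))"
    using Y_L[of "[]" e "[]"] by (simp add: Defs.bigon_def compose_web id_web_def)
  have "web (square (opp e)) = web (Strands [opp e, e]) + web (Stack (Cup (opp e)) (Cap (opp e)))"
    using relations.square[of "opp e"] by transfer simp
  moreover have "web (mirror_drawing (square e)) = web (square (opp e))"
    by (simp add: square_def tensor_assoc flip: compose_web tensor_web)
  ultimately show "web (mirror_drawing (square e))
    = web (mirror_drawing (Strands [e, opp e])) + web (mirror_drawing (Stack (Cup e) (Cap e)))"
    by simp
qed (auto simp: bilinear compose_web tensor_web web_improper
  isotopic_mirror_drawing[THEN web_isotopic])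

text \<open>Reflection in a vertical line: words are reversed and signs stay. It compensates for the
  preference that \<open>reducible\<close> gives to the right letter of the pair.\<close>

lift_definition mirror :: "skein \<Rightarrow> skein" is "linear_extension (\<lambda>d. web (mirror_drawing d))"
  using mirror.linear_extension_relations by (metis linear_extension_diff eq_iff_diff_eq_0)

lemma mirror_web [simp]: "mirror (web d) = web (mirror_drawing d)"
  by transfer simp

lemma mirror_zero [simp]: "mirror 0 = 0"
  by transfer simp

lemma mirror_add: "mirror (x + y) = mirror x + mirror y"
  by transfer (simp add: linear_extension_add)

lemma mirror_scale: "mirror (c *\<^sub>K x) = c *\<^sub>K mirror x"
  by transfer (simp add: linear_extension_scale)

lemma mirror_compose: "mirror (x \<odot> y) = mirror x \<odot> mirror y"
  by transfer (simp add: mirror.linear_extension_Stack)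

lemma mirror_tensor: "mirror (x \<otimes> y) = mirror y \<otimes> mirror x"
  by transfer (simp add: mirror.linear_extension_Beside)

lemma mirror_id_web [simp]: "mirror (id_web s) = id_web (rev s)"
  by (simp add: id_web_def)

lemma mirror_pad: "mirror (pad a x b) = pad (rev b) (mirror x) (rev a)"
  by (simp add: pad_def mirror_tensor tensor_assoc)

lemma mirror_mirror [simp]: "mirror (mirror x) = x"
proof -
  have "mirror_drawing (mirror_drawing d) = d" for d by (induction d) auto
  then show ?thesis
    by (induction x rule: skein_induct) (simp_all add: mirror_add mirror_scale)
qed

lemma mirror_X_web [simp]: "mirror (X_web e) = X_web (opp e)"
  using pad_X_web'[of "[]" "opp e" "[]"] by (simp add: X_web_def[of e] mirror_compose mirror_pad)

primrec mirror_gen :: "gen \<Rightarrow> gen" where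
  "mirror_gen (GCap e) = GCap (opp e)"
| "mirror_gen (GCup e) = GCup (opp e)"
| "mirror_gen (GY e) = GY e"
| "mirror_gen (GL e) = GL e"
| "mirror_gen (GX e) = GX (opp e)"

lemma mirror_gen [simp]: "gen_bottom (mirror_gen g) = rev (gen_bottom g)"
  "gen_top (mirror_gen g) = rev (gen_top g)" "gen_web (mirror_gen g) = mirror (gen_web g)"
  by (cases g; simp)+

lemma mirror_gen_reduction [simp]: "mirror_gen (reduction h e) = reduction e h"
  by (auto simp: reduction_def neq_opp_iff)

lemma built_mirror: "built k s t z \<Longrightarrow> built k (rev s) (rev t) (mirror z)"
proof (induction rule: built.induct)
  case (built_layer k a g b t z)
  then show ?case
    using built.built_layer[of k "rev b" "mirror_gen g" "rev a" "rev t" "mirror z"]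
      by (simp add: mirror_compose mirror_pad)
qed (auto simp: mirror_add mirror_scale intro: built.intros)

lemma crossings_mirror: "crossings c s t x \<Longrightarrow> crossings c (rev s) (rev t) (mirror x)"
proof (induction rule: crossings.induct)
  case (crossings_X c u e v t x)
  then show ?case
    using crossings.crossings_X[of c "rev v" "opp e" "rev u" "rev t" "mirror x"]
    by (simp add: mirror_compose mirror_pad)
qed (auto intro: crossings.intros)

lemma reducible_reduction: "built j (a @ gen_top (reduction h e) @ s @ b) t w \<Longrightarrow>
    reducible (Suc j) (a @ h # e # s) b t (w \<odot> pad a (gen_web (reduction h e)) (s @ b))"
  using reducible_gen[of 0 "a @ [h]" a h "id_web (a @ [h])" j e s b t w "Suc j"]
    crossings_id[of "a @ [h]"]
    compose_id_web[OF Hom_pad[OF Hom_gen_web[of "reduction h e"], of a "s @ b"]] by simp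

text \<open>After the reflection the unmoved letter is the left one of the pair and the crossings
  lie to its right. The bare pair is reducible by \<open>reducible_reduction\<close>, and
  \<open>reducible_crossings\<close> restores the one-sided form.\<close>

lemma reducible_mirror: "reducible k s [] t z \<Longrightarrow> reducible k (rev s) [] (rev t) (mirror z)"
proof (induction k s "[] :: word" t z rule: reducible.induct)
  case (reducible_gen c s1 s' h x j e s2 t w k)
  have "reducible (Suc j) ((rev s2 @ [e]) @ h # rev s') [] (rev t)
    (mirror w \<odot> pad (rev s2) (gen_web (reduction e h)) (rev s'))"
    using reducible_reduction[of j "rev s2" e h "rev s'" "[]" "rev t" "mirror w"]
      built_mirror[OF reducible_gen(2)]
      mirror_gen(2)[of "reduction h e"] by simp
  moreover have "crossings c (rev (s1 @ e # s2)) ((rev s2 @ [e]) @ h # rev s')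
    (pad (rev s2 @ [e]) (mirror x) [])"
    using crossings_widen[OF crossings_mirror[OF reducible_gen(1)], of "rev s2 @ [e]" "[]"] by simp
  ultimately have "reducible (Suc j + c) (rev (s1 @ e # s2)) [] (rev t)
    ((mirror w \<odot> pad (rev s2) (gen_web (reduction e h)) (rev s'))
      \<odot> pad (rev s2 @ [e]) (mirror x) [])"
    using reducible_crossings by fastforce
  then have "reducible k (rev (s1 @ e # s2)) [] (rev t)
    ((mirror w \<odot> pad (rev s2) (gen_web (reduction e h)) (rev s'))
      \<odot> pad (rev s2 @ [e]) (mirror x) [])"
    by (rule reducible_mono) (use reducible_gen(3) in simp)
  then show ?case
    using mirror_gen(3)[of "reduction h e"] by (simp add: mirror_compose mirror_pad compose_assoc)
qed (auto simp: mirror_add mirror_scale intro: reducible.intros)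

section \<open>Every web can be reduced\<close>

lemma reducible_outer_gen: "reducible k s (a @ gen_top g @ b) t z \<Longrightarrow>
  reducible (Suc k) s (a @ gen_bottom g @ b) t (z \<odot> pad (s @ a) (gen_web g) b)"
  using reducible_outer[OF _ built_gen[of a g b], of k s t z] by simp

text \<open>The letters of \<open>b\<close> are moved over from \<open>a\<close> one at a time. A reduction that involves the
  moved letter leaves a web from a shorter word, whose reduction can be pulled in front of it.\<close>

lemma reducible_extend:
  assumes main: "\<And>j s z. j \<le> k \<Longrightarrow> s \<noteq> [] \<Longrightarrow> built j s [] z \<Longrightarrow> reducible j s [] [] z"
  shows "length b < length a \<Longrightarrow> j \<le> k \<Longrightarrow> built j (a @ b) [] z \<Longrightarrow> reducible j a b [] z"
proof (induction b arbitrary: a j z)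
  case Nil
  then show ?case using main by auto
next
  case (Cons e b)
  have "reducible j (a @ [e]) b [] z"
    using Cons.prems by (intro Cons.IH) auto
  then show ?case
  proof (induction rule: reducible_snoc_induct)
    case (left z)
    then show ?case .
  next
    case (last c s' h x i w)
    \<comment> \<open>As \<open>e # b\<close> is shorter than \<open>a\<close>, the words
      \<open>s'\<close>, \<open>s' @ [opp e]\<close> and \<open>s'' @ [e]\<close> that occur below
      are all longer than \<open>b\<close>, so the induction hypothesis on \<open>b\<close> applies
      to each remainder.\<close>
    have len: "length a = Suc (length s')" using crossings_length[OF last(1)] by simp
    have "reducible (Suc i) (s' @ [h]) (e # b) [] (w \<odot> pad s' (gen_web (reduction h e)) b)"
    proof (cases "h = e")
      case False
      then have h: "h = opp e" by (simp add: neq_opp_iff)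
      have "reducible i s' b [] w"
        using last len Cons.prems h by (intro Cons.IH) auto
      then show ?thesis
        using reducible_outer_gen[of i s' "[]" "GCap h" b "[]" w]
        reducible_shift[of "Suc i" s' "[h]" "e # b"] h by simp
    next
      case True
      have "reducible i (s' @ [opp e]) b [] w"
        using last len Cons.prems True by (intro Cons.IH) auto
      then have "reducible (Suc i) (s' @ [e]) (e # b) [] (w \<odot> pad s' (Y_web e) b)"
      proof (induction rule: reducible_snoc_induct)
        case (left w)
        then show ?case
          using reducible_outer_gen[of i s' "[]" "GY e" b "[]" w]
          reducible_shift[of "Suc i" s' "[e]" "e # b"] by simp
      next
        case inner: (last c' s'' h' x' j' w')
        have len': "length s' = Suc (length s'')" using crossings_length[OF inner(1)] by simp
        have comm: "pad [] x' (opp e # b) \<odot> pad s' (Y_web e) b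
        = pad (s'' @ [h']) (Y_web e) b \<odot> pad [] x' (e # e # b)"
          using pad_commute[OF crossings_Hom[OF inner(1)] Hom_Y_web[of e], of "[]" "[]" b] by simp
        show ?case
        proof (cases "h' = e")
          \<comment> \<open>Three letters \<open>e\<close> end in one vertex; \<open>cap_Y\<close>
            lets the left two of them merge instead.\<close>
          case True
          have "built (Suc j') (s'' @ [opp e] @ e # b) [] (w' \<odot> pad s'' (cap_web (opp e)) b)"
            using built_layer[of j' s'' "GCap (opp e)" b "[]" w'] inner(2) True by simp
          then have "reducible (Suc i) (s' @ [e]) (e # b) []
              ((w' \<odot> pad s'' (cap_web (opp e)) b) \<odot> pad s'' (Y_web e) (e # b)
              \<odot> pad [] x' (e # e # b))"
            using reducible_gen[of c' s' s'' e x' "Suc j'" e "[]" "e # b" "[]" _ "Suc i"]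
            inner(1,3) True by simp
          then show ?thesis
            using True by (simp add: comm compose_assoc cap_Y[THEN compose_eq_cont])
        next
          \<comment> \<open>Two successive mergings equal a cap after a crossing, by
            \<open>cap_X_left\<close>. The cap ends on the outer letter \<open>e\<close>, and
            \<open>reducible_X\<close> carries the reduction of \<open>w'\<close> through the
            crossing.\<close>
          case False
          then have h': "h' = opp e" by (simp add: neq_opp_iff)
          have "reducible j' (s'' @ [e]) b [] w'"
            using inner last len len' Cons.prems h' by (intro Cons.IH) auto
          then have "reducible (Suc j') (s'' @ [e, opp e]) (e # b) []
          (w' \<odot> pad (s'' @ [e]) (cap_web (opp e)) b)"
            using reducible_outer_gen[of j' "s'' @ [e]" "[]" "GCap (opp e)" b "[]" w']
              reducible_shift[of "Suc j'" "s'' @ [e]" "[opp e]" "e # b"] by simp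
          then have "reducible (Suc (Suc j')) (s'' @ [opp e, e]) (e # b) []
              ((w' \<odot> pad (s'' @ [e]) (cap_web (opp e)) b) \<odot> pad s'' (X_web (opp e)) (e # b))"
            using reducible_X[of "Suc j'" s'' "opp e" "[]" "e # b"] by simp
          moreover have "crossings c' (s' @ [e]) (s'' @ [opp e, e]) (pad [] x' [e])"
            using crossings_widen[OF inner(1), of "[]" "[e]"] h' by simp
          ultimately have "reducible (Suc (Suc j') + c') (s' @ [e]) (e # b) []
              (((w' \<odot> pad (s'' @ [e]) (cap_web (opp e)) b) \<odot> pad s'' (X_web (opp e)) (e # b))
                \<odot> pad [] (pad [] x' [e]) (e # b))"
            using reducible_crossings by blast
          then have "reducible (Suc i) (s' @ [e]) (e # b) []
              (((w' \<odot> pad (s'' @ [e]) (cap_web (opp e)) b) \<odot> pad s'' (X_web (opp e)) (e # b))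
                \<odot> pad [] (pad [] x' [e]) (e # b))"
            by (rule reducible_mono) (use inner(3) in simp)
          then show ?thesis
            using h' cap_X_left[of s'' "opp e" b, symmetric] 
            by (simp add: comm compose_assoc
            compose_eq_cont[of "pad s'' (Y_web (opp e)) b" "pad (s'' @ [opp e]) (Y_web e) b"])
        qed
      qed (auto simp: bilinear intro: reducible.intros)
      then show ?thesis using True by simp
    qed
    from reducible_crossings[OF last(1) this] show ?case
      using reducible_mono[of "Suc i + c"] last(3) by (simp add: compose_assoc)
  qed (auto intro: reducible.intros)
qed

lemma reducible_Nil: "reducible k [] b t z \<Longrightarrow> z = 0"
  by (induction k "[] :: word" b t z rule: reducible.induct) auto

lemma crossings_Nil: "crossings c [] t x \<Longrightarrow> x = id_web []"
  by (induction c "[] :: word" t x rule: crossings.induct) auto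

text \<open>The induction on the number of generators proves at the same time that closed webs are scalars
  and that webs with lower endpoints only are reducible.\<close>

definition collapses :: "nat \<Rightarrow> word \<Rightarrow> skein \<Rightarrow> bool" where
  "collapses k s z \<longleftrightarrow> (if s = [] then \<exists>c. z = c *\<^sub>K id_web [] else reducible k s [] [] z)"

lemma collapses_zero: "collapses k s 0"
  using skein.scale_zero_left[of "id_web []"]
    by (auto simp: collapses_def reducible_zero intro: exI[of _ 0])

lemma collapses_add: "collapses k s z \<Longrightarrow> collapses k s z' \<Longrightarrow> collapses k s (z + z')"
  using skein.scale_left_distrib[of _ _ "id_web []", symmetric]
    by (auto simp: collapses_def reducible_add split: if_splits)

lemma collapses_scale: "collapses k s z \<Longrightarrow> collapses k s (r *\<^sub>K z)"
  by (auto simp: collapses_def reducible_scale split: if_splits)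

lemma collapses_mono: "collapses k s z \<Longrightarrow> k \<le> l \<Longrightarrow> collapses l s z"
  by (auto simp: collapses_def reducible_mono split: if_splits)

lemma reducible_collapses: "reducible k s [] [] z \<Longrightarrow> collapses k s z"
  by (metis reducible_Nil collapses_zero collapses_def)

lemma collapses_mirror: "collapses k s z \<Longrightarrow> collapses k (rev s) (mirror z)"
  using reducible_mirror[of k s "[]" z] by (auto simp: collapses_def mirror_scale split: if_splits)

lemma collapses_crossings:
  assumes "crossings c s s' x" "collapses k s' z"
  shows "collapses (k + c) s (z \<odot> x)"
proof (cases "s' = []")
  case True
  with crossings_length[OF assms(1)] have "s = []" by simp
  with True assms crossings_Nil[of c s' x] show ?thesis
    using id_web_compose[OF Hom_id_web, of "[]"] by (auto simp: collapses_def bilinear)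
next
  case False
  with assms(2) have "reducible k s' [] [] z" by (simp add: collapses_def)
  from reducible_crossings[OF assms(1) this] show ?thesis by (intro reducible_collapses) simp
qed

context
  fixes k :: nat
  assumes main: "\<And>j s z. j \<le> k \<Longrightarrow> built j s [] z \<Longrightarrow> collapses j s z"
begin

lemma collapses_crossings_built:
  assumes "crossings c s s' x" "built j (s' @ b) [] z" "j \<le> k" "j + c \<le> l"
  shows "collapses l (s @ b) (z \<odot> pad [] x b)"
  using collapses_mono[OF collapses_crossings[OF crossings_widen[OF assms(1), of "[]" b], of j z]
    assms(4)] main[OF assms(3)] assms(2)
  by simp

text \<open>The critical pair consists of the left leg of the cup and a letter \<open>h\<close>
  before it. For equal signs merging and cup fuse to an \<open>L\<close>, for opposite signs the
  zigzag straightens. Either way the result is within reach of \<open>main\<close>.\<close>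

lemma collapses_cup_left_aux:
  assumes "reducible k (a @ [f]) (opp f # b) [] d"
  shows "collapses (Suc k) (a @ b) (d \<odot> pad a (cup_web f) b)"
  using assms
proof (induction rule: reducible_snoc_induct)
  case (left z)
  then show ?case
    using reducible_outer_gen[of k a "[]" "GCup f" b "[]" z] reducible_shift[of "Suc k" a b "[]"]
      by (intro reducible_collapses) simp
next
  case (last c s' h x j w)
  have comm: "pad [] x (f # opp f # b) \<odot> pad a (cup_web f) b
    = pad (s' @ [h]) (cup_web f) b \<odot> pad [] x b"
    using pad_commute[OF crossings_Hom[OF last(1)] Hom_cup_web[of f], of "[]" "[]" b] by simp
  show ?case
  proof (cases "h = f")
    case True
    have "built (Suc j) (s' @ [f] @ b) [] (w \<odot> pad s' (L_web f) b)"
      using built_layer[of j s' "GL f" b "[]" w] last(2) True by simp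
    then have "collapses (Suc k) (a @ b) ((w \<odot> pad s' (L_web f) b) \<odot> pad [] x b)"
      using collapses_crossings_built[OF last(1), of "Suc j" b] last(3) True by simp
    then show ?thesis
      using True by (simp add: comm compose_assoc Y_cup[THEN compose_eq_cont])
  next
    case False
    then have h: "h = opp f" by (simp add: neq_opp_iff)
    have "collapses (Suc k) (a @ b) (w \<odot> pad [] x b)"
      using collapses_crossings_built[OF last(1), of j b w "Suc k"] last(2,3) h by simp
    moreover have "pad [] x b \<in> Hom (a @ b) (s' @ opp f # b)"
      using Hom_pad[OF crossings_Hom[OF last(1)], of "[]" b] h by simp
    ultimately show ?thesis
      using h zigzag_left[of s' "opp f" b, THEN compose_eq_cont]
      by (simp add: comm compose_assoc id_web_compose)
  qed
qed (auto simp: bilinear intro: collapses_zero collapses_add collapses_scale)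

text \<open>Now the right leg of the cup belongs to the pair, while the left leg may have been moved
  by the crossings. An unmoved leg closes a loop with factor \<open>qint 3\<close>; a leg crossed
  once gives a bigon after \<open>X_cup\<close>.\<close>

lemma collapses_cup_crossing_form:
  assumes "crossing_form c a f s' h x" "built j (s' @ gen_top (reduction h (opp f)) @ b) [] w"
    "j + c < k"
  shows "collapses (Suc k) (a @ b)
    (w \<odot> pad s' (gen_web (reduction h (opp f))) b \<odot> pad [] x (opp f # b) \<odot> pad a (cup_web f) b)"
  using assms
proof (induction rule: crossing_form.induct)
  case (crossing_form_still c' a s' x' c f)
  have comm: "pad [] x' (f # opp f # b) \<odot> pad a (cup_web f) b = pad s' (cup_web f) b \<odot> pad [] x' b"
    using pad_commute[OF crossings_Hom[OF crossing_form_still(1)] Hom_cup_web[of f], of "[]" "[]"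
      b] by simp
  have x': "pad [] x' b \<in> Hom (a @ b) (s' @ b)"
    using Hom_pad[OF crossings_Hom[OF crossing_form_still(1)], of "[]" b] by simp
  have "collapses (Suc k) (a @ b) (w \<odot> pad [] x' b)"
    using collapses_crossings_built[OF crossing_form_still(1), of j b w "Suc k"]
      crossing_form_still(2-4) by simp
  then show ?case
    by (simp add: comm cap_cup[THEN compose_eq_cont] bilinear id_web_compose[OF x'] collapses_scale)
next
  case (crossing_form_cross c1 a p f x1 c2 s' x2 c)
  have 1: "pad s' (Y_web (opp f)) b \<odot> pad [] x2 (opp f # opp f # b)
      = pad [] x2 (f # b) \<odot> pad (p @ [f]) (Y_web (opp f)) b"
    using pad_commute[OF crossings_Hom[OF crossing_form_cross(2)] Hom_Y_web[of "opp f"], of "[]"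
      "[]" b] by simp
  have 2: "pad [] x1 (f # opp f # b) \<odot> pad a (cup_web f) b
    = pad (p @ [opp f]) (cup_web f) b \<odot> pad [] x1 b"
    using pad_commute[OF crossings_Hom[OF crossing_form_cross(1)] Hom_cup_web[of f], of "[]" "[]"
      b] by simp
  have 3: "pad [] (pad [] x2 [opp f] \<odot> pad p (X_web (opp f)) [] \<odot> pad [] x1 [f]) (opp f # b)
      = pad [] x2 (opp f # opp f # b) \<odot> pad p (X_web (opp f)) (opp f # b)
        \<odot> pad [] x1 (f # opp f # b)"
  proof -
    have "pad [] x1 [f] \<in> Hom (a @ [f]) (p @ [opp f, f])"
      using Hom_pad[OF crossings_Hom[OF crossing_form_cross(1)], of "[]" "[f]"] by simp
    moreover have "pad p (X_web (opp f)) [] \<in> Hom (p @ [opp f, f]) (p @ [f, opp f])"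
      using Hom_pad[OF Hom_X_web[of "opp f"], of p "[]"] by simp
    moreover have "pad [] x2 [opp f] \<in> Hom (p @ [f, opp f]) (s' @ [opp f])"
      using Hom_pad[OF crossings_Hom[OF crossing_form_cross(2)], of "[]" "[opp f]"] by simp
    ultimately show ?thesis by (simp add: pad_compose3)
  qed
  have L: "pad p (L_web (opp f)) b \<odot> pad [] x1 b \<in> Hom (a @ b) (p @ f # f # b)"
    using Hom_compose[OF Hom_pad[OF Hom_L_web[of "opp f"], of p b], of "pad [] x1 b" "a @ b"]
      Hom_pad[OF crossings_Hom[OF crossing_form_cross(1)], of "[]" b] by simp
  have "built (c2 + j) (p @ [f, f] @ b) [] (w \<odot> pad [] x2 (f # b))"
    using built_comp[OF built_widen[OF crossings_built[OF crossing_form_cross(2)], of "[]" "f #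
      b"]] crossing_form_cross(4) by simp
  then have "built (Suc (c2 + j)) (p @ [opp f] @ b) []
    ((w \<odot> pad [] x2 (f # b)) \<odot> pad p (L_web (opp f)) b)"
    using built_layer[of "c2 + j" p "GL (opp f)" b] by simp
  then have "collapses (Suc k) (a @ b)
    (((w \<odot> pad [] x2 (f # b)) \<odot> pad p (L_web (opp f)) b) \<odot> pad [] x1 b)"
    using crossing_form_cross(3,5) by
      (intro collapses_crossings_built[OF crossing_form_cross(1), of "Suc (c2 + j)"]) simp_all
  moreover have "w \<odot> pad s' (Y_web (opp f)) b \<odot> pad [] x2 (opp f # opp f # b)
      \<odot> pad p (X_web (opp f)) (opp f # b) \<odot> pad [] x1 (f # opp f # b) \<odot> pad a (cup_web f) b
    = - qint 2 *\<^sub>K (w \<odot> pad [] x2 (f # b) \<odot> pad p (L_web (opp f)) b \<odot> pad [] x1 b)"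
    using Y_L[of "p @ [f]" f b, THEN compose_eq_cont] id_web_compose[OF L]
    by (simp add: 1[THEN compose_eq_cont] 2 X_cup[THEN compose_eq_cont] compose_assoc bilinear)
  ultimately show ?case
    using collapses_scale[of "Suc k" "a @ b" _ "- qint 2"] by (simp add: 3 compose_assoc)
next
  case (crossing_form_reducible c a f s' h x)
  have "reducible (c + Suc j) (a @ [f]) (opp f # b) []
      ((w \<odot> pad s' (gen_web (reduction h (opp f))) b) \<odot> pad [] x (opp f # b))"
  proof (rule reducible_comp)
    show "reducible c (a @ [f]) (opp f # b) (s' @ [h, opp f] @ b) (pad [] x (opp f # b))"
      using reducible_widen[OF crossing_form_reducible(1), of "opp f # b"] by simp
    show "built (Suc j) (s' @ [h, opp f] @ b) [] (w \<odot> pad s' (gen_web (reduction h (opp f))) b)"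
      using built_layer[of j s' "reduction h (opp f)" b "[]" w] crossing_form_reducible(2) by simp
  qed
  then have "reducible k (a @ [f]) (opp f # b) []
      ((w \<odot> pad s' (gen_web (reduction h (opp f))) b) \<odot> pad [] x (opp f # b))"
    by (rule reducible_mono) (use crossing_form_reducible(3) in simp)
  from collapses_cup_left_aux[OF this] show ?case by (simp add: compose_assoc)
next
  case (crossing_form_add c a f s' h x x')
  then show ?case by (simp add: pad_add bilinear collapses_add)
qed

lemma collapses_cup_left:
  assumes "reducible k (a @ [f, opp f]) b [] d"
  shows "collapses (Suc k) (a @ b) (d \<odot> pad a (cup_web f) b)"
proof -
  have "reducible k ((a @ [f]) @ [opp f]) b [] d" using assms by simp
  then show ?thesis
  proof (induction rule: reducible_snoc_induct)
    case (left z)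
    then show ?case by (rule collapses_cup_left_aux)
  next
    case (last c s' h x j w)
    from collapses_cup_crossing_form[OF crossings_crossing_form[OF last(1)] last(2,3)] show ?case
      by (simp add: compose_assoc)
  qed (auto simp: bilinear intro: collapses_zero collapses_add collapses_scale)
qed

text \<open>Opposite signs give a merging by \<open>cap_L\<close>. For equal signs the merging and
  the \<open>L\<close> form a crossing, which is a gain only because a crossing counts as one
  generator.\<close>

lemma collapses_L_left_aux:
  assumes "reducible k (a @ [opp e]) (opp e # b) [] d"
  shows "collapses (Suc k) (a @ e # b) (d \<odot> pad a (L_web e) b)"
  using assms
proof (induction rule: reducible_snoc_induct)
  case (left z)
  then show ?case
    using reducible_outer_gen[of k a "[]" "GL e" b "[]" z]
      reducible_shift[of "Suc k" a "e # b" "[]"] by (intro reducible_collapses) simp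
next
  case (last c s' h x j w)
  have comm: "pad [] x (opp e # opp e # b) \<odot> pad a (L_web e) b
    = pad (s' @ [h]) (L_web e) b \<odot> pad [] x (e # b)"
    using pad_commute[OF crossings_Hom[OF last(1)] Hom_L_web[of e], of "[]" "[]" b] by simp
  show ?case
  proof (cases "h = e")
    case True
    have "built (Suc j) (s' @ [e, e] @ b) [] (w \<odot> pad s' (Y_web e) b)"
      using built_layer[of j s' "GY e" b "[]" w] last(2) True by simp
    then have "collapses (Suc k) (a @ e # b) ((w \<odot> pad s' (Y_web e) b) \<odot> pad [] x (e # b))"
      using collapses_crossings_built[OF last(1), of "Suc j" "e # b"] last(3) True by simp
    then show ?thesis
      using True by (simp add: comm compose_assoc cap_L[THEN compose_eq_cont])
  next
    case False
    then have h: "h = opp e" by (simp add: neq_opp_iff)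
    have "built (Suc j) (s' @ [opp e, e] @ b) [] (w \<odot> pad s' (X_web (opp e)) b)"
      using built_layer[of j s' "GX (opp e)" b "[]" w] last(2) h by simp
    then have "collapses (Suc k) (a @ e # b) ((w \<odot> pad s' (X_web (opp e)) b) \<odot> pad [] x (e # b))"
      using collapses_crossings_built[OF last(1), of "Suc j" "e # b"] last(3) h by simp
    then show ?thesis
      using h pad_X_web'[of s' "opp e" b] by (simp add: comm compose_assoc)
  qed
qed (auto simp: bilinear intro: collapses_zero collapses_add collapses_scale)

text \<open>A bigon appears in both main cases: directly when the leg is unmoved, and after
  \<open>cap_X_left\<close> has turned cap and crossing into two mergings when it is crossed
  once.\<close>

lemma collapses_L_crossing_form:
  assumes "crossing_form c a (opp e) s' h x"
    "built j (s' @ gen_top (reduction h (opp e)) @ b) [] w" "j + c < k"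
  shows "collapses (Suc k) (a @ e # b)
    (w \<odot> pad s' (gen_web (reduction h (opp e))) b \<odot> pad [] x (opp e # b) \<odot> pad a (L_web e) b)"
  using assms
proof (induction c a "opp e" s' h x rule: crossing_form.induct)
  case (crossing_form_still c' a s' x' c)
  have comm: "pad [] x' (opp e # opp e # b) \<odot> pad a (L_web e) b
    = pad s' (L_web e) b \<odot> pad [] x' (e # b)"
    using pad_commute[OF crossings_Hom[OF crossing_form_still(1)] Hom_L_web[of e], of "[]" "[]" b]
      by simp
  have x': "pad [] x' (e # b) \<in> Hom (a @ e # b) (s' @ e # b)"
    using Hom_pad[OF crossings_Hom[OF crossing_form_still(1)], of "[]" "e # b"] by simp
  have "collapses (Suc k) (a @ e # b) (w \<odot> pad [] x' (e # b))"
    using collapses_crossings_built[OF crossing_form_still(1), of j "e # b" w "Suc k"]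
      crossing_form_still(2-4) by simp
  from collapses_scale[OF this, of "- qint 2"] show ?case
    using Y_L[of s' e b, THEN compose_eq_cont]
    by (simp add: comm bilinear id_web_compose[OF x'])
next
  case (crossing_form_cross c1 a p x1 c2 s' x2 c)
  have 1: "pad s' (cap_web e) b \<odot> pad [] x2 (e # opp e # b)
      = pad [] x2 b \<odot> pad (p @ [opp e]) (cap_web e) b"
    using pad_commute[OF crossings_Hom[OF crossing_form_cross(2)] Hom_cap_web[of e], of "[]" "[]"
      b] by simp
  have 2: "pad [] x1 (opp e # opp e # b) \<odot> pad a (L_web e) b
    = pad (p @ [e]) (L_web e) b \<odot> pad [] x1 (e # b)"
    using pad_commute[OF crossings_Hom[OF crossing_form_cross(1)] Hom_L_web[of e], of "[]" "[]" b]
      by simp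
  have 3: "pad [] (pad [] x2 [e] \<odot> pad p (X_web e) [] \<odot> pad [] x1 [opp e]) (opp e # b)
      = pad [] x2 (e # opp e # b) \<odot> pad p (X_web e) (opp e # b) \<odot> pad [] x1 (opp e # opp e # b)"
  proof -
    have "pad [] x1 [opp e] \<in> Hom (a @ [opp e]) (p @ [e, opp e])"
      using Hom_pad[OF crossings_Hom[OF crossing_form_cross(1)], of "[]" "[opp e]"] by simp
    moreover have "pad p (X_web e) [] \<in> Hom (p @ [e, opp e]) (p @ [opp e, e])"
      using Hom_pad[OF Hom_X_web[of e], of p "[]"] by simp
    moreover have "pad [] x2 [e] \<in> Hom (p @ [opp e, e]) (s' @ [e])"
      using Hom_pad[OF crossings_Hom[OF crossing_form_cross(2)], of "[]" "[e]"] by simp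
    ultimately show ?thesis by (simp add: pad_compose3)
  qed
  have x1: "pad [] x1 (e # b) \<in> Hom (a @ e # b) (p @ e # e # b)"
    using Hom_pad[OF crossings_Hom[OF crossing_form_cross(1)], of "[]" "e # b"] by simp
  have "built (c2 + j) (p @ [opp e] @ b) [] (w \<odot> pad [] x2 b)"
    using built_comp[OF built_widen[OF crossings_built[OF crossing_form_cross(2)], of "[]" b]]
      crossing_form_cross(4) by simp
  then have "built (Suc (c2 + j)) (p @ [e, e] @ b) [] ((w \<odot> pad [] x2 b) \<odot> pad p (Y_web e) b)"
    using built_layer[of "c2 + j" p "GY e" b] by simp
  then have "collapses (Suc k) (a @ e # b)
    (((w \<odot> pad [] x2 b) \<odot> pad p (Y_web e) b) \<odot> pad [] x1 (e # b))"
    using crossing_form_cross(3,5) by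
      (intro collapses_crossings_built[OF crossing_form_cross(1), of "Suc (c2 + j)"]) simp_all
  moreover have "w \<odot> pad s' (cap_web e) b \<odot> pad [] x2 (e # opp e # b)
      \<odot> pad p (X_web e) (opp e # b) \<odot> pad [] x1 (opp e # opp e # b) \<odot> pad a (L_web e) b
    = - qint 2 *\<^sub>K (w \<odot> pad [] x2 b \<odot> pad p (Y_web e) b \<odot> pad [] x1 (e # b))"
    using Y_L[of "p @ [e]" e b, THEN compose_eq_cont] id_web_compose[OF x1]
    by (simp add: 1[THEN compose_eq_cont] 2 cap_X_left[THEN compose_eq_cont] compose_assoc bilinear)
  ultimately show ?case
    using collapses_scale[of "Suc k" "a @ e # b" _ "- qint 2"] by (simp add: 3 compose_assoc)
next
  case (crossing_form_reducible c a s' h x)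
  have "reducible (c + Suc j) (a @ [opp e]) (opp e # b) []
      ((w \<odot> pad s' (gen_web (reduction h (opp e))) b) \<odot> pad [] x (opp e # b))"
  proof (rule reducible_comp)
    show "reducible c (a @ [opp e]) (opp e # b) (s' @ [h, opp e] @ b) (pad [] x (opp e # b))"
      using reducible_widen[OF crossing_form_reducible(1), of "opp e # b"] by simp
    show "built (Suc j) (s' @ [h, opp e] @ b) [] (w \<odot> pad s' (gen_web (reduction h (opp e))) b)"
      using built_layer[of j s' "reduction h (opp e)" b "[]" w] crossing_form_reducible(2) by simp
  qed
  then have "reducible k (a @ [opp e]) (opp e # b) []
      ((w \<odot> pad s' (gen_web (reduction h (opp e))) b) \<odot> pad [] x (opp e # b))"
    by (rule reducible_mono) (use crossing_form_reducible(3) in simp)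
  from collapses_L_left_aux[OF this] show ?case by (simp add: compose_assoc)
next
  case (crossing_form_add c a s' h x x')
  then show ?case by (simp add: pad_add bilinear collapses_add)
qed

lemma collapses_L_left:
  assumes "reducible k (a @ [opp e, opp e]) b [] d"
  shows "collapses (Suc k) (a @ e # b) (d \<odot> pad a (L_web e) b)"
proof -
  have "reducible k ((a @ [opp e]) @ [opp e]) b [] d" using assms by simp
  then show ?thesis
  proof (induction rule: reducible_snoc_induct)
    case (left z)
    then show ?case by (rule collapses_L_left_aux)
  next
    case (last c s' h x j w)
    from collapses_L_crossing_form[OF crossings_crossing_form[OF last(1)] last(2,3)] show ?case
      by (simp add: compose_assoc)
  qed (auto simp: bilinear intro: collapses_zero collapses_add collapses_scale)
qed

lemma collapses_up_left:
  assumes "built k (a @ gen_top g @ b) [] d" "length b < length (a @ gen_top g)"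
    "g = GCup e \<or> g = GL e"
  shows "collapses (Suc k) (a @ gen_bottom g @ b) (d \<odot> pad a (gen_web g) b)"
proof -
  have "reducible k (a @ gen_top g) b [] d"
    by (rule reducible_extend[OF _ assms(2) order.refl])
      (use assms main in \<open>auto simp: collapses_def\<close>)
  then show ?thesis using assms(3) collapses_cup_left collapses_L_left by auto
qed

text \<open>One of the two sides of the new strands is shorter than the other side together with these
  strands, and \<open>reducible_extend\<close> applies to that side, possibly after mirroring.\<close>

lemma collapses_up:
  assumes "built k (a @ gen_top g @ b) [] d" "g = GCup e \<or> g = GL e"
  shows "collapses (Suc k) (a @ gen_bottom g @ b) (d \<odot> pad a (gen_web g) b)"
proof (cases "length b < length (a @ gen_top g)")
  case True
  with assms show ?thesis by (intro collapses_up_left)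
next
  case False
  have "built k (rev b @ gen_top (mirror_gen g) @ rev a) [] (mirror d)"
    using built_mirror[OF assms(1)] by simp
  moreover have "length (rev a) < length (rev b @ gen_top (mirror_gen g))"
    using False assms(2) by auto
  moreover have "mirror_gen g = GCup (opp e) \<or> mirror_gen g = GL e" using assms(2) by auto
  ultimately have "collapses (Suc k) (rev b @ gen_bottom (mirror_gen g) @ rev a)
    (mirror d \<odot> pad (rev b) (gen_web (mirror_gen g)) (rev a))"
    using collapses_up_left by blast
  from collapses_mirror[OF this] show ?thesis by (simp add: mirror_compose mirror_pad)
qed

end

text \<open>The lowest generator decides. A cap or a merging is a reduction already, a crossing is
  passed by \<open>reducible_X\<close>, and only cups and splittings need the induction hypothesis
  for webs other than the one above the lowest generator.\<close>

lemma built_collapses: "built k s [] z \<Longrightarrow> collapses k s z"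
proof (induction k arbitrary: s z rule: less_induct)
  case (less k)
  have "collapses k s z" if "built k s t z" "t = []"
    "\<And>j s z. j < k \<Longrightarrow> built j s [] z \<Longrightarrow> collapses j s z" for s t z k
    using that
  proof (induction rule: built.induct)
    case (built_id k s)
    then show ?case using skein.scale_one[of "id_web []"]
      by (auto simp: collapses_def intro: exI[of _ 1])
  next
    case (built_layer k a g b t z)
    have main: "j \<le> k \<Longrightarrow> built j s [] z \<Longrightarrow> collapses j s z" for j s z
      using built_layer.prems(2) by simp
    have reduction: "collapses (Suc k) (a @ gen_bottom (reduction h e) @ b)
      (z \<odot> pad a (gen_web (reduction h e)) b)" if "g = reduction h e" for h e
      using reducible_reduction[of k a h e b "[]" "[]" z] built_layer.hyps built_layer.prems(1)
        that by (intro reducible_collapses) simp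
    show ?case
    proof (cases g)
      case (GCap e)
      then show ?thesis using reduction[of e "opp e"] by simp
    next
      case (GY e)
      then show ?thesis using reduction[of e e] by simp
    next
      case (GX e)
      have "collapses k (a @ opp e # e # b) z"
        using main[OF order.refl] built_layer.hyps built_layer.prems(1) GX by simp
      then have "reducible k (a @ opp e # e # b) [] [] z" by (simp add: collapses_def)
      from reducible_X[OF this] show ?thesis using GX by (intro reducible_collapses) simp
    next
      case (GCup e)
      then show ?thesis
        using built_layer.hyps built_layer.prems(1)
        by (intro collapses_up[where e = e, OF main]) simp_all
    next
      case (GL e)
      then show ?thesis
        using built_layer.hyps built_layer.prems(1)
        by (intro collapses_up[where e = e, OF main]) simp_all
    qed
  qed (auto intro: collapses_zero collapses_add collapses_scale)
  from this[OF less.prems HOL.refl less.IH] show ?case .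
qed

section \<open>Webs with fewer upper than lower endpoints\<close>

lemma Hom_Vertex: "i \<le> 3 \<Longrightarrow> web (Vertex e i) \<in> Hom (replicate i e) (replicate (3 - i) (opp e))"
  by (rule Hom_web) (simp add: drawings_def)

lemma unbend_left:
  assumes "i < 3"
  shows "pad [opp e] (web (Vertex e (Suc i))) [] \<odot> pad [] (cup_web (opp e)) (replicate i e)
    = web (Vertex e i)"
proof -
  have V: "web (Vertex e i) \<in> Hom (replicate i e) (opp e # replicate (2 - i) (opp e))"
  proof -
    have "3 - i = Suc (2 - i)" using assms by simp
    then show ?thesis using Hom_Vertex[of i e] assms by simp
  qed
  have "pad [opp e] (web (Vertex e (Suc i))) []
      = pad [opp e] (cap_web e) (replicate (2 - i) (opp e)) \<odot> pad [opp e, e] (web (Vertex e i)) []"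
    using pad_rel[OF bend_left[OF assms] Hom_cap_web V, of "[opp e]" "[]"] by simp
  moreover have "pad [opp e, e] (web (Vertex e i)) [] \<odot> pad [] (cup_web (opp e)) (replicate i e)
      = pad [] (cup_web (opp e)) (opp e # replicate (2 - i) (opp e)) \<odot> web (Vertex e i)"
    using pad_commute[OF Hom_cup_web[of "opp e"] V, of "[]" "[]" "[]"] by simp
  ultimately show ?thesis
    using zigzag_right[of "[]" "opp e" "replicate (2 - i) (opp e)", THEN compose_eq_cont]
    by (simp add: compose_assoc id_web_compose[OF V])
qed

lemma unbend_right:
  assumes "i < 3"
  shows "pad [] (web (Vertex e (Suc i))) [opp e] \<odot> pad (replicate i e) (cup_web e) []
    = web (Vertex e i)"
proof -
  have V: "web (Vertex e i) \<in> Hom (replicate i e) (replicate (2 - i) (opp e) @ [opp e])"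
  proof -
    have "3 - i = Suc (2 - i)" using assms by simp
    then show ?thesis using Hom_Vertex[of i e] assms by (simp add: replicate_append_same)
  qed
  have "pad [] (web (Vertex e (Suc i))) [opp e]
      = pad (replicate (2 - i) (opp e)) (cap_web (opp e)) [opp e]
        \<odot> pad [] (web (Vertex e i)) [e, opp e]"
    using pad_rel[OF bend_right[OF assms] Hom_cap_web V, of "[]" "[opp e]"] by simp
  moreover have "pad [] (web (Vertex e i)) [e, opp e] \<odot> pad (replicate i e) (cup_web e) []
      = pad (replicate (2 - i) (opp e) @ [opp e]) (cup_web e) [] \<odot> web (Vertex e i)"
    using pad_commute[OF V Hom_cup_web[of e], of "[]" "[]" "[]"] by simp
  ultimately show ?thesis
    using zigzag_left[of "replicate (2 - i) (opp e)" "opp e" "[]", THEN compose_eq_cont]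
    by (simp add: compose_assoc id_web_compose[OF V])
qed

text \<open>Vertices with all legs on one side are not generators; they arise from \<open>L\<close>
  or \<open>Y\<close> by bending a leg. The factors of a juxtaposition are placed at different
  heights.\<close>

lemma built_web: "proper d \<Longrightarrow> \<exists>k. built k (bottom_word d) (top_word d) (web d)"
proof (induction d)
  case (Strands s)
  then show ?case using built_id[of 0 s] by (auto simp: id_web_def)
next
  case (Cup e)
  then show ?case using built_gen[of "[]" "GCup e" "[]"] by auto
next
  case (Cap e)
  then show ?case using built_gen[of "[]" "GCap e" "[]"] by auto
next
  case (Vertex e i)
  then consider "i = 0" | "i = 1" | "i = 2" | "i = 3" by fastforce
  then show ?case
  proof cases
    case 1
    have "built (1 + 1) [] [opp e, opp e, opp e]
      (pad [opp e] (L_web e) [] \<odot> pad [] (cup_web (opp e)) [])"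
      using built_gen[of "[]" "GCup (opp e)" "[]"] built_gen[of "[opp e]" "GL e" "[]"]
      by (intro built_comp[of _ _ "[opp e, e]"]) simp_all
    then show ?thesis using unbend_left[of 0 e] 1 by (auto simp: numeral_3_eq_3)
  next
    case 2
    then show ?thesis using built_gen[of "[]" "GL e" "[]"] by (auto simp: numeral_2_eq_2)
  next
    case 3
    then show ?thesis using built_gen[of "[]" "GY e" "[]"] by (auto simp: numeral_2_eq_2)
  next
    case 4
    have "built (1 + 1) [e, e, e] [] (pad [] (cap_web e) [] \<odot> pad [e] (Y_web e) [])"
      using built_gen[of "[]" "GCap e" "[]"] built_gen[of "[e]" "GY e" "[]"]
      by (intro built_comp[of _ _ "[e, opp e]"]) simp_all
    then show ?thesis using bend_left[of 2 e] 4 by (auto simp: numeral_3_eq_3 numeral_2_eq_2)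
  qed
next
  case (Stack w v)
  then obtain k l where "built k (bottom_word v) (top_word v) (web v)"
    "built l (bottom_word w) (top_word w) (web w)" "bottom_word w = top_word v" by auto
  then have "built (k + l) (bottom_word v) (top_word w) (web w \<odot> web v)" by (simp add: built_comp)
  then show ?case by (auto simp: compose_web)
next
  case (Beside v w)
  then obtain k l where kl: "built k (bottom_word v) (top_word v) (web v)"
    "built l (bottom_word w) (top_word w) (web w)" by auto
  have "web v \<otimes> web w = pad [] (web v) (top_word w) \<odot> pad (bottom_word v) (web w) []"
    using interchange[OF Hom_id_web built_Hom[OF kl(1)] built_Hom[OF kl(2)] Hom_id_web]
      compose_id_web[OF built_Hom[OF kl(1)]] id_web_compose[OF built_Hom[OF kl(2)]]
    by (simp add: pad_def)
  moreover have "built (l + k) (bottom_word v @ bottom_word w) (top_word v @ top_word w)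
      (pad [] (web v) (top_word w) \<odot> pad (bottom_word v) (web w) [])"
    using built_widen[OF kl(1), of "[]" "top_word w"] built_widen[OF kl(2), of "bottom_word v" "[]"]
    by (intro built_comp[of _ _ "bottom_word v @ top_word w"]) simp_all
  ultimately show ?case by (auto simp: tensor_web[symmetric])
qed

lemma Hom_built: "z \<in> Hom s t \<Longrightarrow> \<exists>k. built k s t z"
proof (induction rule: Hom_induct)
  case (web d)
  then show ?case using built_web[of d] by (auto simp: drawings_def)
next
  case (add x y)
  then obtain k l where "built k s t x" "built l s t y" by auto
  then have "built (max k l) s t (x + y)" by (intro built_add) (auto elim: built_mono)
  then show ?case by auto
qed (use built_zero built_scale in blast)+

lemma bend_unbend:
  assumes "z \<in> Hom s (t @ [e])"
  shows "pad [] (pad t (cap_web e) [] \<odot> pad [] z [opp e]) [e] \<odot> pad s (cup_web (opp e)) [] = z"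
proof -
  have z: "pad [] z [opp e] \<in> Hom (s @ [opp e]) (t @ [e, opp e])"
    using Hom_pad[OF assms, of "[]" "[opp e]"] by simp
  have "pad [] (pad t (cap_web e) [] \<odot> pad [] z [opp e]) [e]
    = pad t (cap_web e) [e] \<odot> pad [] z [opp e, e]"
    using pad_compose'[OF z Hom_pad[OF Hom_cap_web[of e], of t "[]"], of "[]" "[e]"] by simp
  moreover have "pad [] z [opp e, e] \<odot> pad s (cup_web (opp e)) []
    = pad (t @ [e]) (cup_web (opp e)) [] \<odot> z"
    using pad_commute[OF assms Hom_cup_web[of "opp e"], of "[]" "[]" "[]"] by simp
  ultimately show ?thesis
    using zigzag_left[of t e "[]", THEN compose_eq_cont]
      by (simp add: compose_assoc id_web_compose[OF assms])
qed

lemma Hom_bend: "z \<in> Hom s (t @ [e]) \<Longrightarrow>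
  pad t (cap_web e) [] \<odot> pad [] z [opp e] \<in> Hom (s @ [opp e]) t"
  using Hom_compose[OF Hom_pad[OF Hom_cap_web[of e], of t "[]"], of "pad [] z [opp e]" "s @
    [opp e]"]
    Hom_pad[of z s "t @ [e]" "[]" "[opp e]"] by simp

lemma reducible_unbend:
  assumes "reducible k a (b @ [opp e]) t z"
  shows "reducible (Suc k) a b (t @ [e]) (pad [] z [e] \<odot> pad (a @ b) (cup_web (opp e)) [])"
  using reducible_outer_gen[of k a b "GCup (opp e)" "[]" "t @ [e]" "pad [] z [e]"]
    reducible_widen[OF assms, of "[e]"] by simp

text \<open>Bending the last upper endpoint down moves one letter from \<open>t\<close> to
  \<open>b\<close> and preserves the length condition. Bending back adds a cup on outer strands
  only, which leaves the reduction intact.\<close>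

lemma Hom_reducible:
  "z \<in> Hom (a @ b) t \<Longrightarrow> length b + length t < length a \<Longrightarrow> \<exists>k. reducible k a b t z"
proof (induction t arbitrary: b z rule: rev_induct)
  case Nil
  then obtain k where k: "built k (a @ b) [] z" using Hom_built by blast
  have main: "reducible j s [] [] y" if "s \<noteq> []" "built j s [] y" for j s y
    using built_collapses[OF that(2)] that(1) by (simp add: collapses_def)
  from Nil have "length b < length a" by simp
  from reducible_extend[OF main this order.refl k] show ?case by blast
next
  case (snoc e t)
  let ?y = "pad t (cap_web e) [] \<odot> pad [] z [opp e]"
  have "?y \<in> Hom (a @ b @ [opp e]) t" using Hom_bend[OF snoc.prems(1)] by simp
  from snoc.IH[OF this] obtain k where "reducible k a (b @ [opp e]) t ?y" using snoc.prems by auto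
  from reducible_unbend[OF this] show ?case using bend_unbend[OF snoc.prems(1)] by auto
qed

section \<open>The left ideal of mergings on upward strands\<close>

definition pluses :: "nat \<Rightarrow> word" where
  "pluses n = replicate n Plus"

lemma pluses_add: "pluses (m + n) = pluses m @ pluses n"
  by (simp add: pluses_def replicate_add)

lemma pluses_Suc: "pluses (Suc n) = Plus # pluses n"
  by (simp add: pluses_def)

lemma pluses_snoc: "pluses (Suc n) = pluses n @ [Plus]"
  by (simp add: pluses_def replicate_append_same)

lemma pluses_0 [simp]: "pluses 0 = []"
  by (simp add: pluses_def)

lemma length_pluses [simp]: "length (pluses n) = n"
  by (simp add: pluses_def)

lemma append_eq_plusesE:
  assumes "u @ v = pluses n"
  obtains i j where "u = pluses i" "v = pluses j" "i + j = n"
proof -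
  have len: "length u + length v = n" by (metis assms length_append length_pluses)
  with assms have "u @ v = pluses (length u) @ pluses (length v)"
    by (simp add: pluses_add[symmetric])
  then have "u = pluses (length u)" "v = pluses (length v)"
    by (metis append_eq_append_conv length_pluses)+
  from this len show ?thesis by (rule that)
qed

lemma Cons_eq_plusesE:
  assumes "e # v = pluses n"
  obtains j where "e = Plus" "v = pluses j" "n = Suc j"
  using assms that by (cases n) (auto simp: pluses_Suc)

lemma crossings_pluses: "crossings c (pluses n) t x \<Longrightarrow> t = pluses n \<and> x = id_web (pluses n)"
proof (induction c "pluses n" t x rule: crossings.induct)
  case (crossings_X c u e v t x)
  obtain j where "e # opp e # v = pluses j" using append_eq_plusesE[OF crossings_X(3)] by blast
  then obtain j' where "e = Plus" "opp e # v = pluses j'" by (rule Cons_eq_plusesE)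
  then show ?case by (auto elim: Cons_eq_plusesE)
qed auto

definition Y_ideal :: "nat \<Rightarrow> word \<Rightarrow> skein set" where
  "Y_ideal n t = skein.span {w \<odot> pad (pluses i) (Y_web Plus) (pluses j) | w i j.
     i + j + 2 = n \<and> w \<in> Hom (pluses i @ Minus # pluses j) t}"

lemma Y_ideal_gen: "i + j + 2 = n \<Longrightarrow> w \<in> Hom (pluses i @ Minus # pluses j) t \<Longrightarrow>
    w \<odot> pad (pluses i) (Y_web Plus) (pluses j) \<in> Y_ideal n t"
  unfolding Y_ideal_def by (rule skein.span_base) auto

lemma Y_ideal_zero: "0 \<in> Y_ideal n t"
  unfolding Y_ideal_def by (rule skein.span_zero)

lemma Y_ideal_add: "x \<in> Y_ideal n t \<Longrightarrow> y \<in> Y_ideal n t \<Longrightarrow> x + y \<in> Y_ideal n t"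
  unfolding Y_ideal_def by (rule skein.span_add)

lemma Y_ideal_scale: "x \<in> Y_ideal n t \<Longrightarrow> c *\<^sub>K x \<in> Y_ideal n t"
  unfolding Y_ideal_def by (rule skein.span_scale)

lemma Y_ideal_induct [consumes 1, case_names gen zero add scale]:
  assumes "x \<in> Y_ideal n t"
    and "\<And>w i j. i + j + 2 = n \<Longrightarrow> w \<in> Hom (pluses i @ Minus # pluses j) t \<Longrightarrow>
      P (w \<odot> pad (pluses i) (Y_web Plus) (pluses j))"
    and "P 0" "\<And>x y. P x \<Longrightarrow> P y \<Longrightarrow> P (x + y)" "\<And>c x. P x \<Longrightarrow> P (c *\<^sub>K x)"
  shows "P x"
  using assms(1) unfolding Y_ideal_def
  by (rule skein.span_induct_alt) (use assms(2-) in auto)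

text \<open>On a word of upward strands neither a crossing nor a cap is possible, so a reduction can
  only begin with \<open>Y_web Plus\<close>.\<close>

lemma reducible_Y_ideal: "reducible k (pluses n) [] t z \<Longrightarrow> z \<in> Y_ideal n t"
proof (induction k "pluses n" "[] :: word" t z rule: reducible.induct)
  case (reducible_gen c s1 s' h x j e s2 t w k)
  obtain i i' where s1: "s1 = pluses i" and "e # s2 = pluses i'" and i': "i + i' = n"
    using reducible_gen(4) by (rule append_eq_plusesE)
  then obtain l where e: "e = Plus" and s2: "s2 = pluses l" and n: "i + Suc l = n"
    by (auto elim: Cons_eq_plusesE)
  from reducible_gen(1) s1 have *: "s' @ [h] = pluses i" and x: "x = id_web (pluses i)"
    using crossings_pluses by auto
  obtain m m' where s': "s' = pluses m" and "[h] = pluses m'" and m': "m + m' = i"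
    using * by (rule append_eq_plusesE)
  then obtain m'' where h: "h = Plus" and "[] = pluses m''" and "m' = Suc m''"
    by (auto elim: Cons_eq_plusesE)
  then have i: "i = Suc m" using m' by (cases m'') (auto simp: pluses_Suc)
  have "w \<in> Hom (pluses m @ Minus # pluses l) t"
    using built_Hom[OF reducible_gen(2)] e h s' s2 by simp
  from Y_ideal_gen[OF _ this, of n] have "w \<odot> pad s' (Y_web Plus) s2 \<in> Y_ideal n t"
    using n i s' s2 by simp
  moreover have "pad s' (Y_web Plus) s2 \<odot> id_web (s' @ Plus # Plus # s2) = pad s' (Y_web Plus) s2"
    using compose_id_web[OF Hom_pad[OF Hom_Y_web[of Plus], of s' s2]] by simp
  ultimately show ?case using e h x s' i by (simp add: pluses_snoc)
qed (auto intro: Y_ideal_zero Y_ideal_add Y_ideal_scale)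

lemma Hom_short: "z \<in> Hom (pluses n) t \<Longrightarrow> length t < n \<Longrightarrow> z \<in> Y_ideal n t"
  using Hom_reducible[of z "pluses n" "[]" t] reducible_Y_ideal by auto

lemma Y_ideal_Hom: "x \<in> Y_ideal n t \<Longrightarrow> x \<in> Hom (pluses n) t"
proof (induction rule: Y_ideal_induct)
  case (gen w i j)
  have "pluses n = pluses i @ [Plus, Plus] @ pluses j"
    using gen(1) pluses_add[of i "Suc (Suc j)"] by (auto simp: pluses_Suc)
  then show ?case
    using Hom_compose[OF gen(2)] Hom_pad[OF Hom_Y_web[of Plus], of "pluses i" "pluses j"] by simp
qed (auto intro: Hom_add Hom_scale)

lemma Y_ideal_compose: "x \<in> Y_ideal n t \<Longrightarrow> y \<in> Hom t u \<Longrightarrow> y \<odot> x \<in> Y_ideal n u"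
proof (induction rule: Y_ideal_induct)
  case (gen w i j)
  then show ?case
    using Y_ideal_gen[OF gen(1) Hom_compose[OF gen(3,2)]] by (simp add: compose_assoc)
qed (auto simp: bilinear Y_ideal_zero intro: Y_ideal_add Y_ideal_scale)

lemma Y_ideal_widen: "x \<in> Y_ideal n t \<Longrightarrow> pad [] x [Plus] \<in> Y_ideal (Suc n) (t @ [Plus])"
proof (induction rule: Y_ideal_induct)
  case (gen w i j)
  have "pad [] w [Plus] \<in> Hom (pluses i @ Minus # pluses (Suc j)) (t @ [Plus])"
    using Hom_pad[OF gen(2), of "[]" "[Plus]"] by (simp add: pluses_snoc)
  from Y_ideal_gen[OF _ this, of "Suc n"] gen(1)
  have "pad [] w [Plus] \<odot> pad (pluses i) (Y_web Plus) (pluses (Suc j)) \<in> Y_ideal (Suc n)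
    (t @ [Plus])" by simp
  moreover have "w \<in> Hom (pluses i @ [Minus] @ pluses j) t" using gen(2) by simp
  ultimately show ?case
    using pad_compose'[OF Hom_pad[OF Hom_Y_web[of Plus], of "pluses i" "pluses j"], of w _ t "[]"
      "[Plus]"]
    by (simp add: pluses_snoc)
qed (auto simp: pad_add pad_scale intro: Y_ideal_zero Y_ideal_add Y_ideal_scale)

text \<open>After the last upper endpoint is bent down, the reduction either involves two upward
  strands, which leads into the ideal, or caps the bent letter against the last upward strand. In
  the latter case bending back leaves \<open>pad [] w [Plus]\<close> with \<open>w\<close> on
  \<open>n\<close> strands, and the induction applies.\<close>

lemma Hom_pluses: "z \<in> Hom (pluses n) (pluses n) \<Longrightarrow>
  \<exists>c. z - c *\<^sub>K id_web (pluses n) \<in> Y_ideal n (pluses n)"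
proof (induction n arbitrary: z)
  case 0
  then obtain k where "built k [] [] z" using Hom_built[of z "[]" "[]"] by auto
  from built_collapses[OF this] obtain c where "z = c *\<^sub>K id_web []" by (auto simp: collapses_def)
  then show ?case by (intro exI[of _ c]) (simp add: Y_ideal_zero)
next
  case (Suc n)
  let ?U = "\<lambda>y. pad [] y [Plus] \<odot> pad (pluses (Suc n)) (cup_web Minus) []"
  let ?y = "pad (pluses n) (cap_web Plus) [] \<odot> pad [] z [Minus]"
  have z: "z \<in> Hom (pluses (Suc n)) (pluses n @ [Plus])" using Suc.prems by (simp add: pluses_snoc)
  have "?y \<in> Hom ((pluses (Suc n) @ [Minus]) @ []) (pluses n)" using Hom_bend[OF z] by simp
  from Hom_reducible[OF this] obtain k where "reducible k (pluses (Suc n) @ [Minus]) [] (pluses n)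
    ?y" by auto
  then have "\<exists>c. ?U ?y - c *\<^sub>K id_web (pluses (Suc n)) \<in> Y_ideal (Suc n) (pluses (Suc n))"
  proof (induction rule: reducible_snoc_induct)
    case (left y)
    then have "?U y \<in> Y_ideal (Suc n) (pluses (Suc n))"
      using reducible_Y_ideal[OF reducible_unbend[of k "pluses (Suc n)" "[]" Plus "pluses n" y,
        simplified]]
      by (simp add: pluses_snoc)
    then show ?case by (intro exI[of _ 0]) simp
  next
    case (last c s' h x j w)
    from crossings_pluses[OF last(1)] have h: "h = Plus" "s' = pluses n"
      and x: "x = id_web (pluses (Suc n))"
      by (auto simp: pluses_snoc)
    then have w: "w \<in> Hom (pluses n) (pluses n)" using built_Hom[OF last(2)]
      by (simp add: reduction_def)
    from Suc.IH[OF this] obtain r where r: "w - r *\<^sub>K id_web (pluses n) \<in> Y_ideal n (pluses n)"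
      by auto
    have cap: "pad (pluses n) (cap_web Plus) [] \<in> Hom (pluses n @ [Plus, Minus]) (pluses n)"
      using Hom_pad[OF Hom_cap_web[of Plus], of "pluses n" "[]"] by simp
    have w': "pad [] w [Plus] \<in> Hom (pluses n @ [Plus]) (pluses n @ [Plus])"
      using Hom_pad[OF w, of "[]" "[Plus]"] by simp
    have "?U (w \<odot> pad (pluses n) (cap_web Plus) []) = pad [] w [Plus]"
      using pad_compose[OF cap w, of "[]" "[Plus]"] zigzag_left[of "pluses n" Plus "[]"]
        compose_id_web[OF w']
      by (simp add: compose_assoc pluses_snoc)
    moreover have "w \<odot> pad s' (gen_web (reduction h Minus)) [] \<odot> pad [] x [Minus]
      = w \<odot> pad (pluses n) (cap_web Plus) []"
      using compose_id_web[OF cap] by (simp add: h x pluses_snoc reduction_def)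
    moreover have "pad [] w [Plus] - r *\<^sub>K id_web (pluses (Suc n))
      = pad [] (w - r *\<^sub>K id_web (pluses n)) [Plus]"
      using pad_add[of "[]" "w - r *\<^sub>K id_web (pluses n)" "r *\<^sub>K id_web (pluses n)" "[Plus]"]
      by (simp add: pad_scale pluses_snoc)
    ultimately show ?case
      using Y_ideal_widen[OF r] by (metis pluses_snoc)
  next
    case zero
    then show ?case by (intro exI[of _ 0]) (simp add: Y_ideal_zero)
  next
    case (add y y')
    then obtain c c' where "?U y - c *\<^sub>K id_web (pluses (Suc n)) \<in> Y_ideal (Suc n) (pluses (Suc n))"
      "?U y' - c' *\<^sub>K id_web (pluses (Suc n)) \<in> Y_ideal (Suc n) (pluses (Suc n))" by auto
    from Y_ideal_add[OF this] show ?case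
      by (intro exI[of _ "c + c'"]) (simp add: pad_add bilinear skein.scale_left_distrib
        algebra_simps)
  next
    case (scale r y)
    then obtain c where "?U y - c *\<^sub>K id_web (pluses (Suc n)) \<in> Y_ideal (Suc n) (pluses (Suc n))"
      by auto
    from Y_ideal_scale[OF this, of r] show ?case
      by (intro exI[of _ "r * c"]) (simp add: pad_scale bilinear skein.scale_right_diff_distrib)
  qed
  then show ?case using bend_unbend[OF z] by simp
qed

text \<open>Each generating step of the order lowers the total number of letters by one. Conditions
  on lower weights thus follow from conditions on shorter words.\<close>

lemma weight_less_length: "weight t \<prec> weight s \<Longrightarrow> length t < length s"
proof -
  have "x \<prec> y \<Longrightarrow> fst x + snd x < fst y + snd y" for x y
    by (induction rule: weight_less.induct) auto
  moreover have "fst (weight u) + snd (weight u) = int (length u)" for u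
  proof (induction u)
    case (Cons e u)
    then show ?case by (cases e) (auto simp: weight_def)
  qed (simp add: weight_def)
  ultimately show "weight t \<prec> weight s \<Longrightarrow> length t < length s" by fastforce
qed

section \<open>Upside down webs and uniqueness of clasps\<close>

text \<open>For \<open>i > 3\<close> the value only has to be improper and to have the right boundary.\<close>

primrec flip_drawing :: "drawing \<Rightarrow> drawing" where
  "flip_drawing (Strands s) = Strands s"
| "flip_drawing (Cup e) = Cap e"
| "flip_drawing (Cap e) = Cup e"
| "flip_drawing (Vertex e i) =
    (if i \<le> 3 then Vertex (opp e) (3 - i) else Stack (Strands (replicate i e)) (Strands []))"
| "flip_drawing (Stack w v) = Stack (flip_drawing v) (flip_drawing w)"
| "flip_drawing (Beside v w) = Beside (flip_drawing v) (flip_drawing w)"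

lemma bottom_word_flip [simp]: "bottom_word (flip_drawing d) = top_word d"
  by (induction d) auto

lemma top_word_flip [simp]: "top_word (flip_drawing d) = bottom_word d"
  by (induction d) auto

lemma proper_flip [simp]: "proper (flip_drawing d) = proper d"
  by (induction d) auto

text \<open>The reflected bending moves carry a leg up instead of down and are not among the rules;
  \<open>unbend_left\<close> and \<open>unbend_right\<close> provide them as equalities of
  webs.\<close>

lemma isotopic_flip: "isotopic d e \<Longrightarrow> web (flip_drawing d) = web (flip_drawing e)"
proof (induction rule: isotopic.induct)
  case (stack_assoc u w v)
  then show ?case using web_isotopic[OF isotopic.stack_assoc] by simp
next
  case (stack_top d)
  then show ?case using web_isotopic[OF isotopic.stack_bottom[of "flip_drawing d"]] by simp
next
  case (stack_bottom d)
  then show ?case using web_isotopic[OF isotopic.stack_top[of "flip_drawing d"]] by simp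
next
  case (zigzag_left e)
  then show ?case using web_isotopic[OF isotopic.zigzag_right[of e]] by simp
next
  case (zigzag_right e)
  then show ?case using web_isotopic[OF isotopic.zigzag_left[of e]] by simp
next
  case (interchange w v w' v')
  then show ?case by (auto intro!: web_isotopic isotopic.interchange)
next
  case (bend_left i e)
  then have "3 - i = Suc (2 - i)" "3 - Suc i = 2 - i" by auto
  then show ?case using unbend_left[of "2 - i" "opp e"] bend_left
    by (simp add: pad_def flip: compose_web tensor_web id_web_def)
next
  case (bend_right i e)
  then have "3 - i = Suc (2 - i)" "3 - Suc i = 2 - i" by auto
  then show ?case using unbend_right[of "2 - i" "opp e"] bend_right
    by (simp add: pad_def flip: compose_web tensor_web id_web_def)
next
  case (stack_cong w w' v v')
  then show ?case by (simp flip: compose_web)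
next
  case (beside_cong v v' w w')
  then show ?case by (simp flip: tensor_web)
qed (auto intro: web_isotopic isotopic.intros)

interpretation flip: drawing_map "\<lambda>d. web (flip_drawing d)" "\<lambda>x y. y \<odot> x" "(\<otimes>)"
proof
  fix e
  show "web (flip_drawing (Stack (Cap e) (Cup e))) = qint 3 *\<^sub>K web (flip_drawing (Strands []))"
    using cap_cup[of "[]" e "[]"] by (simp add: compose_web id_web_def)
  show "web (flip_drawing (bigon e)) = - qint 2 *\<^sub>K web (flip_drawing (Strands [e]))"
    using Y_L[of "[]" e "[]"] by (simp add: Defs.bigon_def compose_web id_web_def)
  have "web (square e) = web (Strands [e, opp e]) + web (Stack (Cup e) (Cap e))"
    by transfer (rule relations.square)
  moreover have "web (flip_drawing (square e)) = web (square e)"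
    by (simp add: square_def compose_assoc flip: compose_web tensor_web)
  ultimately show "web (flip_drawing (square e))
      = web (flip_drawing (Strands [e, opp e])) + web (flip_drawing (Stack (Cup e) (Cap e)))"
    by simp
qed (auto simp: bilinear compose_web tensor_web web_improper isotopic_flip)

text \<open>Reflection in a horizontal line combined with reversal of all orientations, so that
  words keep their letters while source and target are exchanged.\<close>

lift_definition flip :: "skein \<Rightarrow> skein" is "linear_extension (\<lambda>d. web (flip_drawing d))"
  using flip.linear_extension_relations by (metis linear_extension_diff eq_iff_diff_eq_0)

lemma flip_web [simp]: "flip (web d) = web (flip_drawing d)"
  by transfer simp

lemma flip_zero [simp]: "flip 0 = 0"
  by transfer simp

lemma flip_add: "flip (x + y) = flip x + flip y"
  by transfer (simp add: linear_extension_add)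

lemma flip_diff: "flip (x - y) = flip x - flip y"
  by transfer (simp add: linear_extension_diff)

lemma flip_scale: "flip (c *\<^sub>K x) = c *\<^sub>K flip x"
  by transfer (simp add: linear_extension_scale)

lemma flip_compose: "flip (x \<odot> y) = flip y \<odot> flip x"
  by transfer (simp add: flip.linear_extension_Stack)

lemma flip_id_web [simp]: "flip (id_web s) = id_web s"
  by (simp add: id_web_def)

lemma flip_Hom: "x \<in> Hom s t \<Longrightarrow> flip x \<in> Hom t s"
proof (induction rule: Hom_induct)
  case (web d)
  then show ?case by (auto simp: drawings_def intro!: Hom_web)
qed (auto simp: flip_add flip_scale intro: Hom_add Hom_scale)

lemma flip_flip: "x \<in> Hom s t \<Longrightarrow> flip (flip x) = x"
proof (induction rule: Hom_induct)
  case (web d)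
  have "proper d \<Longrightarrow> flip_drawing (flip_drawing d) = d"
    by (induction d) auto
  with web show ?case by (auto simp: drawings_def)
qed (auto simp: flip_add flip_scale)

section \<open>Characterisation and uniqueness of the clasps of weight (n, 0)\<close>

definition kills_Y :: "nat \<Rightarrow> skein \<Rightarrow> bool" where
  "kills_Y n g \<longleftrightarrow> (\<forall>i j. i + j + 2 = n \<longrightarrow> pad (pluses i) (Y_web Plus) (pluses j) \<odot> g = 0)"

definition pre_clasp :: "nat \<Rightarrow> skein \<Rightarrow> bool" where
  "pre_clasp n g \<longleftrightarrow> g - id_web (pluses n) \<in> Y_ideal n (pluses n) \<and> kills_Y n g"

lemma Y_ideal_kills: "x \<in> Y_ideal n t \<Longrightarrow> kills_Y n g \<Longrightarrow> x \<odot> g = 0"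
  by (induction rule: Y_ideal_induct) (auto simp: kills_Y_def compose_assoc bilinear)

lemma pre_clasp_Hom: "pre_clasp n g \<Longrightarrow> g \<in> Hom (pluses n) (pluses n)"
  using Hom_add[OF Y_ideal_Hom Hom_id_web, of "g - id_web (pluses n)" n]
    by (simp add: pre_clasp_def)

lemma compose_kills:
  assumes "\<And>t w. w \<in> Hom t (pluses n) \<Longrightarrow> length t < n \<Longrightarrow> P \<odot> w = 0" "x \<in> Y_ideal n (pluses n)"
  shows "P \<odot> x = 0"
  using assms(2)
proof (induction rule: Y_ideal_induct)
  case (gen w i j)
  then have "P \<odot> w = 0" by (intro assms(1)) auto
  then show ?case by (simp flip: compose_assoc)
qed (auto simp: bilinear)

text \<open>The product \<open>flip g \<odot> g\<close> is equal to both of its factors, since each factor differs from the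
  identity by webs through shorter words, which the other factor kills.\<close>

lemma pre_clasp_flip:
  assumes "pre_clasp n g"
  shows "flip g = g"
proof -
  let ?x = "g - id_web (pluses n)"
  have g: "g \<in> Hom (pluses n) (pluses n)" and x: "?x \<in> Y_ideal n (pluses n)" and k: "kills_Y n g"
    using assms pre_clasp_Hom by (auto simp: pre_clasp_def)
  have right: "w \<odot> g = 0" if "w \<in> Hom (pluses n) t" "length t < n" for t w
    using Y_ideal_kills[OF Hom_short[OF that] k] .
  have left: "flip g \<odot> w = 0" if "w \<in> Hom t (pluses n)" "length t < n" for t w
  proof -
    have "flip (flip g \<odot> w) = 0"
      using right[OF flip_Hom[OF that(1)] that(2)] flip_flip[OF g] by (simp add: flip_compose)
    moreover have "flip g \<odot> w \<in> Hom t (pluses n)"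
      using Hom_compose[OF flip_Hom[OF g] that(1)] .
    ultimately show ?thesis using flip_flip by fastforce
  qed
  have "flip g \<odot> ?x = 0"
    by (rule compose_kills[OF left x])
  moreover have "flip ?x \<odot> g = 0"
  proof -
    have "flip (flip ?x \<odot> g) = flip g \<odot> ?x"
      using flip_flip[OF Y_ideal_Hom[OF x]] by (simp add: flip_compose)
    then have "flip (flip ?x \<odot> g) = 0" using \<open>flip g \<odot> ?x = 0\<close> by simp
    moreover have "flip ?x \<odot> g \<in> Hom (pluses n) (pluses n)"
      using Hom_compose[OF flip_Hom[OF Y_ideal_Hom[OF x]] g] .
    ultimately show ?thesis using flip_flip by fastforce
  qed
  moreover have "flip g \<odot> g = flip g \<odot> ?x + flip g"
    using compose_add_right[of "flip g" ?x "id_web (pluses n)"] compose_id_web[OF flip_Hom[OF g]]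
      by simp
  moreover have "flip g \<odot> g = flip ?x \<odot> g + g"
    using compose_add_left[of "flip ?x" "id_web (pluses n)" g] id_web_compose[OF g]
    by (simp add: flip_diff)
  ultimately show ?thesis by simp
qed

text \<open>From above \<open>g\<close> is killed because webs to shorter words lie in the ideal,
  from below by its symmetry under \<open>flip\<close>. It is idempotent since it differs from the
  identity by an element that kills it.\<close>

lemma pre_clasp_is_clasp:
  assumes "pre_clasp n g" "g \<noteq> 0"
  shows "is_clasp (pluses n) g"
proof -
  have g: "g \<in> Hom (pluses n) (pluses n)" and x: "g - id_web (pluses n) \<in> Y_ideal n (pluses n)"
    and k: "kills_Y n g"
    using assms pre_clasp_Hom by (auto simp: pre_clasp_def)
  have right: "w \<odot> g = 0" if "w \<in> Hom (pluses n) t" "length t < n" for t w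
    using Y_ideal_kills[OF Hom_short[OF that] k] .
  have left: "g \<odot> w = 0" if "w \<in> Hom t (pluses n)" "length t < n" for t w
  proof -
    have "flip (g \<odot> w) = 0"
      using right[OF flip_Hom[OF that(1)] that(2)] pre_clasp_flip[OF assms(1)]
        by (simp add: flip_compose)
    then show ?thesis using flip_flip[OF Hom_compose[OF g that(1)]] by simp
  qed
  have "g \<odot> g = g"
    using compose_add_left[of "g - id_web (pluses n)" "id_web (pluses n)" g] Y_ideal_kills[OF x k]
      id_web_compose[OF g]
    by simp
  then show ?thesis
    using g assms(2) left right weight_less_length[of _ "pluses n"] unfolding is_clasp_def by auto
qed

lemma count_list_pluses [simp]: "count_list (pluses n) Plus = n" "count_list (pluses n) Minus = 0"
  by (induction n) (auto simp: pluses_Suc)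

lemma weight_Minus:
  assumes "i + j + 2 = n"
  shows "weight (pluses i @ Minus # pluses j) \<prec> weight (pluses n)"
proof -
  have "weight (pluses i @ Minus # pluses j) = (int n - 2, 0 + 1)"
    unfolding weight_def using assms by simp
  moreover have "weight (pluses n) = (int n, 0)"
    unfolding weight_def by simp
  ultimately show ?thesis
    using weight_less.intros(2)[of "int n" 0] by (simp only:)
qed

text \<open>Modulo the ideal \<open>P\<close> is a scalar \<open>c\<close>. The product
  \<open>P \<odot> g\<close> equals both \<open>P\<close> and \<open>c *\<^sub>K g\<close>, since
  each factor kills the part by which the other differs from a multiple of the identity. Idempotence
  then forces \<open>c = 1\<close>.\<close>

lemma is_clasp_unique:
  assumes "pre_clasp n g" "g \<noteq> 0" "is_clasp (pluses n) P"
  shows "P = g"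
proof -
  have g: "g \<in> Hom (pluses n) (pluses n)" and x: "g - id_web (pluses n) \<in> Y_ideal n (pluses n)"
    and k: "kills_Y n g"
    using assms pre_clasp_Hom by (auto simp: pre_clasp_def)
  have P: "P \<in> Hom (pluses n) (pluses n)" "P \<noteq> 0" "P \<odot> P = P"
    and left: "\<And>t w. weight t \<prec> weight (pluses n) \<Longrightarrow> w \<in> Hom t (pluses n) \<Longrightarrow> P \<odot> w = 0"
    using assms(3) by (auto simp: is_clasp_def)
  obtain c where c: "P - c *\<^sub>K id_web (pluses n) \<in> Y_ideal n (pluses n)"
    using Hom_pluses[OF P(1)] by auto
  have "P \<odot> y = 0" if "y \<in> Y_ideal n (pluses n)" for y
    using that
  proof (induction rule: Y_ideal_induct)
    case (gen w i j)
    have "weight (pluses i @ Minus # pluses j) \<prec> weight (pluses n)"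
      using weight_Minus gen(1) by blast
    from left[OF this gen(2)] show ?case by (simp flip: compose_assoc)
  qed (auto simp: bilinear)
  from this[OF x] have 1: "P \<odot> g = P"
    using compose_add_right[of P "g - id_web (pluses n)" "id_web (pluses n)"]
      compose_id_web[OF P(1)] by simp
  have 2: "P \<odot> g = c *\<^sub>K g"
    using compose_add_left[of "P - c *\<^sub>K id_web (pluses n)" "c *\<^sub>K id_web (pluses n)" g]
      Y_ideal_kills[OF c k]
      id_web_compose[OF g] by (simp add: compose_scale_left)
  have "(c * c) *\<^sub>K g = c *\<^sub>K g"
  proof -
    have "c *\<^sub>K g = (P \<odot> P) \<odot> g" by (simp only: P(3) 2)
    also have "\<dots> = P \<odot> P \<odot> g" by (rule compose_assoc)
    also have "\<dots> = (c * c) *\<^sub>K g" by (simp add: 2 compose_scale_right)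
    finally show ?thesis by (rule HOL.sym)
  qed
  then have "c * c = c" using assms(2) by simp
  moreover have "c \<noteq> 0" using 1 2 P(2) by auto
  ultimately show ?thesis using 1 2 by simp
qed

lemma pre_clasp_f_clasp:
  assumes "pre_clasp n g" "g \<noteq> 0"
  shows "f_clasp n = g"
  unfolding f_clasp_def clasp_def pluses_def[symmetric]
proof (rule the_equality)
  show "is_clasp (pluses n) g" by (rule pre_clasp_is_clasp[OF assms])
  show "P = g" if "is_clasp (pluses n) P" for P by (rule is_clasp_unique[OF assms that])
qed

section \<open>A state sum for webs\<close>

lemma q_half_power: "q_half ^ k = Fract ([:0, 1:] ^ k) 1"
  by (induction k) (simp_all add: q_half_def One_fract_def)

lemma q_half_neq_0 [simp]: "q_half \<noteq> 0"
  by (simp add: q_half_def Zero_fract_def eq_fract)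

text \<open>\<open>q_half\<close> is an indeterminate, hence not a root of unity; this keeps the
  denominators of the recursion nonzero.\<close>

lemma q_half_power_neq_1: "k > 0 \<Longrightarrow> q_half ^ k \<noteq> 1"
proof
  assume k: "k > 0" and "q_half ^ k = 1"
  then have "[:0, 1:] ^ k = (1 :: complex poly)"
    by (simp add: q_half_power One_fract_def eq_fract)
  then have "degree ([:0, 1:] ^ k :: complex poly) = 0" by simp
  with k show False by (simp add: degree_power_eq)
qed

lemma q_half_power_diff: "k > 0 \<Longrightarrow> q_half ^ k - inverse q_half ^ k \<noteq> 0"
proof
  assume k: "k > 0" and "q_half ^ k - inverse q_half ^ k = 0"
  then have "q_half ^ (k + k) = 1" by (simp add: power_add field_simps)
  with k q_half_power_neq_1[of "k + k"] show False by simp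
qed

lemma q_half_diff: "q_half - inverse q_half \<noteq> 0"
  using q_half_power_diff[of 1] by simp

lemma qint_neq_0: "n > 0 \<Longrightarrow> qint n \<noteq> 0"
  using q_half_power_diff q_half_diff by (simp add: qint_def)

lemma qint_0 [simp]: "qint 0 = 0"
  by (simp add: qint_def)

lemma qint_1 [simp]: "qint (Suc 0) = 1"
  using q_half_diff by (simp add: qint_def)

lemma qint_2: "qint 2 = q_half + inverse q_half"
proof -
  have "q_half ^ 2 - inverse q_half ^ 2 = (q_half + inverse q_half) * (q_half - inverse q_half)"
    by (simp add: power2_eq_square algebra_simps)
  then show ?thesis using q_half_diff by (simp add: qint_def)
qed

lemma qint_rec: "qint (Suc (Suc n)) + qint n = qint 2 * qint (Suc n)"
proof -
  let ?h = q_half and ?g = "inverse q_half"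
  have "?h * ?g = 1" by simp
  have "(?h ^ Suc (Suc n) - ?g ^ Suc (Suc n)) + (?h ^ n - ?g ^ n)
    = (?h + ?g) * (?h ^ Suc n - ?g ^ Suc n)"
  proof -
    have "(?h + ?g) * (?h ^ Suc n - ?g ^ Suc n)
      = ?h ^ Suc (Suc n) - ?g ^ Suc (Suc n) + (?h * ?g) * (?h ^ n - ?g ^ n)"
      by (simp only: power_Suc algebra_simps)
    then show ?thesis by simp
  qed
  then show ?thesis
    using q_half_diff unfolding qint_2 by (simp add: qint_def add_divide_distrib[symmetric])
qed

lemma qint_3: "qint 3 = q_half ^ 2 + 1 + inverse q_half ^ 2"
proof -
  have "qint 3 + 1 = qint 2 * qint 2"
    using qint_rec[of 1] by (simp add: numeral_3_eq_3 numeral_2_eq_2)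
  then have "qint 3 = qint 2 * qint 2 - 1" by (simp add: eq_diff_eq)
  then show ?thesis by (simp add: qint_2 power2_eq_square algebra_simps)
qed

section \<open>Colours and local weights\<close>

datatype col = Col0 | Col1 | Col2

lemma UNIV_col: "UNIV = {Col0, Col1, Col2}"
  using col.exhaust by auto

instance col :: finite
  by standard (simp add: UNIV_col)

lemma sum_col: "(\<Sum>c\<in>UNIV. f c) = f Col0 + f Col1 + f Col2"
  by (simp add: UNIV_col add.assoc)

type_synonym coloring = "(sign \<times> col) list"

definition q_sign :: "sign \<Rightarrow> K" where
  "q_sign e = (case e of Plus \<Rightarrow> q_half | Minus \<Rightarrow> inverse q_half)"

lemma q_sign_neq_0 [simp]: "q_sign e \<noteq> 0"
  by (cases e) (simp_all add: q_sign_def)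

lemma q_sign_opp [simp]: "q_sign (opp e) = inverse (q_sign e)"
  by (cases e) (simp_all add: q_sign_def)

text \<open>Cup and cap contribute one factor each, so a loop sums the squares \<open>q\<close>,
  \<open>1\<close> and \<open>1/q\<close> to \<open>[3]\<close>. Reversing the orientation inverts
  the factor, so zigzags have weight 1.\<close>

primrec arc_weight :: "sign \<Rightarrow> col \<Rightarrow> K" where
  "arc_weight e Col0 = q_sign e"
| "arc_weight e Col1 = 1"
| "arc_weight e Col2 = inverse (q_sign e)"

lemma arc_weight_opp: "arc_weight (opp e) c = inverse (arc_weight e c)"
  by (cases c) simp_all

lemma arc_weight_neq_0 [simp]: "arc_weight e c \<noteq> 0"
  by (cases c) simp_all

text \<open>Up to scaling, these values are forced by invariance of the tripod under rotation and by the
  bigon relation.\<close>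

fun tripod_weight :: "K \<Rightarrow> col list \<Rightarrow> K" where
  "tripod_weight h [Col0, Col1, Col2] = 1"
| "tripod_weight h [Col1, Col2, Col0] = h ^ 2"
| "tripod_weight h [Col2, Col0, Col1] = h ^ 2"
| "tripod_weight h [Col0, Col2, Col1] = - h"
| "tripod_weight h [Col2, Col1, Col0] = - (h ^ 3)"
| "tripod_weight h [Col1, Col0, Col2] = - h"
| "tripod_weight h _ = 0"

text \<open>This makes the two bending moves compatible: a leg bent down on the left carries
  \<open>arc_weight e x\<close>, on the right the inverse of it, hence the square.\<close>

lemma tripod_weight_rotate: "tripod_weight (q_sign e) [y, z, x]
  = (arc_weight e x)\<^sup>2 * tripod_weight (q_sign e) [x, y, z]"
  by (cases x; cases y; cases z) (simp_all add: power2_eq_square power3_eq_cube field_simps)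

definition colorings :: "word \<Rightarrow> coloring set" where
  "colorings s = {m. map fst m = s}"

lemma colorings_Nil [simp]: "colorings [] = {[]}"
  by (auto simp: colorings_def)

lemma colorings_Cons: "colorings (e # s) = (\<lambda>(c, m). (e, c) # m) ` (UNIV \<times> colorings s)"
  by (force simp: colorings_def Cons_eq_map_conv eq_commute[of _ "map fst _"] map_eq_Cons_conv
    image_iff)

lemma finite_colorings [simp]: "finite (colorings s)"
  by (induction s) (simp_all add: colorings_Cons)

lemma sum_colorings_Cons: "(\<Sum>m\<in>colorings (e # s). f m) = (\<Sum>c\<in>UNIV. \<Sum>m\<in>colorings s. f ((e, c) # m))"
  unfolding colorings_Cons
  by (subst sum.reindex) (auto simp: inj_on_def sum.cartesian_product intro!: sum.cong)

lemma sum_colorings_append: "(\<Sum>m\<in>colorings (s @ t). f m)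
  = (\<Sum>m\<in>colorings s. \<Sum>m'\<in>colorings t. f (m @ m'))"
  by (induction s arbitrary: f) (simp_all add: sum_colorings_Cons)

lemma length_colorings: "m \<in> colorings s \<Longrightarrow> length m = length s"
  by (auto simp: colorings_def)

text \<open>The matrix coefficients of a web in the tensor powers of the three-dimensional representation
  and its dual: \<open>amp d p q\<close> sums over all colourings of \<open>d\<close> that restrict to \<open>p\<close> at the
  bottom and to \<open>q\<close> at the top.\<close>

primrec amp :: "drawing \<Rightarrow> coloring \<Rightarrow> coloring \<Rightarrow> K" where
  "amp (Strands s) p q = (if p = q \<and> map fst p = s then 1 else 0)"
| "amp (Cup e) p q = (if p = [] \<and> map fst q = [e, opp e] \<and> snd (q ! 0) = snd (q ! 1)
     then arc_weight e (snd (q ! 0)) else 0)"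
| "amp (Cap e) p q = (if q = [] \<and> map fst p = [e, opp e] \<and> snd (p ! 0) = snd (p ! 1)
     then arc_weight e (snd (p ! 0)) else 0)"
| "amp (Vertex e i) p q =
    (if i \<le> 3 \<and> map fst p = replicate i e \<and> map fst q = replicate (3 - i) (opp e)
     then (\<Prod>x\<leftarrow>p. arc_weight e (snd x)) * tripod_weight (q_sign e) (rev (map snd p) @ map snd q)
       else 0)"
| "amp (Stack w v) p q = (\<Sum>m\<in>colorings (top_word v). amp v p m * amp w m q)"
| "amp (Beside v w) p q =
    amp v (take (length (bottom_word v)) p) (take (length (top_word v)) q)
    * amp w (drop (length (bottom_word v)) p) (drop (length (top_word v)) q)"

lemma amp_support:
  "amp d p q \<noteq> 0 \<Longrightarrow> map fst p = bottom_word d \<and> map fst q = top_word d"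
proof (induction d arbitrary: p q)
  case (Stack w v)
  then obtain m where "amp v p m * amp w m q \<noteq> 0"
    by (auto elim: sum.not_neutral_contains_not_neutral)
  then have "amp v p m \<noteq> 0" "amp w m q \<noteq> 0" by auto
  with Stack show ?case by auto
next
  case (Beside v w)
  then have "amp v (take (length (bottom_word v)) p) (take (length (top_word v)) q) \<noteq> 0"
    "amp w (drop (length (bottom_word v)) p) (drop (length (top_word v)) q) \<noteq> 0" by auto
  with Beside.IH have "map fst (take (length (bottom_word v)) p) = bottom_word v"
    "map fst (drop (length (bottom_word v)) p) = bottom_word w"
    "map fst (take (length (top_word v)) q) = top_word v"
    "map fst (drop (length (top_word v)) q) = top_word w" by blast+
  then show ?case by (metis append_take_drop_id bottom_word.simps(6) map_append top_word.simps(6))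
qed (auto split: if_splits)

lemma amp_eq_0: "map fst p \<noteq> bottom_word d \<or> map fst q \<noteq> top_word d \<Longrightarrow> amp d p q = 0"
  using amp_support by blast

lemma amp_improper: "\<not> proper d \<Longrightarrow> amp d p q = 0"
proof (induction d arbitrary: p q)
  case (Stack w v)
  have "amp v p m * amp w m q = 0" if "m \<in> colorings (top_word v)" for m
    using Stack that amp_eq_0[of m w q] by (auto simp: colorings_def)
  then show ?case unfolding amp.simps by (intro sum.neutral) blast
qed auto

text \<open>The index set now depends on the upper drawing only, so the sum can be taken outside
  when the lower factor runs through the terms of a relation.\<close>

lemma amp_Stack_bottom: "amp (Stack w v) p q
  = (\<Sum>m\<in>colorings (bottom_word w). amp v p m * amp w m q)"
proof (cases "bottom_word w = top_word v")
  case False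
  have "amp v p m * amp w m q = 0" for m
    using amp_support[of v p m] amp_support[of w m q] False by (metis mult_eq_0_iff)
  then show ?thesis unfolding amp.simps by (simp only: sum.neutral_const)
qed simp

text \<open>The cutting points are computed from the right factor, for use when the left factor runs
  through the terms of a relation.\<close>

lemma amp_Beside_drop: "amp (Beside v w) p q
  = amp v (take (length p - length (bottom_word w)) p) (take (length q - length (top_word w)) q)
    * amp w (drop (length p - length (bottom_word w)) p) (drop (length q - length (top_word w)) q)"
proof (cases "map fst p = bottom_word (Beside v w) \<and> map fst q = top_word (Beside v w)")
  case True
  then have "length p = length (bottom_word v) + length (bottom_word w)"
    "length q = length (top_word v) + length (top_word w)"
    by (metis length_map length_append bottom_word.simps(6) top_word.simps(6))+
  then show ?thesis by simp
next
  case False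
  let ?p = "length p - length (bottom_word w)" and ?q = "length q - length (top_word w)"
  have "amp v (take ?p p) (take ?q q) * amp w (drop ?p p) (drop ?q q) = 0"
  proof (rule ccontr)
    assume "\<not> ?thesis"
    then have "amp v (take ?p p) (take ?q q) \<noteq> 0" "amp w (drop ?p p) (drop ?q q) \<noteq> 0" by auto
    from this[THEN amp_support] False show False
      by (metis append_take_drop_id bottom_word.simps(6) map_append top_word.simps(6))
  qed
  then show ?thesis using amp_eq_0[of p "Beside v w" q] False by metis
qed

lemma amp_bend_left:
  assumes "top_word d = opp e # s" "map fst q = s"
  shows "amp (Stack (Beside (Cap e) (Strands s)) (Beside (Strands [e]) d)) ((e, x) # p) q
    = arc_weight e x * amp d p ((opp e, x) # q)"
proof -
  have "amp (Stack (Beside (Cap e) (Strands s)) (Beside (Strands [e]) d)) ((e, x) # p) q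
    = (\<Sum>c\<in>UNIV. \<Sum>c'\<in>UNIV. \<Sum>m\<in>colorings s. if c = x \<and> c = c' \<and> m
      = q then arc_weight e x * amp d p ((opp e, x) # q) else 0)"
  proof -
    have top: "top_word (Beside (Strands [e]) d) = e # opp e # s" using assms by simp
    then show ?thesis
      unfolding amp.simps(5) top sum_colorings_Cons
      by (intro sum.cong HOL.refl) (auto simp: colorings_def)
  qed
  also have "\<dots> = (\<Sum>c\<in>UNIV. \<Sum>c'\<in>UNIV. if c = x \<and> c
    = c' then arc_weight e x * amp d p ((opp e, x) # q) else 0)"
  proof (intro sum.cong HOL.refl)
    fix c c' :: col
    have "q \<in> colorings s" using assms(2) by (simp add: colorings_def)
    then show "(\<Sum>m\<in>colorings s. if c = x \<and> c = c' \<and> m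
      = q then arc_weight e x * amp d p ((opp e, x) # q) else 0)
      = (if c = x \<and> c = c' then arc_weight e x * amp d p ((opp e, x) # q) else 0)"
      by (cases "c = x"; cases "c = c'") (simp_all add: sum.delta)
  qed
  also have "\<dots> = arc_weight e x * amp d p ((opp e, x) # q)"
    by (cases x) (simp_all add: sum_col)
  finally show ?thesis .
qed

lemma amp_bend_right:
  assumes "top_word d = s @ [opp e]" "map fst q = s" "length p = length (bottom_word d)"
  shows "amp (Stack (Beside (Strands s) (Cap (opp e))) (Beside d (Strands [e]))) (p @ [(e, x)]) q
    = arc_weight (opp e) x * amp d p (q @ [(opp e, x)])"
proof -
  have q: "length q = length s" using assms(2) by auto
  have "amp (Stack (Beside (Strands s) (Cap (opp e))) (Beside d (Strands [e]))) (p @ [(e, x)]) q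
    = (\<Sum>m\<in>colorings s. \<Sum>c\<in>UNIV. \<Sum>c'\<in>UNIV. if m = q \<and> c' = x \<and> c
      = c' then arc_weight (opp e) x * amp d p (q @ [(opp e, x)]) else 0)"
  proof -
    have top: "top_word (Beside d (Strands [e])) = s @ [opp e, e]" using assms by simp
    then show ?thesis
      unfolding amp.simps(5) top sum_colorings_append sum_colorings_Cons colorings_Nil
      using assms q length_colorings[of _ s] by (intro sum.cong HOL.refl) auto
  qed
  also have "\<dots> = (\<Sum>m\<in>colorings s. if m
    = q then arc_weight (opp e) x * amp d p (q @ [(opp e, x)]) else 0)"
    by (intro sum.cong HOL.refl) (cases x; auto simp: sum_col)
  also have "\<dots> = arc_weight (opp e) x * amp d p (q @ [(opp e, x)])"
  proof -
    have "q \<in> colorings s" using assms(2) by (simp add: colorings_def)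
    then show ?thesis by (simp add: sum.delta)
  qed
  finally show ?thesis .
qed

lemma isotopic_proper: "isotopic d e \<Longrightarrow> proper d \<Longrightarrow> proper e \<and> bottom_word e
  = bottom_word d \<and> top_word e = top_word d"
  using isotopic_same_boundary[of d e "bottom_word d" "top_word d"] by (auto simp: drawings_def)

lemma amp_interchange:
  assumes "bottom_word w = top_word v" "bottom_word w' = top_word v'"
  shows "amp (Stack (Beside w w') (Beside v v')) p q = amp (Beside (Stack w v) (Stack w' v')) p q"
proof -
  let ?p = "take (length (bottom_word v)) p" and ?p' = "drop (length (bottom_word v)) p"
  let ?q = "take (length (top_word w)) q" and ?q' = "drop (length (top_word w)) q"
  have "amp (Stack (Beside w w') (Beside v v')) p q
    = (\<Sum>m\<in>colorings (top_word v). \<Sum>m'\<in>colorings (top_word v'). (amp v ?p m * amp w m ?q) *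
      (amp v' ?p' m' * amp w' m' ?q'))"
    unfolding amp.simps(5) top_word.simps(6) sum_colorings_append
    using assms by (intro sum.cong HOL.refl) (simp add: length_colorings)
  then show ?thesis by (simp add: sum_product)
qed

lemma replicate_opp: "i < 3 \<Longrightarrow> replicate (3 - i) (opp e) = replicate (2 - i) (opp e) @ [opp e]"
proof -
  assume "i < 3"
  then have "3 - i = Suc (2 - i)" by simp
  then show ?thesis by (simp add: replicate_append_same)
qed

text \<open>The legs are listed clockwise, the lower ones from right to left and then the upper ones
  from left to right. Bending the leftmost upper leg down keeps this list and only adds an arc
  weight.\<close>

lemma amp_Vertex_left:
  assumes "i < 3" "map fst p = replicate i e" "map fst q = replicate (2 - i) (opp e)"
  shows "amp (Vertex e (Suc i)) ((e, x) # p) q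
    = arc_weight e x * amp (Vertex e i) p ((opp e, x) # q)"
  using assms replicate_opp[OF assms(1), of e] by (simp add: replicate_append_same)

text \<open>Here the leg moves from the end of the clockwise list to its beginning, which is where
  \<open>tripod_weight_rotate\<close> enters.\<close>

lemma amp_Vertex_right:
  assumes "i < 3" "map fst p = replicate i e" "map fst q = replicate (2 - i) (opp e)"
  shows "amp (Vertex e (Suc i)) (p @ [(e, x)]) q
    = arc_weight (opp e) x * amp (Vertex e i) p (q @ [(opp e, x)])"
proof -
  have "length p = i" "length q = 2 - i"
    using assms(2,3) by (metis length_map length_replicate)+
  then have "length (rev (map snd p) @ map snd q) = 2" using assms(1) by simp
  then obtain y z where yz: "rev (map snd p) @ map snd q = [y, z]"
    unfolding numeral_2_eq_2 length_Suc_conv length_0_conv by blast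
  have "map fst (p @ [(e, x)]) = replicate (Suc i) e"
    "map fst (q @ [(opp e, x)]) = replicate (3 - i) (opp e)"
    using assms replicate_opp[OF assms(1), of e] by (simp_all add: replicate_append_same)
  moreover have "rev (map snd p) @ map snd (q @ [(opp e, x)]) = [y, z, x]"
    "rev (map snd (p @ [(e, x)])) @ map snd q = [x, y, z]"
    using yz by simp_all
  moreover have "3 - Suc i = 2 - i" "Suc i \<le> 3" "i \<le> 3" using assms(1) by auto
  ultimately show ?thesis
    using assms(2,3) unfolding amp.simps(4)
    by (simp only: simp_thms if_True map_append prod_list.append tripod_weight_rotate[of e y z x])
      (simp add: arc_weight_opp power2_eq_square)
qed

lemma amp_isotopic: "isotopic d e \<Longrightarrow> amp d p q = amp e p q"
proof (induction arbitrary: p q rule: isotopic.induct)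
  case (stack_cong w w' v v')
  \<comment> \<open>The intermediate colourings run over \<open>top_word v\<close>, whose invariance
    \<open>isotopic_proper\<close> gives for proper drawings; in the improper case both sides
    vanish.\<close>
  show ?case
  proof (cases "proper v")
    case True
    then show ?thesis using stack_cong isotopic_proper[of v v'] by simp
  next
    case False
    then have "\<not> proper v'" using isotopic_proper[OF isotopic.sym[OF stack_cong(2)]] by blast
    then show ?thesis using False amp_improper[of "Stack w v"] amp_improper[of "Stack w' v'"]
      by simp
  qed
next
  case (beside_cong v v' w w')
  show ?case
  proof (cases "proper v")
    case True
    then show ?thesis using beside_cong isotopic_proper[of v v'] by simp
  next
    case False
    then have "\<not> proper v'" using isotopic_proper[OF isotopic.sym[OF beside_cong(1)]] by blast
    then show ?thesis using False by (simp add: amp_improper)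
  qed
next
  case (stack_assoc u w v)
  have "(\<Sum>m\<in>colorings (top_word v). amp v p m *
    (\<Sum>m'\<in>colorings (top_word w). amp w m m' * amp u m' q))
    = (\<Sum>m'\<in>colorings (top_word w). \<Sum>m\<in>colorings (top_word v). amp v p m *
      (amp w m m' * amp u m' q))"
    unfolding sum_distrib_left by (rule sum.swap)
  then show ?case by (simp add: sum_distrib_right mult.assoc)
next
  case (stack_top d)
  have "amp (Stack (Strands (top_word d)) d) p q
    = (\<Sum>m\<in>colorings (top_word d). if m = q then amp d p q else 0)"
    by (auto simp: colorings_def intro!: sum.cong)
  also have "\<dots> = amp d p q"
  proof -
    have "q \<notin> colorings (top_word d) \<Longrightarrow> amp d p q = 0" by (intro amp_eq_0) (simp add: colorings_def)
    then show ?thesis by (auto simp: sum.delta)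
  qed
  finally show ?case .
next
  case (stack_bottom d)
  have "amp (Stack d (Strands (bottom_word d))) p q
    = (\<Sum>m\<in>colorings (bottom_word d). if m = p then amp d p q else 0)"
    by (auto simp: colorings_def intro!: sum.cong)
  also have "\<dots> = amp d p q"
  proof -
    have "p \<notin> colorings (bottom_word d) \<Longrightarrow> amp d p q = 0"
      by (intro amp_eq_0) (simp add: colorings_def)
    then show ?thesis by (auto simp: sum.delta)
  qed
  finally show ?case .
next
  case (beside_assoc u v w)
  then show ?case by (simp add: take_drop add.commute)
next
  case (beside_empty_left d)
  then show ?case by simp
next
  case (beside_empty_right d)
  show ?case
  proof (cases "map fst p = bottom_word d \<and> map fst q = top_word d")
    case True
    then have "length p = length (bottom_word d)" "length q = length (top_word d)"
      by (metis length_map)+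
    then show ?thesis by simp
  qed (auto simp: amp_eq_0 simp del: amp.simps)
next
  case (beside_strands s t)
  have "p = q \<longleftrightarrow> take (length s) p = take (length s) q \<and> drop (length s) p = drop (length s) q"
    by (metis append_take_drop_id)
  moreover have "map fst p = s @ t \<longleftrightarrow> map fst (take (length s) p) = s \<and> map fst (drop (length s) p)
    = t"
    by (metis append_eq_conv_conj drop_map take_map)
  ultimately show ?case by auto
next
  case (interchange w v w' v')
  then show ?case by (intro amp_interchange)
next
  case (zigzag_left e)
  show ?case
  proof (cases "map fst p = [e] \<and> map fst q = [e]")
    case True
    then obtain a b where "p = [(e, a)]" "q = [(e, b)]" by auto
    then show ?thesis using amp_bend_left[of "Cup (opp e)" e "[e]" q a "[]"]
      by (simp add: arc_weight_opp del: amp.simps(5,6))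
  qed (auto simp: amp_eq_0 simp del: amp.simps)
next
  case (zigzag_right e)
  show ?case
  proof (cases "map fst p = [e] \<and> map fst q = [e]")
    case True
    then obtain a b where "p = [(e, a)]" "q = [(e, b)]" by auto
    then show ?thesis using amp_bend_right[of "Cup e" "[e]" e q "[]" a]
      by (auto simp: arc_weight_opp simp del: amp.simps(5,6))
  qed (auto simp: amp_eq_0 simp del: amp.simps)
next
  case (bend_left i e)
  show ?case
  proof (cases "map fst p = e # replicate i e \<and> map fst q = replicate (2 - i) (opp e)")
    case True
    then obtain x p' where p: "p = (e, x) # p'" "map fst p' = replicate i e" by auto
    have "top_word (Vertex e i) = opp e # replicate (2 - i) (opp e)"
      using replicate_opp[OF bend_left] by (simp add: replicate_append_same)
    then show ?thesis
      using amp_bend_left[of "Vertex e i" e "replicate (2 - i) (opp e)" q x p']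
        amp_Vertex_left[OF bend_left p(2)] True unfolding p(1) by metis
  next
    case False
    have "bottom_word (Vertex e (Suc i)) = e # replicate i e"
      "top_word (Vertex e (Suc i)) = replicate (2 - i) (opp e)"
      using bend_left by simp_all
    with False have "amp (Vertex e (Suc i)) p q = 0"
      by (intro amp_eq_0) metis
    moreover have "amp (Stack (Beside (Cap e) (Strands (replicate (2 - i) (opp e))))
        (Beside (Strands [e]) (Vertex e i))) p q = 0"
      using False by (intro amp_eq_0) auto
    ultimately show ?thesis by simp
  qed
next
  case (bend_right i e)
  show ?case
  proof (cases "map fst p = replicate i e @ [e] \<and> map fst q = replicate (2 - i) (opp e)")
    case True
    then obtain x p' where p: "p = p' @ [(e, x)]" "map fst p' = replicate i e"
      by (auto simp: map_eq_append_conv)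
    have "top_word (Vertex e i) = replicate (2 - i) (opp e) @ [opp e]"
      using replicate_opp[OF bend_right] by simp
    moreover have "length p' = length (bottom_word (Vertex e i))"
      using p(2) by (metis bottom_word.simps(4) length_map)
    ultimately show ?thesis
      using amp_bend_right[of "Vertex e i" "replicate (2 - i) (opp e)" e q p' x]
        amp_Vertex_right[OF bend_right p(2)] True unfolding p(1) by metis
  next
    case False
    have "bottom_word (Vertex e (Suc i)) = replicate i e @ [e]"
      "top_word (Vertex e (Suc i)) = replicate (2 - i) (opp e)"
      using bend_right by (simp_all add: replicate_append_same)
    with False have "amp (Vertex e (Suc i)) p q = 0"
      by (intro amp_eq_0) metis
    moreover have "amp (Stack (Beside (Strands (replicate (2 - i) (opp e))) (Cap (opp e)))
        (Beside (Vertex e i) (Strands [e]))) p q = 0"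
      using False by (intro amp_eq_0) auto
    ultimately show ?thesis by simp
  qed
qed simp_all

lemma amp_cap_cup: "amp (Stack (Cap e) (Cup e)) p q = qint 3 * amp (Strands []) p q"
proof (cases "p = [] \<and> q = []")
  case True
  then show ?thesis
    by (cases e) (simp_all add: sum_colorings_Cons sum_col q_sign_def qint_3 power2_eq_square)
qed (auto simp: amp_eq_0 simp del: amp.simps)

lemma amp_bigon: "amp (bigon e) p q = - qint 2 * amp (Strands [e]) p q"
proof (cases "map fst p = [e] \<and> map fst q = [e]")
  case True
  then obtain a b where pq: "p = [(e, a)]" "q = [(e, b)]" by auto
  have q2: "qint 2 = q_sign e + inverse (q_sign e)"
    by (cases e) (simp_all add: q_sign_def qint_2)
  show ?thesis
    unfolding pq Defs.bigon_def q2
    by (cases a; cases b)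
      (simp_all add: sum_colorings_Cons sum_col numeral_2_eq_2 numeral_3_eq_3 field_simps)
qed (auto simp: amp_eq_0 Defs.bigon_def simp del: amp.simps)

text \<open>The square is cut across its two vertical sides. Each half has four boundary colours and
  one summed colour, which keeps the case distinctions small.\<close>

definition lower_half :: "sign \<Rightarrow> drawing" where
  "lower_half e = Stack (Beside (Strands [opp e]) (Beside (Cap (opp e)) (Strands [e])))
           (Beside (Vertex e 1) (Vertex (opp e) 1))"

definition upper_half :: "sign \<Rightarrow> drawing" where
  "upper_half e = Stack (Beside (Vertex (opp e) 2) (Vertex e 2))
    (Beside (Strands [opp e]) (Beside (Cup (opp e)) (Strands [e])))"

lemma amp_lower_half:
  "amp (lower_half e) [(e, a), (opp e, b)] [(opp e, c), (e, d)]
    = arc_weight e a * arc_weight (opp e) b *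
      (\<Sum>x\<in>UNIV. arc_weight (opp e) x * tripod_weight (q_sign e) [a, c, x] * tripod_weight
        (q_sign (opp e)) [b, x, d])"
  unfolding lower_half_def
  by (cases c; cases d) (simp_all add: sum_colorings_Cons sum_col numeral_2_eq_2 numeral_3_eq_3
    algebra_simps)

lemma amp_upper_half:
  "amp (upper_half e) [(opp e, c), (e, d)] [(e, a), (opp e, b)]
    = arc_weight (opp e) c * arc_weight e d *
      (\<Sum>x\<in>UNIV. arc_weight (opp e) x * tripod_weight (q_sign (opp e)) [x, c, a] * tripod_weight
        (q_sign e) [d, x, b])"
  unfolding upper_half_def
  by (cases c; cases d) (simp_all add: sum_colorings_Cons sum_col numeral_2_eq_2 numeral_3_eq_3
    field_simps arc_weight_opp)

text \<open>The square relation in terms of states, a finite check over the colours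
  \<open>a\<close>, \<open>b\<close>, \<open>a'\<close>, \<open>b'\<close> of the outer legs;
  \<open>c\<close> and \<open>d\<close> colour the vertical sides.\<close>

lemma square_identity:
  "(\<Sum>c\<in>UNIV. \<Sum>d\<in>UNIV.
      (arc_weight e a * arc_weight (opp e) b *
        (\<Sum>x\<in>UNIV. arc_weight (opp e) x * tripod_weight (q_sign e) [a, c, x] * tripod_weight
        (q_sign (opp e)) [b, x, d]))
    * (arc_weight (opp e) c * arc_weight e d *
      (\<Sum>x\<in>UNIV. arc_weight (opp e) x * tripod_weight (q_sign (opp e)) [x, c, a'] * tripod_weight
        (q_sign e) [d, x, b'])))
    = (if a = a' \<and> b = b' then 1 else 0)
      + (if a = b \<and> a' = b' then arc_weight e a * arc_weight e a' else 0)"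
  by (cases a; cases b; cases a'; cases b')
    (simp_all add: sum_col field_simps power2_eq_square power3_eq_cube)

lemma amp_square: "amp (square e) p q
  = amp (Strands [e, opp e]) p q + amp (Stack (Cup e) (Cap e)) p q"
proof (cases "map fst p = [e, opp e] \<and> map fst q = [e, opp e]")
  case True
  then obtain a b a' b' where pq: "p = [(e, a), (opp e, b)]" "q = [(e, a'), (opp e, b')]"
    by (auto simp: map_eq_Cons_conv)
  have "amp (square e) p q = amp (Stack (upper_half e) (lower_half e)) p q"
    unfolding square_def upper_half_def lower_half_def
    by (rule amp_isotopic[OF isotopic.sym[OF isotopic.stack_assoc]])
  also have "\<dots> = (\<Sum>c\<in>UNIV. \<Sum>d\<in>UNIV. amp (lower_half e) p [(opp e, c), (e, d)]
      * amp (upper_half e) [(opp e, c), (e, d)] q)"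
  proof -
    have "top_word (lower_half e) = [opp e, e]" by (simp add: lower_half_def)
    then show ?thesis unfolding amp.simps(5) by (simp only: sum_colorings_Cons colorings_Nil) simp
  qed
  also have "\<dots> = amp (Strands [e, opp e]) p q + amp (Stack (Cup e) (Cap e)) p q"
    unfolding pq amp_lower_half amp_upper_half square_identity by simp
  finally show ?thesis .
next
  case False
  have "bottom_word (square e) = [e, opp e]" "top_word (square e) = [e, opp e]"
    by (simp_all add: square_def numeral_2_eq_2 numeral_3_eq_3)
  with False show ?thesis by (auto simp: amp_eq_0 simp del: amp.simps)
qed

section \<open>Linear functionals on skeins from the state sum\<close>

definition linear_eval :: "(drawing \<Rightarrow> K) \<Rightarrow> comb \<Rightarrow> K" where
  "linear_eval F x = (\<Sum>d\<in>Poly_Mapping.keys x. Poly_Mapping.lookup x d * F d)"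

lemma linear_eval_supset:
  "finite A \<Longrightarrow> Poly_Mapping.keys x \<subseteq> A \<Longrightarrow> linear_eval F x = (\<Sum>d\<in>A. Poly_Mapping.lookup x d * F d)"
  unfolding linear_eval_def by (rule sum.mono_neutral_left) (auto simp: in_keys_iff)

lemma linear_eval_zero [simp]: "linear_eval F 0 = 0"
  by (simp add: linear_eval_def)

lemma linear_eval_add: "linear_eval F (x + y) = linear_eval F x + linear_eval F y"
  by (subst (1 2 3) linear_eval_supset[of "Poly_Mapping.keys x \<union> Poly_Mapping.keys y"])
    (auto simp: in_keys_iff lookup_add distrib_right sum.distrib)

lemma linear_eval_diff: "linear_eval F (x - y) = linear_eval F x - linear_eval F y"
  using linear_eval_add[of F "x - y" y] by simp

lemma linear_eval_scale: "linear_eval F (scale c x) = c * linear_eval F x"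
  by (subst (1 2) linear_eval_supset[of "Poly_Mapping.keys x"])
    (auto simp: in_keys_iff lookup_scale sum_distrib_left mult.assoc)

lemma linear_eval_single [simp]: "linear_eval F (Poly_Mapping.single d c) = c * F d"
  by (subst linear_eval_supset[of "{d}"]) auto

lemma linear_eval_sum: "linear_eval F (sum g A) = (\<Sum>a\<in>A. linear_eval F (g a))"
  by (induction A rule: infinite_finite_induct) (auto simp: linear_eval_add)

lemma linear_eval_bilin_left:
  "linear_eval F (bilin f x y) = (\<Sum>e\<in>Poly_Mapping.keys y. Poly_Mapping.lookup y e * linear_eval
    (\<lambda>d. F (f d e)) x)"
  unfolding bilin_def linear_eval_sum linear_eval_single unfolding linear_eval_def sum_distrib_left
  by (subst sum.swap) (simp add: ac_simps)

lemma linear_eval_bilin_right: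
  "linear_eval F (bilin f x y) = (\<Sum>d\<in>Poly_Mapping.keys x. Poly_Mapping.lookup x d * linear_eval
    (\<lambda>e. F (f d e)) y)"
  unfolding bilin_def linear_eval_sum linear_eval_single
    unfolding linear_eval_def sum_distrib_left by (simp add: ac_simps)

lemma linear_eval_lincomb: "linear_eval (\<lambda>d. \<Sum>m\<in>A. c m * F m d) x
  = (\<Sum>m\<in>A. c m * linear_eval (F m) x)"
  unfolding linear_eval_def sum_distrib_left by (subst sum.swap) (simp add: ac_simps)

text \<open>The boundary colourings stay arbitrary in the induction, because inside a larger web a
  relation is evaluated at the intermediate colourings.\<close>

lemma linear_eval_relations: "x \<in> relations \<Longrightarrow> linear_eval (\<lambda>d. amp d p q) x = 0"
proof (induction arbitrary: p q rule: relations.induct)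
  case (improper d)
  then show ?case by (simp add: amp_improper)
next
  case (isotopy d e)
  then show ?case by (simp add: linear_eval_diff amp_isotopic)
next
  case (loop e)
  then show ?case using amp_cap_cup[of e p q]
    by (simp add: linear_eval_diff linear_eval_scale del: amp.simps)
next
  case (bigon e)
  then show ?case using amp_bigon[of e p q]
    by (simp add: linear_eval_diff linear_eval_scale del: amp.simps)
next
  case (square e)
  then show ?case using amp_square[of e p q]
    by (simp add: linear_eval_diff linear_eval_add del: amp.simps)
next
  case (stack_left x y)
  have "linear_eval (\<lambda>d. amp (Stack d e) p q) x = 0" for e
    using linear_eval_lincomb[where A = "colorings (top_word e)" and c = "amp e p"
      and F = "\<lambda>m d. amp d m q" and x = x] stack_left by simp
  then show ?case by (simp add: linear_eval_bilin_left del: amp.simps)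
next
  case (stack_right y x)
  have "linear_eval (\<lambda>e. amp (Stack d e) p q) y = 0" for d
    unfolding amp_Stack_bottom
    using linear_eval_lincomb[where A = "colorings (bottom_word d)" and c = "\<lambda>m. amp d m q"
      and F = "\<lambda>m e. amp e p m" and x = y] stack_right
    by (simp add: mult.commute)
  then show ?case by (simp add: linear_eval_bilin_right del: amp.simps)
next
  case (beside_left x y)
  have "linear_eval (\<lambda>d. amp (Beside d e) p q) x = 0" for e
    unfolding amp_Beside_drop
    using linear_eval_lincomb[where A = "{()}"
      and c = "\<lambda>_. amp e (drop (length p - length (bottom_word e)) p)
        (drop (length q - length (top_word e)) q)"
        and F = "\<lambda>_ d. amp d (take (length p - length (bottom_word e)) p)
        (take (length q - length (top_word e)) q)" and x = x]
      beside_left by (simp add: mult.commute)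
  then show ?case by (simp add: linear_eval_bilin_left del: amp.simps)
next
  case (beside_right y x)
  have "linear_eval (\<lambda>e. amp (Beside d e) p q) y = 0" for d
    using linear_eval_lincomb[where A = "{()}"
      and c = "\<lambda>_. amp d (take (length (bottom_word d)) p) (take (length (top_word d)) q)"
        and F = "\<lambda>_ e. amp e (drop (length (bottom_word d)) p) (drop (length (top_word d)) q)"
        and x = y]
      beside_right by simp
  then show ?case by (simp add: linear_eval_bilin_right del: amp.simps)
qed (simp_all add: linear_eval_add linear_eval_scale)

lift_definition coefficient :: "coloring \<Rightarrow> coloring \<Rightarrow> skein \<Rightarrow> K" is
  "\<lambda>p q. linear_eval (\<lambda>d. amp d p q)"
  using linear_eval_relations by (metis linear_eval_diff eq_iff_diff_eq_0)

lemma coefficient_web: "coefficient p q (web d) = amp d p q"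
  by transfer simp

lemma coefficient_zero [simp]: "coefficient p q 0 = 0"
  by transfer simp

lemma coefficient_add: "coefficient p q (x + y) = coefficient p q x + coefficient p q y"
  by transfer (simp add: linear_eval_add)

lemma coefficient_diff: "coefficient p q (x - y) = coefficient p q x - coefficient p q y"
  by transfer (simp add: linear_eval_diff)

lemma coefficient_scale: "coefficient p q (c *\<^sub>K x) = c * coefficient p q x"
  by transfer (simp add: linear_eval_scale)

text \<open>The highest weight vector is killed by \<open>Y_web\<close>, since a tripod with two legs of the same
  colour has weight 0.\<close>

lemma coefficient_Y_ideal: "x \<in> Y_ideal n t \<Longrightarrow> coefficient (replicate n (Plus, Col0)) q x = 0"
proof (induction rule: Y_ideal_induct)
  case (gen w i j)
  let ?Y = "Beside (Strands (pluses i)) (Beside (Vertex Plus 2) (Strands (pluses j)))"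
  have tripod_weight: "tripod_weight h (Col0 # Col0 # l) = 0" for h l
    by (cases "(h, Col0 # Col0 # l)" rule: tripod_weight.cases) auto
  have "n - i = Suc (Suc j)" using gen(1) by simp
  then have top: "take 2 (drop i (replicate n (Plus, Col0))) = [(Plus, Col0), (Plus, Col0)]"
    by (simp add: numeral_2_eq_2)
  have "amp (Vertex Plus 2) [(Plus, Col0), (Plus, Col0)] m = 0" for m
    by (simp add: tripod_weight)
  then have "amp ?Y (replicate n (Plus, Col0)) m = 0" for m
    unfolding amp.simps(6) by (simp add: top del: amp.simps(4) take_replicate drop_replicate)
  then have "coefficient (replicate n (Plus, Col0)) q (web d \<odot> web ?Y) = 0" for d
    by (simp add: compose_web coefficient_web del: amp.simps(6))
  then have "coefficient (replicate n (Plus, Col0)) q (z \<odot> web ?Y) = 0" for z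
    by (induction z rule: skein_induct) (simp_all add: bilinear coefficient_add coefficient_scale)
  moreover have "pad (pluses i) (Y_web Plus) (pluses j) = web ?Y"
    by (simp add: pad_def id_web_def tensor_web)
  ultimately show ?case by simp
qed (simp_all add: coefficient_add coefficient_scale)

lemma pre_clasp_neq_0: "pre_clasp n g \<Longrightarrow> g \<noteq> 0"
proof
  let ?p = "replicate n (Plus, Col0)"
  assume "pre_clasp n g" and "g = 0"
  then have "coefficient ?p ?p (g - id_web (pluses n)) = 0"
    using coefficient_Y_ideal[of "g - id_web (pluses n)" n "pluses n" ?p]
      by (simp add: pre_clasp_def)
  then show False
    unfolding coefficient_diff id_web_def coefficient_web using \<open>g = 0\<close> by (simp add: pluses_def)
qed

section \<open>The recursion\<close>

lemma H_web_eq: "H_web = L_web Minus \<odot> Y_web Plus"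
  by (simp add: H_web_def compose_web)

lemma Hom_H_web: "H_web \<in> Hom [Plus, Plus] [Plus, Plus]"
  unfolding H_web_eq using Hom_compose[OF Hom_L_web[of Minus] , of "Y_web Plus"]
    Hom_Y_web[of Plus] by simp

lemma pad_H_web: "pad a H_web b = pad a (L_web Minus) b \<odot> pad a (Y_web Plus) b"
  unfolding H_web_eq using pad_compose'[OF Hom_Y_web[of Plus] Hom_L_web[of Minus]] by simp

lemma H_at_eq: "H_at n k = pad (pluses (n - k - 1)) H_web (pluses (k - 1))"
  by (simp add: H_at_def pad_def pluses_def)

lemma Y_H: "pad a (Y_web Plus) b \<odot> pad a H_web b = - qint 2 *\<^sub>K pad a (Y_web Plus) b"
proof -
  have "pad a (Y_web Plus) b \<odot> pad a (L_web Minus) b = - qint 2 *\<^sub>K id_web (a @ Minus # b)"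
    using Y_L[of a Minus b] by simp
  from this[THEN compose_eq_cont] show ?thesis
    using id_web_compose[OF Hom_pad[OF Hom_Y_web[of Plus], of a b]]
      by (simp add: pad_H_web bilinear)
qed

text \<open>Above the lowest merging, the other vertices regroup into two opposite crossings, and
  \<open>X_X\<close> applies. The second summand contains a merging one place further left, which
  later makes it vanish.\<close>

lemma Y_H_H: "pad (a @ [Plus]) (Y_web Plus) b \<odot> pad a H_web (Plus # b) \<odot> pad (a @ [Plus]) H_web b
  = pad (a @ [Plus]) (Y_web Plus) b
    + pad a (cup_web Plus) b \<odot> pad a (cap_web Minus) b \<odot> pad a (Y_web Plus) (Plus # b)"
proof -
  have 1: "pad a (Y_web Plus) (Plus # b) \<odot> pad (a @ [Plus]) (L_web Minus) b = pad a (X_web Plus) b"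
    using pad_X_web'[of a Plus b] by simp
  have 2: "pad (a @ [Plus]) (Y_web Plus) b \<odot> pad a (L_web Minus) (Plus # b) = pad a (X_web Minus) b"
    using pad_X_web[of a Minus b] by simp
  have 3: "pad a (X_web Minus) b \<odot> pad a (X_web Plus) b
      = id_web (a @ Plus # Minus # b) + pad a (cup_web Plus) b \<odot> pad a (cap_web Plus) b"
    using X_X[of a Plus b] by simp
  have 4: "pad (a @ [Plus]) (Y_web Plus) b \<in> Hom (a @ Plus # Plus # Plus # b)
    (a @ Plus # Minus # b)"
    using Hom_pad[OF Hom_Y_web[of Plus], of "a @ [Plus]" b] by simp
  have 5: "pad a (cap_web Plus) b \<odot> pad (a @ [Plus]) (Y_web Plus) b
    = pad a (cap_web Minus) b \<odot> pad a (Y_web Plus) (Plus # b)"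
    using cap_Y[of a Plus b] by simp
  show ?thesis
    by (simp add: pad_H_web compose_assoc 1[THEN compose_eq_cont] 2[THEN compose_eq_cont]
        3[THEN compose_eq_cont] bilinear id_web_compose[OF 4] 5)
qed

text \<open>Indexed so that \<open>tower n f i\<close> is the web of the summand \<open>i\<close> of
  the recursion on \<open>Suc n\<close> strands; for \<open>i = 1\<close> no \<open>H\<close> occurs
  and the leading term results.\<close>

definition tower :: "nat \<Rightarrow> skein \<Rightarrow> nat \<Rightarrow> skein" where
  "tower n f i = fold (\<lambda>k x. H_at (Suc n) k \<odot> x) [1..<i] (f \<otimes> id_web [Plus])"

context
  fixes n :: nat and f :: skein
  assumes f: "pre_clasp n f"
begin

lemma tower_1: "tower n f (Suc 0) = pad [] f [Plus]"
  by (simp add: tower_def pad_def)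

lemma tower_Suc: "1 \<le> i \<Longrightarrow> tower n f (Suc i) = H_at (Suc n) i \<odot> tower n f i"
  by (simp add: tower_def)

text \<open>The factors \<open>H_at (Suc n) k\<close> with \<open>k < i\<close> act on the
  \<open>b\<close> rightmost strands and slide past the merging. As \<open>b\<close> is positive,
  the merging then lies on the \<open>n\<close> strands of \<open>f\<close>, and \<open>f\<close> is
  killed by it.\<close>

lemma Y_tower_left:
  assumes "1 \<le> i" "i \<le> b" "a + b + 2 = Suc n"
  shows "pad (pluses a) (Y_web Plus) (pluses b) \<odot> tower n f i = 0"
  using assms(1,2)
proof (induction i rule: nat_induct_at_least)
  case base
  then obtain b' where b: "b = Suc b'" by (cases b) auto
  have "pad (pluses a) (Y_web Plus) (pluses b') \<odot> f = 0"
    using f assms(3) b by (auto simp: pre_clasp_def kills_Y_def)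
  moreover have "f \<in> Hom (pluses n) (pluses a @ [Plus, Plus] @ pluses b')"
  proof -
    have "n = a + Suc (Suc b')" using assms(3) b by simp
    then have "pluses n = pluses a @ [Plus, Plus] @ pluses b'"
      by (simp only: pluses_add pluses_Suc) simp
    then show ?thesis using pre_clasp_Hom[OF f] by simp
  qed
  ultimately show ?case
    using pad_compose[OF _ Hom_pad[OF Hom_Y_web[of Plus]], of f "pluses n" "pluses a" "pluses b'"
      "[]" "[Plus]"]
    by (simp add: tower_1 b pluses_snoc)
next
  case (Suc i)
  have "b = (b - Suc i) + Suc (Suc (i - 1))" and "n - i = a + Suc (Suc (b - Suc i))"
    using Suc assms(3) by auto
  then obtain r where b: "pluses b = pluses r @ [Plus, Plus] @ pluses (i - 1)"
    and na: "pluses (n - i) = pluses a @ [Plus, Plus] @ pluses r"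
    by (metis append_Cons append_Nil pluses_Suc pluses_add)
  have comm: "pad (pluses a) (Y_web Plus) (pluses b) \<odot> H_at (Suc n) i
      = pad (pluses a @ Minus # pluses r) H_web (pluses (i - 1))
        \<odot> pad (pluses a) (Y_web Plus) (pluses b)"
    using pad_commute[OF Hom_Y_web[of Plus] Hom_H_web, of "pluses a" "pluses r" "pluses (i - 1)"]
    by (simp add: H_at_eq b na)
  show ?case
    using Suc by (simp add: tower_Suc comm[THEN compose_eq_cont] compose_assoc)
qed

text \<open>The topmost factor sits exactly below the merging and produces a bigon.\<close>

lemma Y_tower_next:
  assumes "a + b + 2 = Suc n"
  shows "pad (pluses a) (Y_web Plus) (pluses b) \<odot> tower n f (Suc (Suc b))
    = - qint 2 *\<^sub>K (pad (pluses a) (Y_web Plus) (pluses b) \<odot> tower n f (Suc b))"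
proof -
  have "n - Suc b = a" using assms by simp
  then show ?thesis
    by (simp add: tower_Suc H_at_eq Y_H[THEN compose_eq_cont] bilinear)
qed

text \<open>The two topmost factors form a square with the merging. The extra summand of
  \<open>Y_H_H\<close> has a merging with \<open>Suc b\<close> strands to its right and vanishes by
  \<open>Y_tower_left\<close>.\<close>

lemma Y_tower_next2:
  assumes "Suc a + b + 2 = Suc n"
  shows "pad (pluses (Suc a)) (Y_web Plus) (pluses b) \<odot> tower n f (Suc (Suc (Suc b)))
    = pad (pluses (Suc a)) (Y_web Plus) (pluses b) \<odot> tower n f (Suc b)"
proof -
  have n: "n - Suc b = Suc a" "n - Suc (Suc b) = a" using assms by auto
  have "pad (pluses a) (Y_web Plus) (pluses (Suc b)) \<odot> tower n f (Suc b) = 0"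
    using assms by (intro Y_tower_left) auto
  then have Y0: "pad (pluses a) (Y_web Plus) (Plus # pluses b) \<odot> tower n f (Suc b) = 0"
    by (simp add: pluses_Suc)
  have "pad (pluses (Suc a)) (Y_web Plus) (pluses b) \<odot> tower n f (Suc (Suc (Suc b)))
    = (pad (pluses a @ [Plus]) (Y_web Plus) (pluses b) \<odot> pad (pluses a) H_web (Plus # pluses b)
      \<odot> pad (pluses a @ [Plus]) H_web (pluses b)) \<odot> tower n f (Suc b)"
    using pluses_snoc[of a] pluses_Suc[of b] by (simp add: tower_Suc H_at_eq n compose_assoc)
  then show ?thesis
    unfolding Y_H_H by (simp add: bilinear compose_assoc Y0 pluses_snoc)
qed

lemma Y_H_at_commute:
  assumes "a + b + 2 = Suc n" "b + 3 \<le> i" "i \<le> n"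
  obtains x where "pad (pluses a) (Y_web Plus) (pluses b) \<odot> H_at (Suc n) i
    = x \<odot> pad (pluses a) (Y_web Plus) (pluses b)"
proof -
  have "a = (n - i) + Suc (Suc (i - b - 3))" and "i - 1 = (i - b - 3) + Suc (Suc b)"
    using assms by auto
  then obtain r where a: "pluses a = pluses (n - i) @ [Plus, Plus] @ pluses r"
    and i: "pluses (i - Suc 0) = pluses r @ [Plus, Plus] @ pluses b"
    by (metis One_nat_def append_Cons append_Nil pluses_Suc pluses_add)
  have "pad (pluses a) (Y_web Plus) (pluses b) \<odot> H_at (Suc n) i
      = pad (pluses (n - i)) H_web (pluses r @ Minus # pluses b)
        \<odot> pad (pluses a) (Y_web Plus) (pluses b)"
    using pad_commute[OF Hom_H_web Hom_Y_web[of Plus], of "pluses (n - i)" "pluses r" "pluses b",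
      symmetric]
    by (simp add: H_at_eq a i)
  then show ?thesis by (rule that)
qed

text \<open>For \<open>i = b + 4\<close> the topmost factor commutes with the merging, and the two
  factors below it disappear by \<open>Y_tower_next2\<close>. Moved back, it applies its own merging
  to \<open>tower n f (Suc b)\<close>, which gives zero. All higher factors commute with the merging
  as well.\<close>

lemma Y_tower_right:
  assumes "a + b + 2 = Suc n" "b + 4 \<le> i" "i \<le> Suc n"
  shows "pad (pluses a) (Y_web Plus) (pluses b) \<odot> tower n f i = 0"
  using assms(2,3)
proof (induction i rule: nat_induct_at_least)
  case base
  let ?Y = "pad (pluses a) (Y_web Plus) (pluses b)"
  have "b + 3 \<le> n" using base by simp
  then obtain x where x: "?Y \<odot> H_at (Suc n) (b + 3) = x \<odot> ?Y"
    using Y_H_at_commute[OF assms(1) order.refl] by blast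
  obtain a' where a: "a = Suc a'" using assms(1) base by (cases a) auto
  have "?Y \<odot> tower n f (b + 4) = x \<odot> ?Y \<odot> tower n f (b + 3)"
    using tower_Suc[of "b + 3"] x[THEN compose_eq_cont]
      by (simp add: compose_assoc eval_nat_numeral)
  also have "?Y \<odot> tower n f (b + 3) = ?Y \<odot> tower n f (Suc b)"
    using Y_tower_next2[of a' b] assms(1) a by (simp add: eval_nat_numeral)
  also have "x \<odot> ?Y \<odot> tower n f (Suc b) = ?Y \<odot> H_at (Suc n) (b + 3) \<odot> tower n f (Suc b)"
    using x[THEN compose_eq_cont] by (simp add: compose_assoc)
  also have "H_at (Suc n) (b + 3) \<odot> tower n f (Suc b) = 0"
  proof -
    have "pad (pluses (n - Suc (Suc (Suc b)))) (Y_web Plus) (pluses (Suc (Suc b)))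
      \<odot> tower n f (Suc b) = 0"
      using assms(1) base by (intro Y_tower_left) auto
    then show ?thesis by (simp add: H_at_eq pad_H_web compose_assoc)
  qed
  finally show ?case by simp
next
  case (Suc i)
  then obtain x where "pad (pluses a) (Y_web Plus) (pluses b) \<odot> H_at (Suc n) i
    = x \<odot> pad (pluses a) (Y_web Plus) (pluses b)"
    using Y_H_at_commute[OF assms(1), of i] by auto
  from this[THEN compose_eq_cont] show ?case
    using Suc by (simp add: tower_Suc compose_assoc)
qed

lemma kills_Y_recursion:
  "kills_Y (Suc n) (\<Sum>i=1..Suc n. (qint (Suc n + 1 - i) / qint (Suc n)) *\<^sub>K tower n f i)"
  unfolding kills_Y_def
proof (intro allI impI)
  fix a b assume ab: "a + b + 2 = Suc n"
  let ?Y = "pad (pluses a) (Y_web Plus) (pluses b)"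
    and ?c = "\<lambda>i. qint (Suc n + 1 - i) / qint (Suc n)"
  let ?T = "?Y \<odot> tower n f (Suc b)"
  have eq: "?Y \<odot> (\<Sum>i=1..Suc n. ?c i *\<^sub>K tower n f i) = (\<Sum>i=1..Suc n. ?c i *\<^sub>K (?Y \<odot> tower n f i))"
    by (simp only: compose_sum_right compose_scale_right)
  have zero: "?Y \<odot> tower n f i = 0" if "1 \<le> i" "i \<le> Suc n"
    "i \<notin> {Suc b, Suc (Suc b), Suc (Suc (Suc b))}" for i
  proof (cases "i \<le> b")
    case True
    then show ?thesis using Y_tower_left[of i b a] that ab by simp
  next
    case False
    then show ?thesis using Y_tower_right[of a b i] that ab by simp
  qed
  have "qint (Suc (Suc a)) = qint 2 * qint (Suc a) - qint a"
    using qint_rec[of a] by (simp add: eq_diff_eq)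
  then have rec: "qint (Suc (Suc a)) / qint (Suc n) - qint 2 * (qint (Suc a) / qint (Suc n))
    + qint a / qint (Suc n) = 0"
    by (simp add: add_divide_distrib[symmetric] diff_divide_distrib[symmetric])
  have c: "?c (Suc b) = qint (Suc (Suc a)) / qint (Suc n)"
    "?c (Suc (Suc b)) = qint (Suc a) / qint (Suc n)"
    "?c (Suc (Suc (Suc b))) = qint a / qint (Suc n)"
  proof -
    have "Suc n + 1 - Suc b = Suc (Suc a)" "Suc n + 1 - Suc (Suc b) = Suc a"
      "Suc n + 1 - Suc (Suc (Suc b)) = a"
      using ab by auto
    then show "?c (Suc b) = qint (Suc (Suc a)) / qint (Suc n)"
      "?c (Suc (Suc b)) = qint (Suc a) / qint (Suc n)"
      "?c (Suc (Suc (Suc b))) = qint a / qint (Suc n)" by simp_all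
  qed
  have "(\<Sum>i=1..Suc n. ?c i *\<^sub>K (?Y \<odot> tower n f i))
    = (qint (Suc (Suc a)) / qint (Suc n) - qint 2 * (qint (Suc a) / qint (Suc n))
      + qint a / qint (Suc n)) *\<^sub>K ?T"
  proof (cases a)
    \<comment> \<open>Only two terms are left, since the index \<open>b + 3\<close> exceeds
      \<open>Suc n\<close>; the missing coefficient would be \<open>qint 0 = 0\<close>, so the same
      formula holds.\<close>
    case 0
    have "(\<Sum>i=1..Suc n. ?c i *\<^sub>K (?Y \<odot> tower n f i))
      = (\<Sum>i\<in>{Suc b, Suc (Suc b)}. ?c i *\<^sub>K (?Y \<odot> tower n f i))"
      by (rule sum.mono_neutral_right) (use zero ab 0 in auto)
    also have "\<dots> = ?c (Suc b) *\<^sub>K ?T + ?c (Suc (Suc b)) *\<^sub>K (- qint 2 *\<^sub>K ?T)"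
      using Y_tower_next[OF ab] by simp
    also have "\<dots> = (qint (Suc (Suc a)) / qint (Suc n) - qint 2 * (qint (Suc a) / qint (Suc n))
        + qint a / qint (Suc n)) *\<^sub>K ?T"
      unfolding c by (simp add: 0 skein.scale_left_diff_distrib mult.commute)
    finally show ?thesis .
  next
    case (Suc a')
    have "(\<Sum>i=1..Suc n. ?c i *\<^sub>K (?Y \<odot> tower n f i))
        = (\<Sum>i\<in>{Suc b, Suc (Suc b), Suc (Suc (Suc b))}. ?c i *\<^sub>K (?Y \<odot> tower n f i))"
      by (rule sum.mono_neutral_right) (use zero ab Suc in auto)
    also have "\<dots> = ?c (Suc b) *\<^sub>K ?T + ?c (Suc (Suc b)) *\<^sub>K (- qint 2 *\<^sub>K ?T)
      + ?c (Suc (Suc (Suc b))) *\<^sub>K ?T"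
      using Y_tower_next[OF ab] Y_tower_next2[of a' b] ab Suc by (simp add: add.assoc)
    also have "\<dots> = (qint (Suc (Suc a)) / qint (Suc n) - qint 2 * (qint (Suc a) / qint (Suc n))
        + qint a / qint (Suc n)) *\<^sub>K ?T"
      unfolding c by (simp add: skein.scale_left_diff_distrib skein.scale_left_distrib mult.commute)
    finally show ?thesis .
  qed
  then show "?Y \<odot> (\<Sum>i=1..Suc n. ?c i *\<^sub>K tower n f i) = 0"
    unfolding eq rec by simp
qed

text \<open>\<open>H_at (Suc n) 1\<close> has a merging at its bottom and lies in the ideal.
  Replacing \<open>f\<close> by the identity changes the composite by an element of the ideal only,
  and further factors on top remain in a left ideal.\<close>

lemma tower_Y_ideal:
  assumes "2 \<le> i" "i \<le> Suc n"
  shows "tower n f i \<in> Y_ideal (Suc n) (pluses (Suc n))"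
  using assms
proof (induction i rule: nat_induct_at_least)
  case base
  then obtain n' where n: "n = Suc n'" by (cases n) auto
  have H: "H_at (Suc n) 1 \<in> Y_ideal (Suc n) (pluses (Suc n))"
  proof -
    have "pad (pluses n') (L_web Minus) [] \<in> Hom (pluses n' @ Minus # pluses 0) (pluses (Suc n))"
      using Hom_pad[OF Hom_L_web[of Minus], of "pluses n'" "[]"] by (simp add: n pluses_snoc)
    from Y_ideal_gen[OF _ this, of "Suc n"] show ?thesis by (simp add: n H_at_eq pad_H_web)
  qed
  have x: "pad [] (f - id_web (pluses n)) [Plus] \<in> Y_ideal (Suc n) (pluses (Suc n))"
    using f Y_ideal_widen[of "f - id_web (pluses n)" n "pluses n"]
      by (simp add: pre_clasp_def pluses_snoc)
  have "tower n f 1 = id_web (pluses (Suc n)) + pad [] (f - id_web (pluses n)) [Plus]"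
    using pad_add[of "[]" "f - id_web (pluses n)" "id_web (pluses n)" "[Plus]"]
      by (simp add: tower_1 pluses_snoc)
  then have "tower n f 2 = H_at (Suc n) 1 + H_at (Suc n) 1 \<odot> pad [] (f - id_web (pluses n)) [Plus]"
    using tower_Suc[of 1] compose_id_web[OF Y_ideal_Hom[OF H]]
      by (simp add: numeral_2_eq_2 bilinear)
  then show ?case using Y_ideal_add[OF H Y_ideal_compose[OF x Y_ideal_Hom[OF H]]] by simp
next
  case (Suc i)
  have "pluses (Suc n) = pluses (n - i) @ [Plus, Plus] @ pluses (i - 1)"
  proof -
    have "Suc n = (n - i) + Suc (Suc (i - 1))" using Suc by simp
    then show ?thesis by (metis append_Cons append_Nil pluses_Suc pluses_add)
  qed
  then have "H_at (Suc n) i \<in> Hom (pluses (Suc n)) (pluses (Suc n))"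
    using Hom_pad[OF Hom_H_web, of "pluses (n - i)" "pluses (i - 1)"] by (simp add: H_at_eq)
  with Suc show ?case by (simp add: tower_Suc Y_ideal_compose)
qed

lemma pre_clasp_recursion:
  "pre_clasp (Suc n) (tower n f 1
    + (\<Sum>i=2..Suc n. (qint (Suc n + 1 - i) / qint (Suc n)) *\<^sub>K tower n f i))"
proof -
  let ?c = "\<lambda>i. qint (Suc n + 1 - i) / qint (Suc n)"
  have "(\<Sum>i=1..Suc n. ?c i *\<^sub>K tower n f i)
    = ?c 1 *\<^sub>K tower n f 1 + (\<Sum>i=2..Suc n. ?c i *\<^sub>K tower n f i)"
    using sum.atLeast_Suc_atMost[of 1 "Suc n" "\<lambda>i. ?c i *\<^sub>K tower n f i"]
      by (simp add: numeral_2_eq_2)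
  \<comment> \<open>The coefficient for \<open>i = 1\<close> is
    \<open>qint (Suc n) / qint (Suc n)\<close>, that is 1, so the leading term joins the
    sum.\<close>
  then have eq: "tower n f 1 + (\<Sum>i=2..Suc n. ?c i *\<^sub>K tower n f i)
    = (\<Sum>i=1..Suc n. ?c i *\<^sub>K tower n f i)"
    using qint_neq_0[of "Suc n"] by simp
  have "(\<Sum>i=2..Suc n. ?c i *\<^sub>K tower n f i) \<in> Y_ideal (Suc n) (pluses (Suc n))"
    unfolding Y_ideal_def by (intro skein.span_sum skein.span_scale)
      (use tower_Y_ideal in \<open>auto simp: Y_ideal_def\<close>)
  moreover have "tower n f 1 - id_web (pluses (Suc n)) \<in> Y_ideal (Suc n) (pluses (Suc n))"
  proof -
    have "pad [] (f - id_web (pluses n)) [Plus] \<in> Y_ideal (Suc n) (pluses (Suc n))"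
      using f Y_ideal_widen[of "f - id_web (pluses n)" n "pluses n"]
        by (simp add: pre_clasp_def pluses_snoc)
    then show ?thesis
      using pad_add[of "[]" "f - id_web (pluses n)" "id_web (pluses n)" "[Plus]"]
        by (simp add: tower_1 pluses_snoc)
  qed
  ultimately have "(tower n f 1 - id_web (pluses (Suc n)))
    + (\<Sum>i=2..Suc n. ?c i *\<^sub>K tower n f i) \<in> Y_ideal (Suc n) (pluses (Suc n))"
    by (intro Y_ideal_add)
  moreover have "(tower n f 1 - id_web (pluses (Suc n))) + (\<Sum>i=2..Suc n. ?c i *\<^sub>K tower n f i)
      = tower n f 1 + (\<Sum>i=2..Suc n. ?c i *\<^sub>K tower n f i) - id_web (pluses (Suc n))"
    by (simp add: algebra_simps)
  ultimately show ?thesis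
    using kills_Y_recursion unfolding pre_clasp_def eq by metis
qed

end

lemma f_clasp_eq: "pre_clasp n g \<Longrightarrow> f_clasp n = g"
  by (intro pre_clasp_f_clasp pre_clasp_neq_0)

text \<open>Starting from the empty web, the right-hand side of the recursion itself supplies the
  next clasp, and uniqueness identifies it with the value chosen by \<open>THE\<close>.\<close>

lemma pre_clasp_f: "pre_clasp n (f_clasp n)"
proof (induction n)
  case 0
  have "pre_clasp 0 (id_web [])"
    by (simp add: pre_clasp_def kills_Y_def Y_ideal_zero)
  then show ?case using f_clasp_eq by metis
next
  case (Suc n)
  from pre_clasp_recursion[OF Suc] show ?case using f_clasp_eq by metis
qed

theorem proposition3p1:
  fixes n :: nat
  assumes "n \<ge> 1"
  shows "f_clasp n = f_clasp (n - 1) \<otimes> id_web [Plus]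
    + (\<Sum>i=2..n. (qint (n + 1 - i) / qint n) *\<^sub>K
        fold (\<lambda>k x. H_at n k \<odot> x) [1..<i] (f_clasp (n - 1) \<otimes> id_web [Plus]))"
proof -
  obtain m where n: "n = Suc m" using assms by (cases n) auto
  show ?thesis
    using f_clasp_eq[OF pre_clasp_recursion[OF pre_clasp_f[of m]]]
    unfolding n tower_def by simp
qed

end
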